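(* Let $k\ge1$ be an integer. (1) Let $Y_0>0$ and $\kappa\in\mathbb R$ be fixed and let $Y(x)=Y_0\exp\big(\kappa\frac{\log x}{\log\log(x+1)}\big)$. Then, for $x\ge1.9$, $$M_{k,\omega}(x,Y(x))\ll_k\frac{x(\log\log(x+1))^k}{\log x}.$$ (2) More generally, there is a constant $\mathscr B_k$, depending on $k$ but on no other variables or parameters, such that for all $1.9\le y\le x^{1/k}$ $$M_{k,\omega}(x,y)\le\mathscr B_k\,x\log y\,(\log\log(x+1))^{k-1}.$$
   Context: $\log$ is the natural logarithm, $\mu$ is the Möbius function, $\omega(n)$ is the number of distinct prime factors of $n$, $p_1(n)$ is the smallest prime factor of $n$, with $p_1(1)=\infty$, and $$M_{k,\omega}(x,y)=\sum_{\substack{n\le x\\ p_1(n)>y}}\mu(n)\binom{\omega(n)-1}{k-1},$$ where for $n=1$ the generalized binomial coefficient is $\binom{-1}{k-1}=(-1)^{k-1}$. In (1) the implied constant may depend on $k$ and on the fixed parameters $Y_0$ and $\kappa$. *)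

theory Defs
  imports "HOL-Analysis.Analysis" "HOL-Computational_Algebra.Squarefree"
begin

definition moebius :: "nat \<Rightarrow> int" where
  "moebius n = (if squarefree n then (-1) ^ card (prime_factors n) else 0)"

definition omega :: "nat \<Rightarrow> nat" where
  "omega n = card (prime_factors n)"

definition least_prime_factor :: "nat \<Rightarrow> ereal" where
  "least_prime_factor n = (if n = 1 then \<infinity> else ereal (real (Min (prime_factors n))))"

(* The subtraction is done in the reals: for n = 1 the upper entry of the
   (generalized) binomial coefficient is -1. *)
definition M_omega :: "nat \<Rightarrow> real \<Rightarrow> real \<Rightarrow> real" where
  "M_omega k x y =
     (\<Sum>n | 1 \<le> n \<and> real n \<le> x \<and> least_prime_factor n > ereal y.
        of_int (moebius n) * ((real (omega n) - 1) gchoose (k - 1)))"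

definition Y_fun :: "real \<Rightarrow> real \<Rightarrow> real \<Rightarrow> real" where
  "Y_fun Y0 \<kappa> x = Y0 * exp (\<kappa> * (ln x / ln (ln (x + 1))))"

lemma gchoose_minus_one: "(-1 :: real) gchoose m = (-1) ^ m"
  using gbinomial_minus[of "1::real" m] by (simp add: binomial_gbinomial[symmetric])

end

theory Submission
  imports Defs "HOL-Complex_Analysis.Complex_Analysis" "HOL-Probability.Probability"
    "HOL-Real_Asymp.Real_Asymp"
begin

text \<open>
  The weight \<open>binomial(\<omega>(n) - 1, k - 1)\<close> is, by Vandermonde's identity, a signed sum of the
  coefficients \<open>binomial(\<omega>(n), j)\<close> with \<open>j < k\<close>, also for \<open>n = 1\<close>. The sums over squarefree integers
  weighted by such a coefficient obey a recursion in \<open>j\<close> that removes one prime factor at a time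
  (\<open>omega_sum_Suc\<close>), and each step costs only a sum over primes, hence a factor \<open>log log x\<close>
  (\<open>omega_sum_bound\<close>). So everything is reduced to \<open>j = 0\<close>.

  With absolute values the case \<open>j = 0\<close> is the trivial bound \<open>x\<close>. This gives
  \<open>M_omega k x y = O(x (log log x)^(k-1))\<close> for all \<open>y\<close>, and the second claim follows because
  \<open>log y\<close> is bounded below.

  For the first claim the sign of \<open>\<kappa>\<close> decides. If \<open>\<kappa> > 0\<close>, a count with absolute values is enough: an
  integer up to \<open>x\<close> whose prime factors all exceed \<open>y = Y(x)\<close> has at most
  \<open>log x / log y = O(log log x)\<close> of them, and an elementary sieve argument leaves only
  \<open>O(x / log y)\<close> such squarefree integers (\<open>card_rough_squarefree_le\<close>).

  If \<open>\<kappa> \<le> 0\<close>, then \<open>Y(x) \<le> Y0\<close>, and one needs \<open>sum_{n \<le> x} \<mu>(n) = O(x / log x)\<close>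
  (\<open>moebius_sum_bound\<close>), which is stronger than the prime number theorem without an error term. It
  survives the condition that \<open>n\<close> avoid a finite set of primes, with a loss of a factor 7 for each
  prime (\<open>omega_sum_0_coprime_bound\<close>), and can then be fed into the recursion.

  The bound for the sum of the Moebius function comes from the second derivative
  \<open>G(s) = sum \<mu>(n) (log n)^2 n^(-s)\<close> of \<open>1/\<zeta>(s)\<close>. The inequality
  \<open>|\<zeta>(\<sigma>)^3 \<zeta>(\<sigma> + it)^4 \<zeta>(\<sigma> + 2it)| \<ge> 1\<close> and a bound \<open>\<zeta>(s) = O(|s|^a)\<close> slightly to the left of
  \<open>Re s = 1\<close>, with a small exponent \<open>a\<close>, give \<open>G(s) = O(|s|)\<close> uniformly for \<open>1 < Re s < 1 + \<delta>\<close>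
  (\<open>moebius_ln2_series_bound\<close>). Now \<open>G(s)/s\<close> is the Laplace transform of
  \<open>S(e^v) = sum_{n \<le> e^v} \<mu>(n) (log n)^2\<close>. Its boundedness on the line \<open>Re s = 1 + 1/V\<close> bounds the
  Gaussian mean of \<open>S(e^v) e^(-(1+1/V)v)\<close> over a window of width \<open>1/V\<close> about \<open>V = log x\<close>
  (\<open>gaussian_average_eq\<close>). On that window the function changes by \<open>O(V)\<close> only
  (\<open>damped_sum_lipschitz\<close>), so \<open>S(x) = O(x log x)\<close>, and replacing the weight \<open>(log n)^2\<close> by
  \<open>(log x)^2\<close> costs another \<open>O(x log x)\<close>.
\<close>

section \<open>Chebyshev's bound and sums over primes\<close>

definition primes_upto :: "real \<Rightarrow> nat set" where
  "primes_upto x = {p. prime p \<and> real p \<le> x}"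

lemma finite_nat_le_real: "finite {n::nat. real n \<le> x \<and> P n}"
proof (rule finite_subset)
  show "{n::nat. real n \<le> x \<and> P n} \<subseteq> {..nat \<lfloor>x\<rfloor>}"
    by (auto simp: le_nat_floor)
qed auto

lemma finite_primes_upto [simp]: "finite (primes_upto x)"
  unfolding primes_upto_def using finite_nat_le_real[of x prime] by (simp add: conj_commute)

lemma primes_uptoD:
  assumes "p \<in> primes_upto x"
  shows "prime p" "real p \<le> x" "2 \<le> p" "0 < p"
  using assms prime_ge_2_nat[of p] unfolding primes_upto_def by auto

lemma prod_primes_dvd:
  fixes n :: nat
  assumes "finite A" "\<And>p. p \<in> A \<Longrightarrow> prime p \<and> p dvd n"
  shows "\<Prod>A dvd n"
  using assms
proof (induction A rule: finite_induct)
  case (insert p A)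
  have "coprime p (\<Prod>A)"
    by (rule prod_coprime_right) (metis insert.hyps(2) insert.prems insertCI primes_coprime)
  with insert show ?case by (simp add: divides_mult)
qed auto

text \<open>Every prime in \<open>(n, 2n]\<close> divides the central binomial coefficient, which is at most \<open>4^n\<close>.\<close>

lemma sum_ln_primes_doubling:
  "(\<Sum>p | prime p \<and> n < p \<and> p \<le> 2 * n. ln (real p)) \<le> 2 * real n * ln 2"
proof -
  let ?A = "{p. prime p \<and> n < p \<and> p \<le> 2 * n}"
  have fin: "finite ?A" by simp
  have dvd: "p dvd (2 * n choose n)" if "p \<in> ?A" for p
  proof -
    have "p dvd fact (2 * n)" using that prime_dvd_fact_iff[of p "2*n"] by auto
    also have "fact (2 * n) = fact n * fact n * (2 * n choose n)"
      using binomial_fact_lemma[of n "2*n"] by (simp add: mult_2)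
    finally show ?thesis using that prime_dvd_fact_iff[of p n]
      by (auto simp: prime_dvd_mult_iff)
  qed
  have "\<Prod>?A dvd (2 * n choose n)"
    by (rule prod_primes_dvd[OF fin]) (use dvd in auto)
  hence "\<Prod>?A \<le> (2 * n choose n)" by (rule dvd_imp_le) auto
  also have "\<dots> \<le> 2 ^ (2 * n)" by (rule binomial_le_pow2)
  finally have "real (\<Prod>?A) \<le> real (2 ^ (2 * n))" by (simp only: of_nat_le_iff)
  hence le: "real (\<Prod>?A) \<le> 2 ^ (2 * n)" by (simp only: of_nat_power of_nat_numeral)
  have pos: "real p > 0" if "p \<in> ?A" for p using that by auto
  have "(\<Sum>p\<in>?A. ln (real p)) = ln (\<Prod>p\<in>?A. real p)"
    by (rule ln_prod[symmetric]) (use fin pos in auto)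
  also have "\<dots> = ln (real (\<Prod>?A))" by (simp add: of_nat_prod)
  also have "\<dots> \<le> ln (2 ^ (2 * n))"
  proof (rule ln_mono)
    show "0 < real (\<Prod>?A)" by (simp only: of_nat_prod, rule prod_pos) (use pos in auto)
  qed (use le in auto)
  also have "\<dots> = 2 * real n * ln 2" by (simp add: ln_realpow)
  finally show ?thesis .
qed

definition theta :: "real \<Rightarrow> real" where
  "theta x = (\<Sum>p\<in>primes_upto x. ln (real p))"

lemma theta_mono: "x \<le> y \<Longrightarrow> theta x \<le> theta y"
  unfolding theta_def
  by (rule sum_mono2, rule finite_primes_upto)
     (auto simp: primes_upto_def intro!: ln_ge_zero dest: prime_ge_1_nat)

text \<open>Halving \<open>n\<close> repeatedly turns the doubling estimate into Chebyshev's upper bound; \<open>3\<close> exceeds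
  \<open>4 log 2\<close> by enough to absorb the rounding in \<open>(n + 1) div 2\<close>.\<close>

lemma theta_nat_le: "theta (real n) \<le> 3 * real n"
proof (induction n rule: less_induct)
  case (less n)
  have l2: "ln 2 \<le> (25/36 :: real)" by (rule ln2_le_25_over_36)
  show ?case
  proof (cases "n \<le> 2")
    case True
    have "theta (real n) \<le> theta 2" by (rule theta_mono) (use True in auto)
    moreover have "primes_upto 2 = {2}" by (auto simp: primes_upto_def dest: prime_ge_2_nat)
    hence "theta 2 = ln 2" by (simp add: theta_def)
    moreover have "theta (real n) = 0" if "n < 2"
    proof -
      have "primes_upto (real n) = {}" using that by (auto simp: primes_upto_def dest: prime_ge_2_nat)
      thus ?thesis by (simp add: theta_def)
    qed
    ultimately show ?thesis using l2 True by (cases "n < 2") auto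
  next
    case False
    define m where "m = (n + 1) div 2"
    have m: "m < n" "n \<le> 2 * m" "2 * m \<le> n + 1" using False unfolding m_def by auto
    have "theta (real n) \<le> theta (real (2 * m))" by (rule theta_mono) (use m in auto)
    also have "theta (real (2 * m)) = theta (real m) + (\<Sum>p | prime p \<and> m < p \<and> p \<le> 2 * m. ln (real p))"
    proof -
      have "primes_upto (real (2 * m)) = primes_upto (real m) \<union> {p. prime p \<and> m < p \<and> p \<le> 2 * m}"
        by (auto simp: primes_upto_def)
      moreover have "primes_upto (real m) \<inter> {p. prime p \<and> m < p \<and> p \<le> 2 * m} = {}"
        by (auto simp: primes_upto_def)
      ultimately show ?thesis unfolding theta_def by (simp add: sum.union_disjoint)
    qed
    also have "\<dots> \<le> 3 * real m + 2 * real m * ln 2"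
      using less.IH[OF m(1)] sum_ln_primes_doubling[of m] by linarith
    also have "\<dots> \<le> 3 * real m + 2 * real m * (25/36)"
      using l2 by (intro add_left_mono mult_left_mono) auto
    also have "\<dots> \<le> 3 * real n" using m False by linarith
    finally show ?thesis .
  qed
qed

lemma theta_le: assumes "x \<ge> 0" shows "theta x \<le> 3 * x"
proof -
  have "primes_upto x = primes_upto (real (nat \<lfloor>x\<rfloor>))"
    using assms unfolding primes_upto_def by (intro Collect_cong conj_cong refl) (simp only: of_nat_le_iff, simp add: le_nat_iff le_floor_iff)
  hence "theta x = theta (real (nat \<lfloor>x\<rfloor>))" by (simp add: theta_def)
  also have "\<dots> \<le> 3 * real (nat \<lfloor>x\<rfloor>)" by (rule theta_nat_le)
  also have "\<dots> \<le> 3 * x" using assms by linarith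
  finally show ?thesis .
qed

text \<open>Among the primes \<open>p\<close> with \<open>x / e^(i+1) < p \<le> x / e^i\<close> the sum of \<open>log p / p\<close> is bounded by
  Chebyshev's bound, so a weight that is controlled on each of these blocks can be summed block by
  block, at the cost of a constant.\<close>

lemma sum_primes_block_le:
  fixes g :: "nat \<Rightarrow> real"
  assumes x: "x \<ge> 1" and W: "\<And>i. 0 \<le> W i"
    and g: "\<And>p. p \<in> primes_upto x \<Longrightarrow> g p \<le> W (nat \<lfloor>ln (x / real p)\<rfloor>)"
  shows "(\<Sum>p\<in>primes_upto x. ln (real p) / real p * g p) \<le> 3 * exp 1 * (\<Sum>i\<le>nat \<lfloor>ln x\<rfloor>. W i)"
proof -
  define b where "b p = nat \<lfloor>ln (x / real p)\<rfloor>" for p :: nat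
  have bi: "b ` primes_upto x \<subseteq> {..nat \<lfloor>ln x\<rfloor>}"
  proof
    fix i assume "i \<in> b ` primes_upto x"
    then obtain p where p: "p \<in> primes_upto x" "i = b p" by auto
    have "ln (x / real p) \<le> ln x"
      using primes_uptoD[OF p(1)] x by (subst ln_le_cancel_iff) (auto simp: field_simps)
    thus "i \<in> {..nat \<lfloor>ln x\<rfloor>}" unfolding p(2) b_def by (simp add: floor_mono nat_mono)
  qed
  have "(\<Sum>p\<in>primes_upto x. ln (real p) / real p * g p)
      = (\<Sum>i\<le>nat \<lfloor>ln x\<rfloor>. \<Sum>p | p \<in> primes_upto x \<and> b p = i. ln (real p) / real p * g p)"
    by (rule sum.group[OF _ _ bi, symmetric]) auto
  also have "\<dots> \<le> (\<Sum>i\<le>nat \<lfloor>ln x\<rfloor>. 3 * exp 1 * W i)"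
  proof (rule sum_mono)
    fix i assume "i \<in> {..nat \<lfloor>ln x\<rfloor>}"
    have "(\<Sum>p | p \<in> primes_upto x \<and> b p = i. ln (real p) / real p * g p)
        \<le> (\<Sum>p | p \<in> primes_upto x \<and> b p = i. ln (real p) * (exp (real i + 1) / x * W i))"
    proof (rule sum_mono)
      fix p assume p: "p \<in> {p. p \<in> primes_upto x \<and> b p = i}"
      note pp = primes_uptoD[of p x]
      have "ln (x / real p) < real i + 1"
        using p unfolding b_def by (simp, linarith)
      hence "exp (ln (x / real p)) < exp (real i + 1)" by (simp only: exp_less_cancel_iff)
      moreover have "exp (ln (x / real p)) = x / real p" using p pp x by (subst exp_ln) auto
      ultimately have "x / real p < exp (real i + 1)" by simp
      hence 1: "1 / real p \<le> exp (real i + 1) / x" using p pp x by (auto simp: field_simps)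
      have "ln (real p) / real p * g p \<le> ln (real p) / real p * W i"
        using p pp g[of p] by (intro mult_left_mono) (auto simp: b_def)
      also have "\<dots> = ln (real p) * (1 / real p * W i)" by simp
      also have "\<dots> \<le> ln (real p) * (exp (real i + 1) / x * W i)"
        using 1 p pp W[of i] by (intro mult_left_mono mult_right_mono) auto
      finally show "ln (real p) / real p * g p \<le> ln (real p) * (exp (real i + 1) / x * W i)" .
    qed
    also have "\<dots> = (\<Sum>p | p \<in> primes_upto x \<and> b p = i. ln (real p)) * (exp (real i + 1) / x * W i)"
      by (rule sum_distrib_right[symmetric])
    also have "\<dots> \<le> theta (x / exp (real i)) * (exp (real i + 1) / x * W i)"
    proof (rule mult_right_mono)
      show "(\<Sum>p | p \<in> primes_upto x \<and> b p = i. ln (real p)) \<le> theta (x / exp (real i))"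
        unfolding theta_def
      proof (rule sum_mono2)
        show "{p \<in> primes_upto x. b p = i} \<subseteq> primes_upto (x / exp (real i))"
        proof
          fix p assume "p \<in> {p. p \<in> primes_upto x \<and> b p = i}"
          hence p: "p \<in> primes_upto x" "b p = i" by auto
          note pp = primes_uptoD[OF p(1)]
          have "ln (x / real p) \<ge> 0" using p pp x by auto
          hence "ln (x / real p) \<ge> real i" using p unfolding b_def by linarith
          hence "exp (ln (x / real p)) \<ge> exp (real i)" by (simp only: exp_le_cancel_iff)
          moreover have "exp (ln (x / real p)) = x / real p" using p pp x by (subst exp_ln) auto
          ultimately have "exp (real i) \<le> x / real p" by simp
          hence "exp (real i) * real p \<le> x" using pp(4) by (subst (asm) pos_le_divide_eq) auto
          hence "real p \<le> x / exp (real i)" by (subst pos_le_divide_eq) (auto simp: mult.commute)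
          thus "p \<in> primes_upto (x / exp (real i))" using pp(1) by (simp add: primes_upto_def)
        qed
      qed (auto dest!: primes_uptoD)
      show "0 \<le> exp (real i + 1) / x * W i" using x W by auto
    qed
    also have "\<dots> \<le> (3 * (x / exp (real i))) * (exp (real i + 1) / x * W i)"
      using x W by (intro mult_right_mono theta_le) auto
    also have "\<dots> = 3 * exp 1 * W i" using x by (simp add: exp_add field_simps)
    finally show "(\<Sum>p | p \<in> primes_upto x \<and> b p = i. ln (real p) / real p * g p) \<le> 3 * exp 1 * W i" .
  qed
  also have "\<dots> = 3 * exp 1 * (\<Sum>i\<le>nat \<lfloor>ln x\<rfloor>. W i)" by (simp add: sum_distrib_left)
  finally show ?thesis .
qed

text \<open>A version of \<open>log log x\<close> that is at least \<open>1\<close> on all of \<open>[1, \<infinity>)\<close>, so that powers of it are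
  monotone in the exponent.\<close>

definition iter_log :: "real \<Rightarrow> real" where
  "iter_log x = 1 + ln (1 + ln x)"

lemma iter_log_ge_1: "x \<ge> 1 \<Longrightarrow> iter_log x \<ge> 1"
  unfolding iter_log_def by simp

lemma iter_log_mono: "1 \<le> x \<Longrightarrow> x \<le> y \<Longrightarrow> iter_log x \<le> iter_log y"
  unfolding iter_log_def by (simp add: add_pos_nonneg)

lemma harm_le_1_plus_ln: "n \<ge> 1 \<Longrightarrow> harm n \<le> (1 + ln (real n) :: real)"
proof -
  assume "n \<ge> 1"
  then obtain m where m: "n = Suc m" by (cases n) auto
  have "harm (Suc m) - ln (real (Suc m)) \<le> harm (Suc 0) - ln (real (Suc 0))"
    using decseq_harm_diff_ln unfolding decseq_def by blast
  thus ?thesis unfolding m by (simp add: harm_def)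
qed

lemma sum_inverse_le_iter_log:
  assumes "x \<ge> 1"
  shows "(\<Sum>i\<le>nat \<lfloor>ln x\<rfloor>. 1 / (1 + real i)) \<le> iter_log x"
proof -
  have "(\<Sum>i\<le>N. 1 / (1 + real i)) = harm (Suc N)" for N
    by (induction N) (simp_all add: harm_def divide_inverse)
  hence "(\<Sum>i\<le>nat \<lfloor>ln x\<rfloor>. 1 / (1 + real i)) \<le> 1 + ln (real (Suc (nat \<lfloor>ln x\<rfloor>)))"
    using harm_le_1_plus_ln[of "Suc (nat \<lfloor>ln x\<rfloor>)"] by simp
  also have "ln (real (Suc (nat \<lfloor>ln x\<rfloor>))) \<le> ln (1 + ln x)"
  proof -
    have "real (nat \<lfloor>ln x\<rfloor>) \<le> ln x" using assms by simp
    thus ?thesis using assms by (subst ln_le_cancel_iff) (auto simp del: of_nat_nat intro: add_pos_nonneg)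
  qed
  finally show ?thesis by (simp add: iter_log_def)
qed

lemma sum_ln_prime_weighted_le:
  assumes "x \<ge> 1"
  shows "(\<Sum>p\<in>primes_upto x. ln (real p) / real p * (1 / (1 + ln (x / real p)))) \<le> 9 * exp 1 * iter_log x"
proof -
  have "(\<Sum>p\<in>primes_upto x. ln (real p) / real p * (1 / (1 + ln (x / real p))))
      \<le> 3 * exp 1 * (\<Sum>i\<le>nat \<lfloor>ln x\<rfloor>. 1 / (1 + real i))"
  proof (rule sum_primes_block_le[OF assms])
    fix p assume p: "p \<in> primes_upto x"
    have "ln (x / real p) \<ge> 0" using primes_uptoD[OF p] assms by auto
    thus "1 / (1 + ln (x / real p)) \<le> 1 / (1 + real (nat \<lfloor>ln (x / real p)\<rfloor>))"
      by (intro divide_left_mono mult_pos_pos add_pos_nonneg) auto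
  qed auto
  also have "\<dots> \<le> 3 * exp 1 * iter_log x"
    by (intro mult_left_mono sum_inverse_le_iter_log assms) auto
  also have "\<dots> \<le> 9 * exp 1 * iter_log x" using iter_log_ge_1[OF assms] by simp
  finally show ?thesis .
qed

text \<open>Here \<open>1/p = (log p / p) / log p\<close>, and on the \<open>i\<close>-th block \<open>log p\<close> is comparable to the distance of
  \<open>i\<close> from the last block; the harmonic sum is run through backwards.\<close>

lemma sum_prime_reciprocals_le:
  assumes "x \<ge> 1"
  shows "(\<Sum>p\<in>primes_upto x. 1 / real p) \<le> 9 * exp 1 * iter_log x"
proof -
  define N where "N = nat \<lfloor>ln x\<rfloor>"
  define W where "W i = 3 / (1 + real (N - i))" for i
  have "(\<Sum>p\<in>primes_upto x. 1 / real p) = (\<Sum>p\<in>primes_upto x. ln (real p) / real p * (1 / ln (real p)))"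
  proof (rule sum.cong)
    fix p assume "p \<in> primes_upto x"
    from primes_uptoD[OF this] have "ln (real p) > 0" by simp
    thus "1 / real p = ln (real p) / real p * (1 / ln (real p))" by simp
  qed auto
  also have "\<dots> \<le> 3 * exp 1 * (\<Sum>i\<le>nat \<lfloor>ln x\<rfloor>. W i)"
  proof (rule sum_primes_block_le[OF assms])
    fix p assume p: "p \<in> primes_upto x"
    note pp = primes_uptoD[OF p]
    define i where "i = nat \<lfloor>ln (x / real p)\<rfloor>"
    have l2: "ln 2 \<le> ln (real p)" using pp by (subst ln_le_cancel_iff) auto
    have g2: "ln 2 \<ge> (2/3 :: real)" by (rule ln2_ge_two_thirds)
    have "ln (x / real p) = ln x - ln (real p)" using pp assms by (simp add: ln_div)
    moreover have "ln (x / real p) < real i + 1" unfolding i_def by linarith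
    moreover have "real N \<le> ln x" unfolding N_def using assms by simp
    ultimately have l3: "ln (real p) > real N - real i - 1" by linarith
    have "1 + real (N - i) \<le> 3 * ln (real p)"
    proof (cases "N \<le> i + 1")
      case True
      hence "real (N - i) \<le> 1" by simp
      thus ?thesis using l2 g2 by linarith
    next
      case False
      hence "real (N - i) = real N - real i" "real N - real i \<ge> 2" by linarith+
      thus ?thesis using l3 by linarith
    qed
    moreover have "ln (real p) > 0" using l2 g2 by linarith
    ultimately have "1 / ln (real p) \<le> W i" unfolding W_def by (simp add: field_simps)
    thus "1 / ln (real p) \<le> W (nat \<lfloor>ln (x / real p)\<rfloor>)" by (simp add: i_def)
  qed (auto simp: W_def)
  also have "(\<Sum>i\<le>nat \<lfloor>ln x\<rfloor>. W i) = (\<Sum>i\<le>N. 3 / (1 + real i))"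
    unfolding N_def[symmetric] W_def by (rule sum.reindex_bij_witness[of _ "\<lambda>i. N - i" "\<lambda>i. N - i"]) auto
  also have "\<dots> = 3 * (\<Sum>i\<le>N. 1 / (1 + real i))" by (simp add: sum_distrib_left)
  also have "3 * exp 1 * \<dots> \<le> 3 * exp 1 * (3 * iter_log x)"
    unfolding N_def by (intro mult_left_mono sum_inverse_le_iter_log assms) auto
  finally show ?thesis by simp
qed

text \<open>From \<open>log x = log p + log (x/p)\<close> the quotient \<open>(1 + log x) / (1 + log (x/p))\<close> equals
  \<open>1 + log p / (1 + log (x/p))\<close>, which splits the sum into the two sums bounded before.\<close>

lemma sum_prime_log_weight_le:
  assumes "x \<ge> 1"
  shows "(\<Sum>p\<in>primes_upto x. 1 / real p * (1 / (1 + ln (x / real p)))) \<le> 18 * exp 1 * iter_log x / (1 + ln x)"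
proof -
  have "(1 + ln x) * (\<Sum>p\<in>primes_upto x. 1 / real p * (1 / (1 + ln (x / real p))))
     = (\<Sum>p\<in>primes_upto x. 1 / real p * ((1 + ln x) / (1 + ln (x / real p))))"
    by (simp add: sum_distrib_left)
  also have "\<dots> \<le> (\<Sum>p\<in>primes_upto x. 1 / real p + ln (real p) / real p * (1 / (1 + ln (x / real p))))"
  proof (rule sum_mono)
    fix p assume p: "p \<in> primes_upto x"
    note pp = primes_uptoD[OF p]
    have nn: "ln (x / real p) \<ge> 0" using pp assms by auto
    have e: "ln (x / real p) = ln x - ln (real p)" using pp assms by (simp add: ln_div)
    have "(1 + ln x) / (1 + ln (x / real p)) = 1 + ln (real p) / (1 + ln (x / real p))"
      using nn unfolding e by (simp add: field_simps)
    thus "1 / real p * ((1 + ln x) / (1 + ln (x / real p))) \<le> 1 / real p + ln (real p) / real p * (1 / (1 + ln (x / real p)))"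
      by (simp add: ring_distribs)
  qed
  also have "\<dots> \<le> 9 * exp 1 * iter_log x + 9 * exp 1 * iter_log x"
    unfolding sum.distrib
    by (intro add_mono sum_prime_reciprocals_le sum_ln_prime_weighted_le assms)
  finally show ?thesis using assms by (simp add: field_simps add_pos_nonneg)
qed

section \<open>Sums over squarefree integers weighted by the number of prime factors\<close>

definition squarefree_upto :: "nat set \<Rightarrow> real \<Rightarrow> nat set" where
  "squarefree_upto B x = {n. 1 \<le> n \<and> real n \<le> x \<and> squarefree n \<and> (\<forall>p\<in>B. \<not> p dvd n)}"

text \<open>For \<open>j = 0\<close> and \<open>c = -1\<close> this is the sum of the Moebius function over the integers up to \<open>x\<close> that are
  divisible by no prime of \<open>B\<close>; for \<open>c = 1\<close> one gets the sums that majorise it. The set \<open>B\<close> serves both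
  the sifting condition and the coprimality conditions that the recursion in \<open>j\<close> creates.\<close>

definition omega_sum :: "real \<Rightarrow> nat \<Rightarrow> nat set \<Rightarrow> real \<Rightarrow> real" where
  "omega_sum c j B x = (\<Sum>n\<in>squarefree_upto B x. c ^ omega n * real (omega n choose j))"

lemma finite_squarefree_upto [simp]: "finite (squarefree_upto B x)"
  by (rule finite_subset[OF _ finite_nat_le_real[of x "\<lambda>_. True"]]) (auto simp: squarefree_upto_def)

lemma squarefree_upto_empty: "x < 1 \<Longrightarrow> squarefree_upto B x = {}"
  unfolding squarefree_upto_def by fastforce

lemma omega_prime_mult:
  assumes "prime p" "\<not> p dvd m" "m > 0"
  shows "omega (p * m) = Suc (omega m)"
proof -
  have "prime_factors (p * m) = insert p (prime_factors m)"
    using assms by (simp add: prime_factors_product prime_prime_factors)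
  moreover have "p \<notin> prime_factors m" using assms by auto
  ultimately show ?thesis unfolding omega_def by simp
qed

lemma squarefree_prime_mult_iff:
  assumes "prime (p::nat)"
  shows "squarefree (p * m) \<longleftrightarrow> squarefree m \<and> \<not> p dvd m"
proof
  assume sq: "squarefree (p * m)"
  have "\<not> p dvd m"
  proof
    assume "p dvd m"
    hence "p ^ 2 dvd p * m" by (simp add: power2_eq_square)
    with sq have "is_unit p" by (rule squarefreeD)
    with assms show False by auto
  qed
  thus "squarefree m \<and> \<not> p dvd m" using sq squarefree_multD by blast
next
  assume "squarefree m \<and> \<not> p dvd m"
  thus "squarefree (p * m)"
    using assms by (intro squarefree_mult_coprime) (auto simp: prime_imp_coprime squarefree_prime)
qed

lemma prime_mult_in_squarefree_upto_iff:
  assumes "prime p" "p \<notin> B" "\<And>q. q \<in> B \<Longrightarrow> prime q"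
  shows "p * m \<in> squarefree_upto B x \<longleftrightarrow> m \<in> squarefree_upto (insert p B) (x / real p)"
proof -
  have p: "real p > 0" using assms(1) prime_gt_0_nat by simp
  have "q dvd p * m \<longleftrightarrow> q dvd m" if "q \<in> B" for q
    using that assms by (metis prime_dvd_mult_iff primes_dvd_imp_eq)
  thus ?thesis using p assms(1)
    by (auto simp: squarefree_upto_def squarefree_prime_mult_iff pos_le_divide_eq mult.commute[of "real m"])
qed

text \<open>\<open>(j + 1) binomial(w, j + 1) = w binomial(w - 1, j)\<close>, and the factor \<open>w = \<omega>(n)\<close> counts the ways of
  writing \<open>n = p m\<close> with a prime \<open>p\<close>.\<close>

lemma omega_sum_Suc:
  assumes B: "\<And>q. q \<in> B \<Longrightarrow> prime q"
  shows "real (Suc j) * omega_sum c (Suc j) B x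
       = c * (\<Sum>p\<in>primes_upto x - B. omega_sum c j (insert p B) (x / real p))"
proof -
  let ?Q = "squarefree_upto"
  have "real (Suc j) * omega_sum c (Suc j) B x
     = (\<Sum>n\<in>?Q B x. \<Sum>p\<in>prime_factors n. c ^ omega n * real (omega n - 1 choose j))"
    unfolding omega_sum_def sum_distrib_left
  proof (rule sum.cong)
    fix n assume "n \<in> ?Q B x"
    have "Suc j * (omega n choose Suc j) = omega n * (omega n - 1 choose j)"
      by (cases "omega n") (simp_all only: diff_Suc_1 Suc_times_binomial_eq mult.commute binomial_0_Suc mult_zero_left mult_zero_right)
    hence "real (Suc j) * real (omega n choose Suc j) = real (omega n) * real (omega n - 1 choose j)"
      by (metis of_nat_mult)
    thus "real (Suc j) * (c ^ omega n * real (omega n choose Suc j)) =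
        (\<Sum>p\<in>prime_factors n. c ^ omega n * real (omega n - 1 choose j))"
      by (simp add: omega_def[symmetric] mult.left_commute del: binomial_Suc_Suc)
  qed auto
  also have "\<dots> = (\<Sum>(n,p)\<in>(SIGMA n:?Q B x. prime_factors n). c ^ omega n * real (omega n - 1 choose j))"
    by (rule sum.Sigma) auto
  also have "\<dots> = (\<Sum>(p,m)\<in>(SIGMA p:primes_upto x - B. ?Q (insert p B) (x / real p)).
                     c * (c ^ omega m * real (omega m choose j)))"
  proof (rule sum.reindex_bij_witness[of _ "\<lambda>(p,m). (p * m, p)" "\<lambda>(n,p). (p, n div p)"])
    fix a assume "a \<in> (SIGMA n:?Q B x. prime_factors n)"
    then obtain n p where a: "a = (n, p)" "n \<in> ?Q B x" "p \<in> prime_factors n" by auto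
    hence p: "prime p" "p dvd n" by auto
    then obtain m where m: "n = p * m" by auto
    have n0: "n > 0" using a by (auto simp: squarefree_upto_def)
    have pB: "p \<notin> B" using a p by (auto simp: squarefree_upto_def)
    have mQ: "m \<in> ?Q (insert p B) (x / real p)"
      using prime_mult_in_squarefree_upto_iff[OF p(1) pB B] a m by auto
    have "real p \<le> real n" using p n0 by (simp add: dvd_imp_le)
    hence px: "p \<in> primes_upto x" using a p by (auto simp: primes_upto_def squarefree_upto_def)
    have nd: "n div p = m" using m p by auto
    have om: "omega n = Suc (omega m)"
      unfolding m using mQ by (intro omega_prime_mult p) (auto simp: squarefree_upto_def)
    show "(case case a of (n, p) \<Rightarrow> (p, n div p) of (p, m) \<Rightarrow> (p * m, p)) = a"
      using a nd m by simp
    show "(case a of (n, p) \<Rightarrow> (p, n div p)) \<in> (SIGMA p:primes_upto x - B. ?Q (insert p B) (x / real p))"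
      using a px pB mQ nd by simp
    show "(case case a of (n, p) \<Rightarrow> (p, n div p) of (p, m) \<Rightarrow> c * (c ^ omega m * real (omega m choose j))) =
         (case a of (n, p) \<Rightarrow> c ^ omega n * real (omega n - 1 choose j))"
      using a nd om by simp
  next
    fix b assume "b \<in> (SIGMA p:primes_upto x - B. ?Q (insert p B) (x / real p))"
    then obtain p m where b: "b = (p, m)" "p \<in> primes_upto x" "p \<notin> B"
      "m \<in> ?Q (insert p B) (x / real p)" by auto
    note pp = primes_uptoD[OF b(2)]
    have "p * m \<in> ?Q B x" using prime_mult_in_squarefree_upto_iff[OF pp(1) b(3) B] b by auto
    moreover have "p \<in> prime_factors (p * m)"
      using pp calculation by (auto simp: squarefree_upto_def prime_factors_dvd)
    ultimately show "(case b of (p, m) \<Rightarrow> (p * m, p)) \<in> (SIGMA n:?Q B x. prime_factors n)"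
      using b by simp
    show "(case case b of (p, m) \<Rightarrow> (p * m, p) of (n, p) \<Rightarrow> (p, n div p)) = b"
      using b pp by simp
  qed
  also have "\<dots> = (\<Sum>p\<in>primes_upto x - B. \<Sum>m\<in>?Q (insert p B) (x / real p).
                     c * (c ^ omega m * real (omega m choose j)))"
    by (rule sum.Sigma[symmetric]) auto
  also have "\<dots> = c * (\<Sum>p\<in>primes_upto x - B. omega_sum c j (insert p B) (x / real p))"
    unfolding omega_sum_def by (simp add: sum_distrib_left)
  finally show ?thesis .
qed

text \<open>Sort the integers by divisibility by \<open>p\<close>.\<close>

lemma omega_sum_0_insert:
  assumes p: "prime p" "p \<notin> B" and B: "\<And>q. q \<in> B \<Longrightarrow> prime q"
  shows "omega_sum c 0 B x = omega_sum c 0 (insert p B) x + c * omega_sum c 0 (insert p B) (x / real p)"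
proof -
  let ?Q = "squarefree_upto"
  let ?Q' = "?Q (insert p B) (x / real p)"
  have eq: "?Q B x = ?Q (insert p B) x \<union> (*) p ` ?Q'"
  proof (rule set_eqI)
    fix n
    show "n \<in> ?Q B x \<longleftrightarrow> n \<in> ?Q (insert p B) x \<union> (*) p ` ?Q'"
    proof (cases "p dvd n")
      case True
      then obtain m where m: "n = p * m" by auto
      have "p > 0" using p prime_gt_0_nat by auto
      have "n \<in> (*) p ` ?Q' \<longleftrightarrow> m \<in> ?Q'" using m \<open>p > 0\<close> by auto
      thus ?thesis using prime_mult_in_squarefree_upto_iff[OF p B, of m x] m True
        by (auto simp: squarefree_upto_def)
    next
      case False
      thus ?thesis by (auto simp: squarefree_upto_def)
    qed
  qed
  have disj: "?Q (insert p B) x \<inter> (*) p ` ?Q' = {}" by (auto simp: squarefree_upto_def)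
  have inj: "inj_on ((*) p) ?Q'" using p by (auto simp: inj_on_def)
  have "omega_sum c 0 B x = omega_sum c 0 (insert p B) x + (\<Sum>n\<in>(*) p ` ?Q'. c ^ omega n)"
    unfolding omega_sum_def eq by (subst sum.union_disjoint) (use disj in auto)
  also have "(\<Sum>n\<in>(*) p ` ?Q'. c ^ omega n) = (\<Sum>m\<in>?Q'. c ^ omega (p * m))"
    by (subst sum.reindex[OF inj]) simp
  also have "\<dots> = (\<Sum>m\<in>?Q'. c * c ^ omega m)"
    by (rule sum.cong) (auto simp: squarefree_upto_def omega_prime_mult p)
  finally show ?thesis by (simp add: omega_sum_def sum_distrib_left)
qed

lemma one_plus_ln_prime_le:
  assumes "p \<ge> 2" shows "1 + ln (real p) \<le> 6 / 7 * real p"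
proof -
  have "ln (real p) = ln 2 + ln (real p / 2)" using assms by (simp add: ln_div)
  also have "ln (real p / 2) \<le> real p / 2 - 1" by (rule ln_le_minus_one) (use assms in auto)
  also have "ln 2 \<le> (25/36 :: real)" by (rule ln2_le_25_over_36)
  finally show ?thesis using assms by linarith
qed

text \<open>Adding a prime \<open>p\<close> to \<open>B\<close> changes the sum at \<open>x\<close>, up to sign, by the new sum at \<open>x/p\<close>, which allows induction on the
  size of \<open>x\<close>. The induction closes because \<open>(1 + log p)/p \<le> 6/7\<close> for every prime \<open>p\<close>: the geometric
  series with ratio \<open>6/7\<close> gives the factor \<open>7\<close>, and it is the same for all primes. This uniformity is
  what the recursion in \<open>j\<close> needs, since there the added prime runs up to \<open>x\<close>.\<close>

lemma omega_sum_0_coprime_bound: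
  assumes base: "\<And>x. x \<ge> 1 \<Longrightarrow> \<bar>omega_sum c 0 {} x\<bar> \<le> K * x / (1 + ln x)"
    and c: "\<bar>c\<bar> = 1" and K: "K \<ge> 0"
    and B: "finite B" "\<And>q. q \<in> B \<Longrightarrow> prime q" and x: "x \<ge> 1"
  shows "\<bar>omega_sum c 0 B x\<bar> \<le> K * 7 ^ card B * x / (1 + ln x)"
  using B x
proof (induction B arbitrary: x rule: finite_induct)
  case empty
  thus ?case using base by simp
next
  case (insert p B)
  have p: "prime p" "p \<ge> 2" using insert.prems prime_ge_2_nat by auto
  define K' where "K' = K * 7 ^ card B"
  have K': "K' \<ge> 0" using K by (simp add: K'_def)
  have IH: "\<bar>omega_sum c 0 B x\<bar> \<le> K' * x / (1 + ln x)" if "x \<ge> 1" for x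
    using insert.IH[OF _ that] insert.prems by (simp add: K'_def)
  have "\<bar>omega_sum c 0 (insert p B) x\<bar> \<le> 7 * K' * x / (1 + ln x)" if "1 \<le> x" "x < 2 ^ n" for n x
    using that
  proof (induction n arbitrary: x)
    case 0 thus ?case by simp
  next
    case (Suc n x)
    have l: "1 + ln x > 0" using Suc.prems by (simp add: add_pos_nonneg)
    have small: "\<bar>omega_sum c 0 (insert p B) (x / real p)\<bar> \<le> 6 * K' * x / (1 + ln x)"
    proof (cases "x / real p < 1")
      case True
      hence "omega_sum c 0 (insert p B) (x / real p) = 0"
        by (simp add: omega_sum_def squarefree_upto_empty)
      thus ?thesis using K' l Suc.prems by simp
    next
      case False
      have "x / real p \<le> x / 2" using p Suc.prems by (intro divide_left_mono) auto
      also have "\<dots> < 2 ^ n" using Suc.prems by simp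
      finally have lt: "x / real p < 2 ^ n" .
      have l': "ln (x / real p) \<ge> 0" using False by simp
      have "ln (x / real p) = ln x - ln (real p)" using p Suc.prems by (simp add: ln_div)
      hence "1 + ln x = 1 + ln (x / real p) + ln (real p)" by simp
      also have "\<dots> \<le> (1 + ln (real p)) * (1 + ln (x / real p))"
        using l' p by (simp add: algebra_simps)
      also have "\<dots> \<le> (6 / 7 * real p) * (1 + ln (x / real p))"
        using l' one_plus_ln_prime_le[OF p(2)] by (intro mult_right_mono) auto
      finally have 1: "1 / (1 + ln (x / real p)) \<le> 6 / 7 * real p / (1 + ln x)"
        using l l' by (simp add: field_simps)
      have "\<bar>omega_sum c 0 (insert p B) (x / real p)\<bar> \<le> 7 * K' * (x / real p) * (1 / (1 + ln (x / real p)))"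
        using Suc.IH[OF _ lt] False by simp
      also have "\<dots> \<le> 7 * K' * (x / real p) * (6 / 7 * real p / (1 + ln x))"
        using K' Suc.prems by (intro mult_left_mono 1) auto
      also have "\<dots> = 6 * K' * x / (1 + ln x)"
        using p l by (simp add: divide_simps)
      finally show ?thesis .
    qed
    have "omega_sum c 0 (insert p B) x = omega_sum c 0 B x - c * omega_sum c 0 (insert p B) (x / real p)"
      using omega_sum_0_insert[of p B c x] p insert by auto
    moreover have "\<bar>c * omega_sum c 0 (insert p B) (x / real p)\<bar> = \<bar>omega_sum c 0 (insert p B) (x / real p)\<bar>"
      using c by (simp add: abs_mult)
    ultimately have "\<bar>omega_sum c 0 (insert p B) x\<bar> \<le> \<bar>omega_sum c 0 B x\<bar> + \<bar>omega_sum c 0 (insert p B) (x / real p)\<bar>"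
      by linarith
    also have "\<dots> \<le> K' * x / (1 + ln x) + 6 * K' * x / (1 + ln x)"
      using small IH[OF Suc.prems(1)] by linarith
    also have "\<dots> = 7 * K' * x / (1 + ln x)" by (simp add: add_divide_distrib[symmetric])
    finally show ?case .
  qed
  moreover obtain n where "x < 2 ^ n" using real_arch_pow[of 2 x] by auto
  ultimately have "\<bar>omega_sum c 0 (insert p B) x\<bar> \<le> 7 * K' * x / (1 + ln x)" using insert.prems by blast
  also have "7 * K' = K * 7 ^ card (insert p B)" using insert.hyps by (simp add: K'_def)
  finally show ?case .
qed

text \<open>The weight \<open>w\<close> will be \<open>1\<close> (absolute values) or \<open>1 / (1 + log x)\<close> (cancellation in the sum of the
  Moebius function). All that matters is that summing \<open>w(x/p)/p\<close> over primes loses only \<open>log log x\<close>.\<close>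

lemma omega_sum_bound:
  assumes base: "\<And>B x. finite B \<Longrightarrow> (\<And>q. q \<in> B \<Longrightarrow> prime q) \<Longrightarrow> x \<ge> 1 \<Longrightarrow>
             \<bar>omega_sum c 0 B x\<bar> \<le> K * 7 ^ card B * x * w x"
    and w: "\<And>x. x \<ge> 1 \<Longrightarrow> w x \<ge> 0"
    and tr: "\<And>x. x \<ge> 1 \<Longrightarrow> (\<Sum>p\<in>primes_upto x. 1 / real p * w (x / real p)) \<le> D * iter_log x * w x"
    and c: "\<bar>c\<bar> = 1" and K: "K \<ge> 0" and D: "D \<ge> 0"
    and B: "finite B" "\<And>q. q \<in> B \<Longrightarrow> prime q" and x: "x \<ge> 1"
  shows "\<bar>omega_sum c j B x\<bar> \<le> K * (7 * D) ^ j * 7 ^ card B * x * iter_log x ^ j * w x"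
  using B x
proof (induction j arbitrary: B x)
  case 0
  thus ?case using base by simp
next
  case (Suc j B x)
  note x = \<open>x \<ge> 1\<close>
  let ?E = "K * (7 * D) ^ j * 7 ^ Suc (card B) * x * iter_log x ^ j"
  have L: "iter_log x \<ge> 1" using x by (rule iter_log_ge_1)
  have E: "?E \<ge> 0" using K D x L by simp
  have "\<bar>omega_sum c (Suc j) B x\<bar> \<le> real (Suc j) * \<bar>omega_sum c (Suc j) B x\<bar>"
    using mult_right_mono[of 1 "real (Suc j)" "\<bar>omega_sum c (Suc j) B x\<bar>"] by simp
  also have "\<dots> = \<bar>real (Suc j) * omega_sum c (Suc j) B x\<bar>" by (simp add: abs_mult)
  also have "\<dots> = \<bar>\<Sum>p\<in>primes_upto x - B. omega_sum c j (insert p B) (x / real p)\<bar>"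
    using Suc.prems c by (subst omega_sum_Suc) (auto simp: abs_mult)
  also have "\<dots> \<le> (\<Sum>p\<in>primes_upto x - B. \<bar>omega_sum c j (insert p B) (x / real p)\<bar>)"
    by (rule sum_abs)
  also have "\<dots> \<le> (\<Sum>p\<in>primes_upto x - B. ?E * (1 / real p * w (x / real p)))"
  proof (rule sum_mono)
    fix p assume p: "p \<in> primes_upto x - B"
    hence pp: "prime p" "real p \<le> x" "2 \<le> p" using primes_uptoD[of p x] by auto
    have xp: "x / real p \<ge> 1" using pp by simp
    have "\<bar>omega_sum c j (insert p B) (x / real p)\<bar>
        \<le> K * (7 * D) ^ j * 7 ^ card (insert p B) * (x / real p) * iter_log (x / real p) ^ j * w (x / real p)"
      by (rule Suc.IH) (use Suc.prems pp xp in auto)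
    also have "card (insert p B) = Suc (card B)" using p Suc.prems by simp
    also have "K * (7 * D) ^ j * 7 ^ Suc (card B) * (x / real p) * iter_log (x / real p) ^ j * w (x / real p)
      \<le> K * (7 * D) ^ j * 7 ^ Suc (card B) * (x / real p) * iter_log x ^ j * w (x / real p)"
    proof (intro mult_right_mono mult_left_mono power_mono)
      have "x / real p \<le> x / 1" using pp x by (intro divide_left_mono) auto
      thus "iter_log (x / real p) \<le> iter_log x" by (intro iter_log_mono xp) auto
      show "0 \<le> iter_log (x / real p)" using iter_log_ge_1[OF xp] by simp
    qed (use w[OF xp] K D x in auto)
    finally show "\<bar>omega_sum c j (insert p B) (x / real p)\<bar> \<le> ?E * (1 / real p * w (x / real p))"
      by (simp add: field_simps)
  qed
  also have "\<dots> = ?E * (\<Sum>p\<in>primes_upto x - B. 1 / real p * w (x / real p))"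
    by (rule sum_distrib_left[symmetric])
  also have "\<dots> \<le> ?E * (\<Sum>p\<in>primes_upto x. 1 / real p * w (x / real p))"
  proof (rule mult_left_mono[OF sum_mono2 E])
    fix p assume "p \<in> primes_upto x - (primes_upto x - B)"
    hence "x / real p \<ge> 1" using primes_uptoD[of p x] by auto
    thus "0 \<le> 1 / real p * w (x / real p)" using w by simp
  qed auto
  also have "\<dots> \<le> ?E * (D * iter_log x * w x)"
    using E by (intro mult_left_mono tr x)
  finally show ?case by (simp add: algebra_simps)
qed

lemma card_squarefree_upto_le:
  assumes "x \<ge> 0" shows "real (card (squarefree_upto B x)) \<le> x"
proof -
  have "squarefree_upto B x \<subseteq> {1..nat \<lfloor>x\<rfloor>}" by (auto simp: squarefree_upto_def le_nat_floor)
  hence "card (squarefree_upto B x) \<le> card {1..nat \<lfloor>x\<rfloor>}" by (intro card_mono) auto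
  thus ?thesis using assms by simp linarith
qed

section \<open>Squarefree integers without small prime factors\<close>

text \<open>By Stirling's lower bound \<open>log N! \<ge> N log N - N\<close>.\<close>

lemma sum_ln_quotient_le:
  assumes "finite A" "\<And>n. n \<in> A \<Longrightarrow> 1 \<le> n \<and> real n \<le> x" "x \<ge> 1"
  shows "(\<Sum>n\<in>A. ln (x / real n)) \<le> x"
proof -
  define N where "N = nat \<lfloor>x\<rfloor>"
  have N: "1 \<le> N" "real N \<le> x" using assms(3) unfolding N_def by (auto simp: le_nat_floor)
  have stirling: "(\<Sum>n=1..M. ln (real n)) \<ge> real M * ln (real M) - real M" for M :: nat
  proof (induction M)
    case (Suc M)
    show ?case
    proof (cases "M = 0")
      case False
      have "ln (real (Suc M)) - ln (real M) = ln (real (Suc M) / real M)"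
        using False by (simp add: ln_div)
      also have "\<dots> \<le> real (Suc M) / real M - 1" by (rule ln_le_minus_one) (use False in auto)
      also have "\<dots> = 1 / real M" using False by (simp add: field_simps)
      finally have "real M * (ln (real (Suc M)) - ln (real M)) \<le> 1"
        using False by (simp add: field_simps)
      with Suc show ?thesis by (simp add: algebra_simps)
    qed simp
  qed simp
  have "A \<subseteq> {1..N}" using assms(2) unfolding N_def by (auto simp: le_nat_floor)
  hence "(\<Sum>n\<in>A. ln (x / real n)) \<le> (\<Sum>n=1..N. ln (x / real n))"
    using N by (intro sum_mono2) (auto intro!: ln_ge_zero)
  also have "\<dots> = (\<Sum>n=1..N. ln x - ln (real n))"
    using assms by (intro sum.cong) (auto simp: ln_div)
  also have "\<dots> = real N * ln x - (\<Sum>n=1..N. ln (real n))"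
    by (simp add: sum_subtractf)
  also have "\<dots> \<le> real N * ln x - (real N * ln (real N) - real N)"
    using stirling[of N] by simp
  also have "\<dots> = real N * ln (x / real N) + real N"
    using N assms by (simp add: ln_div algebra_simps)
  also have "\<dots> \<le> real N * (x / real N - 1) + real N"
    using N assms by (intro add_right_mono mult_left_mono ln_le_minus_one) auto
  also have "\<dots> = x" using N by (simp add: algebra_simps)
  finally show ?thesis .
qed

lemma ln_squarefree_eq:
  assumes "squarefree n"
  shows "ln (real n) = (\<Sum>p\<in>prime_factors n. ln (real p))"
proof -
  have n0: "n \<noteq> 0" using assms by (metis not_squarefree_0)
  have "(\<Prod>p\<in>prime_factors n. p) = (\<Prod>p\<in>prime_factors n. p ^ multiplicity p n)"
    using assms n0 by (intro prod.cong) (auto simp: squarefree_factorial_semiring')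
  also have "\<dots> = n" using prod_prime_factors[OF n0] by simp
  finally have "real (\<Prod>p\<in>prime_factors n. p) = real n" by (simp only:)
  hence "real n = (\<Prod>p\<in>prime_factors n. real p)" by (simp only: of_nat_prod)
  moreover have "ln (\<Prod>p\<in>prime_factors n. real p) = (\<Sum>p\<in>prime_factors n. ln (real p))"
  proof (rule ln_prod)
    fix p assume "p \<in> prime_factors n"
    hence "prime p" by (rule in_prime_factors_imp_prime)
    thus "real p \<noteq> 0" using prime_gt_0_nat[of p] by simp
  qed simp
  ultimately show ?thesis by simp
qed

text \<open>An integer \<open>m\<close> without prime factors up to \<open>y\<close> is coprime to every \<open>d \<le> y\<close>, so the products \<open>m d\<close> are
  distinct integers up to \<open>x y\<close>. Comparing with the harmonic sum up to \<open>x y\<close> gives the factor \<open>1 / log y\<close>,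
  because the harmonic sum over \<open>d \<le> y\<close> is at least \<open>log y\<close>.\<close>

lemma sum_reciprocals_rough_le:
  assumes y: "2 \<le> y" "y \<le> x"
  shows "(\<Sum>m\<in>squarefree_upto (primes_upto y) x. 1 / real m) \<le> (1 + 2 * ln x) / ln y"
proof -
  let ?Q = "squarefree_upto (primes_upto y) x"
  define N where "N = nat \<lfloor>y\<rfloor>"
  have N: "N \<ge> 1" "real N \<le> y" "y < real N + 1" using y unfolding N_def by (auto simp: le_nat_floor)
  have cop: "coprime m d" if "m \<in> ?Q" "d \<in> {1..N}" for m d
  proof (rule ccontr)
    assume "\<not> coprime m d"
    then obtain p where p: "prime p" "p dvd m" "p dvd d"
      by (metis coprime_def not_coprimeE prime_divisor_exists is_unit_gcd gcd_greatest_iff dvd_trans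
          prime_factor_nat gcd_dvd1 gcd_dvd2 coprime_iff_gcd_eq_1)
    have "p \<le> d" using p that by (intro dvd_imp_le) auto
    hence "real p \<le> y" using that N by auto
    with p that show False by (auto simp: squarefree_upto_def primes_upto_def)
  qed
  have inj: "inj_on (\<lambda>(m, d). m * d) (?Q \<times> {1..N})"
  proof (rule inj_onI, clarify)
    fix m d m' d' assume a: "m \<in> ?Q" "d \<in> {1..N}" "m' \<in> ?Q" "d' \<in> {1..N}" "m * d = m' * d'"
    have "m dvd m'" using a cop[of m d'] by (metis coprime_dvd_mult_left_iff dvd_triv_left)
    moreover have "m' dvd m" using a cop[of m' d] by (metis coprime_dvd_mult_left_iff dvd_triv_left)
    ultimately have "m = m'" by (simp add: dvd_antisym)
    with a show "m = m' \<and> d = d'" by (auto simp: squarefree_upto_def)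
  qed
  have xy: "x * y \<ge> 1" using y mult_mono[of 1 x 1 y] by simp
  have sub: "(\<lambda>(m, d). m * d) ` (?Q \<times> {1..N}) \<subseteq> {1..nat \<lfloor>x * y\<rfloor>}"
  proof clarify
    fix m d assume a: "m \<in> ?Q" "d \<in> {1..N}"
    have "real (m * d) \<le> x * y"
      using a N y unfolding of_nat_mult by (intro mult_mono) (auto simp: squarefree_upto_def)
    thus "m * d \<in> {1..nat \<lfloor>x * y\<rfloor>}" using a by (auto simp: le_nat_floor squarefree_upto_def)
  qed
  have "(\<Sum>m\<in>?Q. 1 / real m) * (\<Sum>d=1..N. 1 / real d) = (\<Sum>(m,d)\<in>?Q \<times> {1..N}. 1 / real (m * d))"
    by (simp add: sum_product sum.cartesian_product)
  also have "\<dots> = (\<Sum>n\<in>(\<lambda>(m, d). m * d) ` (?Q \<times> {1..N}). 1 / real n)"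
    by (subst sum.reindex[OF inj]) (auto simp: case_prod_unfold)
  also have "\<dots> \<le> (\<Sum>n=1..nat \<lfloor>x * y\<rfloor>. 1 / real n)"
    by (rule sum_mono2[OF _ sub]) auto
  also have "\<dots> = harm (nat \<lfloor>x * y\<rfloor>)" by (simp add: harm_def divide_inverse)
  also have "\<dots> \<le> 1 + ln (real (nat \<lfloor>x * y\<rfloor>))"
    using xy by (intro harm_le_1_plus_ln) (auto simp: le_nat_floor)
  also have "ln (real (nat \<lfloor>x * y\<rfloor>)) \<le> ln (x * y)" using xy by (subst ln_le_cancel_iff) auto
  also have "ln (x * y) = ln x + ln y" using y by (simp add: ln_mult)
  also have "ln y \<le> ln x" using y by (subst ln_le_cancel_iff) auto
  finally have 1: "(\<Sum>m\<in>?Q. 1 / real m) * (\<Sum>d=1..N. 1 / real d) \<le> 1 + 2 * ln x" by simp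
  have "ln y \<le> ln (real N + 1)" using y N by (subst ln_le_cancel_iff) auto
  also have "\<dots> \<le> harm N" by (rule ln_le_harm)
  also have "\<dots> = (\<Sum>d=1..N. 1 / real d)" by (simp add: harm_def divide_inverse)
  finally have "(\<Sum>m\<in>?Q. 1 / real m) * ln y \<le> (\<Sum>m\<in>?Q. 1 / real m) * (\<Sum>d=1..N. 1 / real d)"
    by (intro mult_left_mono sum_nonneg) auto
  with 1 have "(\<Sum>m\<in>?Q. 1 / real m) * ln y \<le> 1 + 2 * ln x" by linarith
  moreover have "ln y > 0" using y by simp
  ultimately show ?thesis by (simp add: pos_le_divide_eq)
qed

text \<open>Write \<open>log n\<close> as the sum of \<open>log p\<close> over the primes dividing \<open>n\<close>, sum over \<open>p\<close> first, and use
  Chebyshev's bound for each cofactor \<open>m = n/p\<close>.\<close>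

lemma sum_ln_squarefree_le:
  assumes "x \<ge> 1"
  shows "(\<Sum>n\<in>squarefree_upto B x. ln (real n)) \<le> 3 * x * (\<Sum>m\<in>squarefree_upto B x. 1 / real m)"
proof -
  let ?Q = "squarefree_upto B x"
  have "(\<Sum>n\<in>?Q. ln (real n)) = (\<Sum>n\<in>?Q. \<Sum>p\<in>prime_factors n. ln (real p))"
    by (rule sum.cong) (auto simp: squarefree_upto_def ln_squarefree_eq)
  also have "\<dots> = (\<Sum>(n,p)\<in>(SIGMA n:?Q. prime_factors n). ln (real p))"
    by (rule sum.Sigma) auto
  also have "\<dots> = (\<Sum>(m,p)\<in>(\<lambda>(n,p). (n div p, p)) ` (SIGMA n:?Q. prime_factors n). ln (real p))"
  proof (subst sum.reindex)
    show "inj_on (\<lambda>(n, p). (n div p, p)) (SIGMA n:?Q. prime_factors n)"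
    proof (rule inj_onI, clarify)
      fix n p n' assume a: "p \<in> prime_factors n" "p \<in> prime_factors n'" "n div p = n' div p"
      have "n = p * (n div p)" using a(1) by (auto simp: prime_factors_dvd)
      also have "\<dots> = n'" unfolding a(3) using a(2) by (auto simp: prime_factors_dvd)
      finally show "n = n' \<and> p = p" by simp
    qed
  qed (auto simp: case_prod_unfold)
  also have "\<dots> \<le> (\<Sum>(m,p)\<in>(SIGMA m:?Q. primes_upto (x / real m)). ln (real p))"
  proof (rule sum_mono2)
    show "(\<lambda>(n,p). (n div p, p)) ` (SIGMA n:?Q. prime_factors n) \<subseteq> (SIGMA m:?Q. primes_upto (x / real m))"
    proof clarify
      fix n p assume n: "n \<in> ?Q" and p: "p \<in> prime_factors n"
      hence pp: "prime p" and "p dvd n" by auto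
      then obtain m where m: "n = p * m" by auto
      have p1: "p \<ge> 1" using pp prime_ge_1_nat by auto
      have m0: "m > 0" using n m by (auto simp: squarefree_upto_def)
      have "real m * 1 \<le> real m * real p" using p1 by (intro mult_left_mono) auto
      hence "real m \<le> real (p * m)" by (simp add: mult.commute)
      also have "real (p * m) \<le> x" using n m by (auto simp: squarefree_upto_def)
      finally have "real m \<le> x" .
      moreover have "squarefree m" using n m squarefree_multD by (auto simp: squarefree_upto_def)
      ultimately have "m \<in> ?Q" using n m m0 by (auto simp: squarefree_upto_def)
      moreover have "p \<in> primes_upto (x / real m)"
        using n m m0 pp by (auto simp: squarefree_upto_def primes_upto_def pos_le_divide_eq)
      moreover have "n div p = m" using m p1 by simp
      ultimately show "n div p \<in> ?Q \<and> p \<in> primes_upto (x / real (n div p))" by simp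
    qed
  qed (auto intro!: finite_SigmaI ln_ge_zero dest!: primes_uptoD(3))
  also have "\<dots> = (\<Sum>m\<in>?Q. theta (x / real m))"
    unfolding theta_def by (rule sum.Sigma[symmetric]) auto
  also have "\<dots> \<le> (\<Sum>m\<in>?Q. 3 * (x / real m))"
    using assms by (intro sum_mono theta_le) auto
  also have "\<dots> = 3 * x * (\<Sum>m\<in>?Q. 1 / real m)" by (simp add: sum_distrib_left)
  finally show ?thesis .
qed

text \<open>Weighting each \<open>n\<close> by \<open>log x = log (x/n) + log n\<close> gives an upper bound sieve of the correct order from
  the three preceding estimates.\<close>

lemma card_rough_squarefree_le:
  assumes y: "2 \<le> y" "y \<le> x"
  shows "real (card (squarefree_upto (primes_upto y) x)) \<le> 12 * x / ln y"
proof -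
  let ?Q = "squarefree_upto (primes_upto y) x"
  have ly: "ln y > 0" "ln y \<le> ln x" "ln x \<ge> ln 2" using y by auto
  have l2: "ln x \<ge> 2/3" using ly(3) ln2_ge_two_thirds by linarith
  have "real (card ?Q) * ln x = (\<Sum>n\<in>?Q. ln (x / real n)) + (\<Sum>n\<in>?Q. ln (real n))"
  proof -
    have "(\<Sum>n\<in>?Q. ln (x / real n)) + (\<Sum>n\<in>?Q. ln (real n)) = (\<Sum>n\<in>?Q. ln x)"
      unfolding sum.distrib[symmetric] using y
      by (intro sum.cong) (auto simp: ln_div squarefree_upto_def)
    thus ?thesis by simp
  qed
  also have "(\<Sum>n\<in>?Q. ln (x / real n)) \<le> x"
    using y by (intro sum_ln_quotient_le finite_squarefree_upto) (auto simp: squarefree_upto_def)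
  also have "(\<Sum>n\<in>?Q. ln (real n)) \<le> 3 * x * (\<Sum>m\<in>?Q. 1 / real m)"
    using y by (intro sum_ln_squarefree_le) auto
  also have "\<dots> \<le> 3 * x * ((1 + 2 * ln x) / ln y)"
    using y by (intro mult_left_mono sum_reciprocals_rough_le) auto
  also have "\<dots> \<le> 3 * x * ((7 / 2 * ln x) / ln y)"
    using y ly l2 by (intro mult_left_mono divide_right_mono) auto
  finally have "real (card ?Q) * ln x \<le> x + 3 * x * ((7 / 2 * ln x) / ln y)" by simp
  moreover have "x \<le> x * ln x / ln y"
    using ly y by (simp add: pos_le_divide_eq)
  ultimately have "real (card ?Q) * ln x \<le> x * ln x / ln y + 3 * x * ((7 / 2 * ln x) / ln y)"
    by linarith
  hence "real (card ?Q) * ln x \<le> (x / ln y + 21 / 2 * x / ln y) * ln x"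
    by (simp add: ring_distribs)
  moreover have "ln x > 0" using l2 by linarith
  ultimately have "real (card ?Q) \<le> x / ln y + 21 / 2 * x / ln y"
    by (simp only: mult_le_cancel_right_pos)
  also have "\<dots> \<le> 12 * x / ln y" using ly y by (simp add: field_simps)
  finally show ?thesis .
qed

lemma omega_rough_le:
  assumes y: "2 \<le> y" "y \<le> x" and n: "n \<in> squarefree_upto (primes_upto y) x"
  shows "real (omega n) \<le> ln x / ln y"
proof -
  have "real (omega n) * ln y = (\<Sum>p\<in>prime_factors n. ln y)" by (simp add: omega_def)
  also have "\<dots> \<le> (\<Sum>p\<in>prime_factors n. ln (real p))"
  proof (rule sum_mono)
    fix p assume "p \<in> prime_factors n"
    hence "y < real p" using n by (auto simp: squarefree_upto_def primes_upto_def prime_factors_dvd not_le)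
    thus "ln y \<le> ln (real p)" using y by (subst ln_le_cancel_iff) auto
  qed
  also have "\<dots> = ln (real n)" using n by (intro ln_squarefree_eq[symmetric]) (auto simp: squarefree_upto_def)
  also have "\<dots> \<le> ln x" using n by (subst ln_le_cancel_iff) (auto simp: squarefree_upto_def)
  finally show ?thesis using y by (simp add: pos_le_divide_eq)
qed

section \<open>The function zeta(s) to the right of the line Re s = 0\<close>

text \<open>\<open>u^(-s)\<close>, written with \<open>exp\<close> so that it is visibly entire in \<open>s\<close>.\<close>

definition npow :: "real \<Rightarrow> complex \<Rightarrow> complex" where
  "npow u s = exp (- (s * of_real (ln u)))"

lemma npow_1 [simp]: "npow 1 s = 1"
  by (simp add: npow_def)

lemma npow_mult: "u > 0 \<Longrightarrow> v > 0 \<Longrightarrow> npow (u * v) s = npow u s * npow v s"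
  by (simp add: npow_def ln_mult ring_distribs exp_add[symmetric])

lemma npow_add_exponent: "npow u (s + t) = npow u s * npow u t"
  by (simp add: npow_def ring_distribs exp_add[symmetric])

lemma norm_npow: "u > 0 \<Longrightarrow> norm (npow u s) = u powr (- Re s)"
  by (simp add: npow_def powr_def)

lemma has_field_derivative_npow:
  "((\<lambda>s. npow u s) has_field_derivative (- of_real (ln u) * npow u s)) (at s)"
  unfolding npow_def by (auto intro!: derivative_eq_intros)

lemma has_vector_derivative_npow:
  assumes "u > 0"
  shows "((\<lambda>u. npow u s) has_vector_derivative (- s * npow u (s + 1))) (at u within A)"
proof -
  have "((\<lambda>z. exp (- (s * z))) has_field_derivative (- s * exp (- (s * of_real (ln u))))) (at (of_real (ln u)))"
    by (auto intro!: derivative_eq_intros)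
  note 1 = has_field_derivative_at_within[OF this]
  have 2: "((\<lambda>u. complex_of_real (ln u)) has_vector_derivative of_real (1 / u)) (at u within A)"
    using assms by (auto intro!: derivative_eq_intros has_vector_derivative_of_real
        simp: has_real_derivative_iff_has_vector_derivative[symmetric])
  have "((\<lambda>u. exp (- (s * of_real (ln u)))) has_vector_derivative
      of_real (1 / u) * (- s * exp (- (s * of_real (ln u))))) (at u within A)"
    using field_vector_diff_chain_within[OF 2 1] by (simp add: o_def)
  moreover have "npow u (s + 1) = of_real (1 / u) * npow u s"
  proof -
    have "npow u 1 = of_real (1 / u)"
      using assms by (simp add: npow_def exp_minus exp_of_real divide_inverse flip: of_real_inverse)
    thus ?thesis by (simp add: npow_add_exponent mult.commute)
  qed
  ultimately show ?thesis by (simp add: npow_def mult_ac)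
qed

text \<open>Interpolation between the trivial bound \<open>2 n^(-\<sigma>)\<close> and the mean value bound \<open>|s| n^(-\<sigma>-1)\<close>. The
  exponent \<open>a\<close> trades growth in \<open>s\<close> for convergence in \<open>n\<close>, which makes it possible to cross the line
  \<open>Re s = 1\<close> with a growth of only \<open>|s|^a\<close>.\<close>

lemma norm_npow_diff_le:
  assumes n: "1 \<le> n" "n \<le> u" "u \<le> n + 1" and s: "0 \<le> Re s" and a: "0 \<le> a" "a \<le> 1"
  shows "norm (npow u s - npow n s) \<le> 2 * norm s powr a * n powr (- Re s - a)"
proof (cases "s = 0")
  case True
  thus ?thesis by (simp add: npow_def)
next
  case False
  have 1: "norm (npow u s - npow n s) \<le> 2 * n powr (- Re s)"
  proof -
    have "norm (npow u s - npow n s) \<le> norm (npow u s) + norm (npow n s)" by (rule norm_triangle_ineq4)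
    also have "norm (npow u s) \<le> n powr (- Re s)"
      using n s by (simp add: norm_npow powr_mono2')
    also have "norm (npow n s) = n powr (- Re s)" using n by (simp add: norm_npow)
    finally show ?thesis by simp
  qed
  have 2: "norm (npow u s - npow n s) \<le> norm s * n powr (- Re s - 1)"
  proof (cases "u = n")
    case False
    have "\<exists>x\<in>{n<..<u}. norm (npow u s - npow n s) \<le> norm ((u - n) *\<^sub>R (- s * npow x (s + 1)))"
    proof (rule mvt_general)
      show "n < u" using n False by simp
      show "continuous_on {n..u} (\<lambda>u. npow u s)"
        using n by (intro continuous_at_imp_continuous_on ballI
            has_vector_derivative_continuous[OF has_vector_derivative_npow]) auto
      fix x assume "n < x" "x < u"
      thus "((\<lambda>u. npow u s) has_derivative (\<lambda>h. h *\<^sub>R (- s * npow x (s + 1)))) (at x)"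
        using has_vector_derivative_npow[of x s UNIV] n by (simp add: has_vector_derivative_def)
    qed
    then obtain x where x: "n < x" "x < u" "norm (npow u s - npow n s) \<le> \<bar>u - n\<bar> * (norm s * norm (npow x (s + 1)))"
      by (auto simp: norm_mult)
    note x(3)
    also have "\<bar>u - n\<bar> * (norm s * norm (npow x (s + 1))) \<le> 1 * (norm s * n powr (- Re s - 1))"
      using x n s by (intro mult_mono) (auto simp: norm_npow powr_mono2')
    finally show ?thesis by simp
  qed simp
  have pn: "n > 0" using n by simp
  have e: "norm s powr a * n powr (- Re s - a) = n powr (- Re s) * (norm s / n) powr a"
    using pn by (simp add: powr_diff powr_divide)
  show ?thesis
  proof (cases "norm s \<le> n")
    case True
    have "norm s / n \<le> (norm s / n) powr a"
      using True pn False a powr_mono'[of a 1 "norm s / n"] by simp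
    hence "n powr (- Re s) * (norm s / n) \<le> n powr (- Re s) * (norm s / n) powr a"
      by (intro mult_left_mono) auto
    moreover have "norm s * n powr (- Re s - 1) = n powr (- Re s) * (norm s / n)"
      using pn by (simp add: powr_diff)
    ultimately have "norm (npow u s - npow n s) \<le> norm s powr a * n powr (- Re s - a)"
      using 2 unfolding e by linarith
    moreover have "norm s powr a * n powr (- Re s - a) \<ge> 0" by simp
    ultimately show ?thesis by linarith
  next
    case False
    have "n powr (- Re s) * 1 \<le> n powr (- Re s) * (norm s / n) powr a"
      using False pn a by (intro mult_left_mono ge_one_powr_ge_zero) auto
    thus ?thesis using 1 unfolding mult.assoc e by linarith
  qed
qed

text \<open>\<open>s - 1\<close> times the difference between \<open>n^(-s)\<close> and the integral of \<open>u^(-s)\<close> over \<open>[n, n + 1]\<close>. Because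
  of the factor \<open>s - 1\<close> each term is entire and the pole at \<open>s = 1\<close> never appears.\<close>

definition zeta_term :: "nat \<Rightarrow> complex \<Rightarrow> complex" where
  "zeta_term n s = (s - 1) * npow (real n) s - npow (real n) (s - 1) + npow (real n + 1) (s - 1)"

lemma norm_zeta_term_le:
  assumes n: "n \<ge> 1" and s: "0 \<le> Re s" and a: "0 \<le> a" "a \<le> 1"
  shows "norm (zeta_term n s) \<le> 2 * norm (s - 1) * norm s powr a * real n powr (- Re s - a)"
proof -
  \<comment> \<open>the derivative of \<open>\<psi>\<close> vanishes at \<open>n\<close>, so \<open>\<psi>\<close> measures the error of the rectangle rule\<close>
  define \<psi> where "\<psi> u = npow u (s - 1) + (u - real n) *\<^sub>R ((s - 1) * npow (real n) s)" for u
  have "\<exists>x\<in>{real n<..<real n + 1}. norm (\<psi> (real n + 1) - \<psi> (real n)) \<le>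
      norm ((real n + 1 - real n) *\<^sub>R ((1 - s) * npow x s + (s - 1) * npow (real n) s))"
  proof (rule mvt_general)
    have d: "(\<psi> has_vector_derivative ((1 - s) * npow x s + (s - 1) * npow (real n) s)) (at x within A)"
      if "x > 0" for x A
      unfolding \<psi>_def using has_vector_derivative_npow[OF that, of "s - 1"]
      by (auto intro!: derivative_eq_intros)
    show "continuous_on {real n..real n + 1} \<psi>"
      using n by (intro continuous_at_imp_continuous_on ballI has_vector_derivative_continuous[OF d]) auto
    fix x assume "real n < x"
    thus "(\<psi> has_derivative (\<lambda>h. h *\<^sub>R ((1 - s) * npow x s + (s - 1) * npow (real n) s))) (at x)"
      using d[of x UNIV] n by (simp add: has_vector_derivative_def)
  qed simp
  then obtain x where x: "real n < x" "x < real n + 1"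
    "norm (\<psi> (real n + 1) - \<psi> (real n)) \<le> norm ((1 - s) * npow x s + (s - 1) * npow (real n) s)"
    by auto
  have "zeta_term n s = \<psi> (real n + 1) - \<psi> (real n)"
    by (simp add: zeta_term_def \<psi>_def)
  also have "norm \<dots> \<le> norm ((1 - s) * npow x s + (s - 1) * npow (real n) s)" by (rule x(3))
  also have "(1 - s) * npow x s + (s - 1) * npow (real n) s = - ((s - 1) * (npow x s - npow (real n) s))"
    by (simp add: algebra_simps)
  also have "norm \<dots> = norm (s - 1) * norm (npow x s - npow (real n) s)"
    by (simp only: norm_minus_cancel norm_mult)
  also have "\<dots> \<le> norm (s - 1) * (2 * norm s powr a * real n powr (- Re s - a))"
    using n x s a by (intro mult_left_mono norm_npow_diff_le) auto
  finally show ?thesis by (simp add: mult_ac)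
qed

lemma summable_nat_powr: "c > 1 \<Longrightarrow> summable (\<lambda>n. real (Suc n) powr (- c))"
  using summable_ignore_initial_segment[of "\<lambda>n. real n powr (- c)" 1] summable_real_powr_iff[of "-c"] by simp

text \<open>\<open>(s - 1) \<zeta>(s)\<close>, continued to \<open>Re s > 0\<close>; the leading \<open>1\<close> is what the integrals telescope to.\<close>

definition zeta_reg :: "complex \<Rightarrow> complex" where
  "zeta_reg s = 1 + (\<Sum>n. zeta_term (Suc n) s)"

text \<open>On a small disc the series is dominated by a convergent series \<open>sum n^(-1-c)\<close>.\<close>

lemma zeta_reg_holomorphic: "zeta_reg holomorphic_on {s. Re s > 0}"
proof -
  let ?S = "{s::complex. Re s > 0}"
  have op: "open ?S" by (rule open_halfspace_Re_gt)
  let ?f' = "\<lambda>n s. deriv (zeta_term (Suc n)) s"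
  have d: "(zeta_term (Suc n) has_field_derivative deriv (zeta_term (Suc n)) s) (at s)" for n s
  proof -
    have "zeta_term (Suc n) field_differentiable at s"
      unfolding zeta_term_def npow_def by (intro holomorphic_on_imp_differentiable_at[of _ UNIV] holomorphic_intros) auto
    thus ?thesis by (simp add: field_differentiable_derivI)
  qed
  have "\<exists>g g'. \<forall>x\<in>?S. (\<lambda>n. zeta_term (Suc n) x) sums g x \<and> (\<lambda>n. ?f' n x) sums g' x \<and> (g has_field_derivative g' x) (at x)"
  proof (rule series_and_derivative_comparison_local[OF op d])
    fix s assume "s \<in> ?S"
    define c where "c = Re s / 2"
    have c: "c > 0" using \<open>s \<in> ?S\<close> by (simp add: c_def)
    define R where "R = norm s + c"
    define h where "h n = 2 * (R + 1) * R * real (Suc n) powr (- (c + 1))" for n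
    have "summable h" unfolding h_def using c by (intro summable_mult summable_nat_powr) auto
    moreover have "norm (zeta_term (Suc n) y) \<le> h n" if y: "y \<in> ball s c" for n y
    proof -
      have d: "norm (y - s) < c" using y by (simp add: dist_norm norm_minus_commute)
      have "- c < Re (y - s)" using abs_Re_le_cmod[of "y - s"] d by linarith
      hence "Re s - c < Re y" by simp
      hence re: "Re y \<ge> c" by (simp add: c_def)
      have ny: "norm y \<le> R" unfolding R_def using d norm_triangle_ineq[of s "y - s"] by simp
      have ny1: "norm (y - 1) \<le> R + 1" using norm_triangle_ineq4[of y 1] ny by simp
      have "norm (zeta_term (Suc n) y) \<le> 2 * norm (y - 1) * norm y powr 1 * real (Suc n) powr (- Re y - 1)"
        using re c by (intro norm_zeta_term_le) auto
      also have "\<dots> \<le> 2 * (R + 1) * R * real (Suc n) powr (- (c + 1))"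
        using re c ny ny1 order.trans[OF norm_ge_zero ny]
        by (intro mult_mono powr_mono mult_nonneg_nonneg) auto
      finally show ?thesis by (simp add: h_def)
    qed
    ultimately show "\<exists>d h. 0 < d \<and> summable h \<and> (\<forall>\<^sub>F n in sequentially. \<forall>y\<in>ball s d \<inter> ?S. norm (zeta_term (Suc n) y) \<le> h n)"
      using c by (intro exI[of _ c] exI[of _ h]) auto
  qed
  then obtain g g' where g: "\<forall>x\<in>?S. (\<lambda>n. zeta_term (Suc n) x) sums g x \<and> (g has_field_derivative g' x) (at x)"
    by metis
  have "(\<lambda>s. 1 + g s) holomorphic_on ?S"
    using g op by (intro holomorphic_intros) (auto simp: holomorphic_on_open)
  moreover have "zeta_reg s = 1 + g s" if "s \<in> ?S" for s
    using g that by (auto simp: zeta_reg_def sums_iff)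
  ultimately show ?thesis using holomorphic_transform[of "\<lambda>s. 1 + g s" ?S zeta_reg] by auto
qed

lemma zeta_reg_1: "zeta_reg 1 = 1"
  by (simp add: zeta_reg_def zeta_term_def npow_def)

lemma norm_zeta_reg_le:
  fixes a :: real
  assumes a: "0 < a" "a \<le> 1"
  obtains C where "C > 0" "\<And>s. Re s \<ge> 1 - a / 2 \<Longrightarrow> norm (zeta_reg s) \<le> 1 + C * norm (s - 1) * norm s powr a"
proof -
  define T where "T = (\<Sum>n. real (Suc n) powr (- (1 + a / 2)))"
  have su: "summable (\<lambda>n. real (Suc n) powr (- (1 + a / 2)))" using a by (intro summable_nat_powr) auto
  have T: "T \<ge> 0" unfolding T_def using su by (intro suminf_nonneg) auto
  show thesis
  proof (rule that[of "2 * T + 1"])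
    fix s :: complex assume s: "Re s \<ge> 1 - a / 2"
    define D where "D = 2 * norm (s - 1) * norm s powr a"
    have le: "norm (zeta_term (Suc n) s) \<le> D * real (Suc n) powr (- (1 + a / 2))" for n
    proof -
      have "norm (zeta_term (Suc n) s) \<le> D * real (Suc n) powr (- Re s - a)"
        unfolding D_def using s a by (intro norm_zeta_term_le) auto
      also have "\<dots> \<le> D * real (Suc n) powr (- (1 + a / 2))"
        using s by (intro mult_left_mono powr_mono) (auto simp: D_def)
      finally show ?thesis .
    qed
    have "norm (\<Sum>n. zeta_term (Suc n) s) \<le> (\<Sum>n. D * real (Suc n) powr (- (1 + a / 2)))"
      by (rule norm_suminf_le[OF le]) (intro summable_mult su)
    also have "\<dots> = D * T" unfolding T_def by (rule suminf_mult[OF su])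
    finally have "norm (zeta_reg s) \<le> 1 + D * T"
      unfolding zeta_reg_def using norm_triangle_ineq[of 1 "\<Sum>n. zeta_term (Suc n) s"] by simp
    also have "D * T \<le> (2 * T + 1) * norm (s - 1) * norm s powr a"
      unfolding D_def by (simp add: algebra_simps)
    finally show "norm (zeta_reg s) \<le> 1 + (2 * T + 1) * norm (s - 1) * norm s powr a" by simp
  qed (use T in auto)
qed

lemma summable_norm_npow:
  assumes "Re s > 1"
  shows "summable (\<lambda>n. norm (npow (real (Suc n)) s))"
  using summable_nat_powr[OF assms] by (simp add: norm_npow)

lemma zeta_reg_eq:
  assumes s: "Re s > 1"
  shows "(\<lambda>n. npow (real (Suc n)) s) sums (zeta_reg s / (s - 1))"
proof -
  have s1: "s - 1 \<noteq> 0" using s by auto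
  have su: "summable (\<lambda>n. npow (real (Suc n)) s)" by (rule summable_norm_cancel[OF summable_norm_npow[OF s]])
  have lim: "(\<lambda>n. npow (real (Suc n)) (s - 1)) \<longlonglongrightarrow> 0"
  proof (rule tendsto_norm_zero_cancel)
    have "((\<lambda>x::real. x powr (- (Re s - 1))) \<longlongrightarrow> 0) at_top"
      using s by (intro tendsto_neg_powr filterlim_ident) auto
    hence "(\<lambda>n. real (Suc n) powr (- (Re s - 1))) \<longlonglongrightarrow> 0"
      by (rule filterlim_compose) (intro filterlim_compose[OF filterlim_real_sequentially] filterlim_Suc)
    thus "(\<lambda>n. norm (npow (real (Suc n)) (s - 1))) \<longlonglongrightarrow> 0" by (simp add: norm_npow)
  qed
  have "(\<lambda>n. npow (real (Suc (Suc n))) (s - 1) - npow (real (Suc n)) (s - 1)) sums (0 - npow (real (Suc 0)) (s - 1))"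
    using telescope_sums[OF lim] by simp
  hence tel: "(\<lambda>n. npow (real (Suc n) + 1) (s - 1) - npow (real (Suc n)) (s - 1)) sums (- 1)"
    by (simp add: add_ac)
  have "(\<lambda>n. (s - 1) * npow (real (Suc n)) s) sums ((s - 1) * (\<Sum>n. npow (real (Suc n)) s))"
    by (intro sums_mult summable_sums su)
  from sums_add[OF this tel] have "(\<lambda>n. zeta_term (Suc n) s) sums ((s - 1) * (\<Sum>n. npow (real (Suc n)) s) - 1)"
    unfolding zeta_term_def by (simp add: algebra_simps)
  hence "zeta_reg s = (s - 1) * (\<Sum>n. npow (real (Suc n)) s)" unfolding zeta_reg_def by (simp add: sums_iff)
  thus ?thesis using su s1 by (simp add: summable_sums)
qed

section \<open>Euler product and the inequality with exponents 3, 4, 1\<close>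

lemma summable_on_powr:
  assumes "c > 1" shows "(\<lambda>n. real n powr (- c)) summable_on A"
proof -
  have "summable (\<lambda>n. norm (real n powr (- c)))" using assms by (simp add: summable_real_powr_iff)
  hence "(\<lambda>n. real n powr (- c)) summable_on UNIV" by (rule norm_summable_imp_summable_on)
  thus ?thesis by (rule summable_on_subset_banach) auto
qed

lemma infsum_powr_tail_tendsto_0:
  assumes "c > 1"
  shows "(\<lambda>N. infsum (\<lambda>n. real n powr (- c)) {N<..}) \<longlonglongrightarrow> 0"
proof -
  let ?f = "\<lambda>n. real n powr (- c)"
  have su: "?f summable_on A" for A by (rule summable_on_powr[OF assms])
  have "(?f has_sum infsum ?f UNIV) UNIV" by (rule has_sum_infsum[OF su])
  hence "?f sums infsum ?f UNIV" by (rule has_sum_imp_sums)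
  hence "(\<lambda>N. \<Sum>n\<le>N. ?f n) \<longlonglongrightarrow> infsum ?f UNIV" by (simp add: sums_def_le)
  hence "(\<lambda>N. infsum ?f UNIV - (\<Sum>n\<le>N. ?f n)) \<longlonglongrightarrow> infsum ?f UNIV - infsum ?f UNIV"
    by (intro tendsto_diff tendsto_const)
  moreover have "infsum ?f UNIV - (\<Sum>n\<le>N. ?f n) = infsum ?f {N<..}" for N
  proof -
    have "infsum ?f ({..N} \<union> {N<..}) = infsum ?f {..N} + infsum ?f {N<..}"
      by (rule infsum_Un_disjoint) (auto intro: su)
    moreover have "{..N} \<union> {N<..} = UNIV" by auto
    ultimately show ?thesis by simp
  qed
  ultimately show ?thesis by simp
qed

text \<open>Both the Euler product and its reciprocal are compared with a full Dirichlet series in this way: the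
  terms that a finite product misses all have index above \<open>N\<close>.\<close>

lemma has_sum_diff_le_tail:
  fixes f :: "nat \<Rightarrow> complex"
  assumes f: "(f has_sum S) A" "(f has_sum T) B" "B \<subseteq> A" "A - B \<subseteq> {N<..}"
    and le: "\<And>n. n \<in> A \<Longrightarrow> norm (f n) \<le> real n powr (- c)" and c: "c > 1"
  shows "norm (S - T) \<le> infsum (\<lambda>n. real n powr (- c)) {N<..}"
proof -
  have d: "(f has_sum (S - T)) (A - B)" using has_sum_Diff[OF f(1,2,3)] .
  have "norm (S - T) \<le> infsum (\<lambda>n. real n powr (- c)) (A - B)"
    by (rule norm_infsum_le[OF d has_sum_infsum[OF summable_on_powr[OF c]]]) (use le in auto)
  also have "\<dots> \<le> infsum (\<lambda>n. real n powr (- c)) {N<..}"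
    by (rule infsum_mono2[OF summable_on_powr[OF c] summable_on_powr[OF c] f(4)]) auto
  finally show ?thesis .
qed

definition zeta :: "complex \<Rightarrow> complex" where "zeta s = zeta_reg s / (s - 1)"

lemma has_sum_atLeast_1I:
  fixes f :: "nat \<Rightarrow> complex"
  assumes "((\<lambda>n. f (Suc n)) has_sum S) UNIV" shows "(f has_sum S) {1..}"
proof -
  have "(f has_sum S) (Suc ` UNIV)" using assms by (subst has_sum_reindex) (auto simp: o_def)
  moreover have "Suc ` UNIV = {1..}" by (auto simp: image_iff Suc_le_eq gr0_conv_Suc)
  ultimately show ?thesis by simp
qed

lemma zeta_has_sum:
  assumes "Re s > 1" shows "((\<lambda>n. npow (real n) s) has_sum zeta s) {1..}"
proof -
  have "((\<lambda>n. npow (real (Suc n)) s) has_sum zeta s) UNIV"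
    using norm_summable_imp_has_sum[OF summable_norm_npow[OF assms]] zeta_reg_eq[OF assms]
    by (simp add: zeta_def)
  thus ?thesis by (rule has_sum_atLeast_1I)
qed

definition euler_prod :: "nat set \<Rightarrow> complex \<Rightarrow> complex" where
  "euler_prod A s = (\<Prod>p\<in>A. 1 - npow (real p) s)"

text \<open>The sieve of Eratosthenes: multiplying by \<open>1 - p^(-s)\<close> removes the multiples of \<open>p\<close>.\<close>

lemma zeta_euler_prod_has_sum:
  assumes s: "Re s > 1" and A: "finite A" "\<And>p. p \<in> A \<Longrightarrow> prime p"
  shows "((\<lambda>n. npow (real n) s) has_sum (zeta s * euler_prod A s)) {n. n \<ge> 1 \<and> (\<forall>p\<in>A. \<not> p dvd n)}"
  using A
proof (induction A rule: finite_induct)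
  case empty
  thus ?case using zeta_has_sum[OF s] by (simp add: euler_prod_def atLeast_def)
next
  case (insert p A)
  let ?Q = "\<lambda>A. {n::nat. n \<ge> 1 \<and> (\<forall>p\<in>A. \<not> p dvd n)}"
  have p: "prime p" "p > 0" using insert.prems prime_gt_0_nat by auto
  have IH: "((\<lambda>n. npow (real n) s) has_sum (zeta s * euler_prod A s)) (?Q A)"
    using insert by auto
  have inj: "inj_on ((*) p) (?Q A)" using p by (auto simp: inj_on_def)
  have "((\<lambda>n. npow (real p) s * npow (real n) s) has_sum (npow (real p) s * (zeta s * euler_prod A s))) (?Q A)"
    by (rule has_sum_cmult_right[OF IH])
  moreover have "npow (real p) s * npow (real n) s = npow (real (p * n)) s" if "n \<in> ?Q A" for n
    using that p by (simp add: npow_mult)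
  ultimately have "((\<lambda>n. npow (real (p * n)) s) has_sum (npow (real p) s * (zeta s * euler_prod A s))) (?Q A)"
    by (subst has_sum_cong[of "?Q A" _ "\<lambda>n. npow (real p) s * npow (real n) s"]) auto
  hence "((\<lambda>n. npow (real n) s) has_sum (npow (real p) s * (zeta s * euler_prod A s))) ((*) p ` ?Q A)"
    by (subst has_sum_reindex[OF inj]) (simp add: o_def)
  from has_sum_Diff[OF IH this] have
    "((\<lambda>n. npow (real n) s) has_sum (zeta s * euler_prod A s - npow (real p) s * (zeta s * euler_prod A s))) (?Q A - (*) p ` ?Q A)"
  proof -
    have "(*) p ` ?Q A \<subseteq> ?Q A"
    proof clarify
      fix n assume n: "n \<ge> 1" "\<forall>p\<in>A. \<not> p dvd n"
      have "\<not> q dvd p * n" if "q \<in> A" for q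
        using that n insert p by (metis insertCI prime_dvd_mult_iff primes_dvd_imp_eq)
      thus "1 \<le> p * n \<and> (\<forall>q\<in>A. \<not> q dvd p * n)" using n p by auto
    qed
    thus ?thesis using has_sum_Diff[OF IH \<open>(_ has_sum _) ((*) p ` ?Q A)\<close>] by simp
  qed
  moreover have "?Q A - (*) p ` ?Q A = ?Q (insert p A)"
  proof (intro set_eqI iffI)
    fix n assume n: "n \<in> ?Q A - (*) p ` ?Q A"
    have "\<not> p dvd n"
    proof
      assume "p dvd n"
      then obtain m where m: "n = p * m" by auto
      have "m \<in> ?Q A" using n m by (auto simp: Suc_le_eq)
      thus False using n m by auto
    qed
    thus "n \<in> ?Q (insert p A)" using n by auto
  qed auto
  moreover have "zeta s * euler_prod A s - npow (real p) s * (zeta s * euler_prod A s) = zeta s * euler_prod (insert p A) s"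
    using insert.hyps by (simp add: euler_prod_def algebra_simps)
  ultimately show ?case by simp
qed

lemma zeta_euler_prod_tendsto_1:
  assumes s: "Re s > 1"
  shows "(\<lambda>N. zeta s * euler_prod (primes_upto (real N)) s) \<longlonglongrightarrow> 1"
proof (rule Lim_null_comparison[THEN LIM_zero_cancel])
  show "(\<lambda>N. infsum (\<lambda>n. real n powr (- Re s)) {N<..}) \<longlonglongrightarrow> 0"
    by (rule infsum_powr_tail_tendsto_0[OF s])
  show "\<forall>\<^sub>F N in sequentially. norm (zeta s * euler_prod (primes_upto (real N)) s - 1)
          \<le> infsum (\<lambda>n. real n powr (- Re s)) {N<..}"
  proof (intro always_eventually allI)
    fix N
    let ?A = "primes_upto (real N)"
    show "norm (zeta s * euler_prod ?A s - 1) \<le> infsum (\<lambda>n. real n powr (- Re s)) {N<..}"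
    proof (rule has_sum_diff_le_tail)
      show "((\<lambda>n. npow (real n) s) has_sum (zeta s * euler_prod ?A s)) {n. n \<ge> 1 \<and> (\<forall>p\<in>?A. \<not> p dvd n)}"
        by (rule zeta_euler_prod_has_sum[OF s]) (auto dest: primes_uptoD)
      show "((\<lambda>n. npow (real n) s) has_sum 1) {1::nat}" using has_sum_finite[of "{1::nat}" "\<lambda>n. npow (real n) s"] by simp
      show "{1} \<subseteq> {n. n \<ge> 1 \<and> (\<forall>p\<in>?A. \<not> p dvd n)}" by (auto dest: primes_uptoD)
      show "{n. n \<ge> 1 \<and> (\<forall>p\<in>?A. \<not> p dvd n)} - {1} \<subseteq> {N<..}"
      proof
        fix n assume n: "n \<in> {n. n \<ge> 1 \<and> (\<forall>p\<in>?A. \<not> p dvd n)} - {1}"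
        then obtain p where p: "prime p" "p dvd n" using prime_factor_nat[of n] by auto
        hence "\<not> real p \<le> real N" using n by (auto simp: primes_upto_def)
        moreover have "p \<le> n" using p n by (intro dvd_imp_le) auto
        ultimately show "n \<in> {N<..}" by simp
      qed
    qed (use s in \<open>auto simp: norm_npow\<close>)
  qed
qed

definition moebius_series :: "complex \<Rightarrow> complex" where
  "moebius_series s = (\<Sum>n. of_int (moebius (Suc n)) * npow (real (Suc n)) s)"

lemma abs_moebius_le_1: "\<bar>moebius n\<bar> \<le> 1"
  by (simp add: moebius_def power_abs)

lemma norm_moebius_npow_le:
  assumes "n \<ge> 1" shows "norm (of_int (moebius n) * npow (real n) s) \<le> real n powr (- Re s)"
proof -
  have "norm (of_int (moebius n) * npow (real n) s) = real_of_int \<bar>moebius n\<bar> * real n powr (- Re s)"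
    using assms by (simp add: norm_mult norm_npow)
  also have "\<dots> \<le> 1 * real n powr (- Re s)"
    using abs_moebius_le_1[of n] by (intro mult_right_mono) auto
  finally show ?thesis by simp
qed

lemma moebius_series_has_sum:
  assumes "Re s > 1"
  shows "((\<lambda>n. of_int (moebius n) * npow (real n) s) has_sum moebius_series s) {1..}"
proof -
  have su: "summable (\<lambda>n. norm (of_int (moebius (Suc n)) * npow (real (Suc n)) s))"
  proof (rule summable_comparison_test'[OF summable_nat_powr[OF assms]])
    fix n
    show "norm (norm (of_int (moebius (Suc n)) * npow (real (Suc n)) s)) \<le> real (Suc n) powr (- Re s)"
      using norm_moebius_npow_le[of "Suc n" s] by simp
  qed
  have "((\<lambda>n. of_int (moebius (Suc n)) * npow (real (Suc n)) s) has_sum moebius_series s) UNIV"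
    unfolding moebius_series_def
    by (rule norm_summable_imp_has_sum[OF su summable_sums[OF summable_norm_cancel[OF su]]])
  thus ?thesis by (rule has_sum_atLeast_1I)
qed

lemma euler_prod_eq_sum:
  assumes A: "finite A" "\<And>p. p \<in> A \<Longrightarrow> prime p"
  shows "finite {n. squarefree n \<and> prime_factors n \<subseteq> A} \<and>
         euler_prod A s = (\<Sum>n | squarefree n \<and> prime_factors n \<subseteq> A. of_int (moebius n) * npow (real n) s)"
  using A
proof (induction A rule: finite_induct)
  case empty
  have "{n::nat. squarefree n \<and> prime_factors n \<subseteq> {}} = {1}"
    by (auto simp: prime_factorization_empty_iff)
  thus ?case by (simp add: euler_prod_def moebius_def)
next
  case (insert p A)
  let ?Q = "\<lambda>A. {n. squarefree n \<and> prime_factors n \<subseteq> A}"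
  let ?f = "\<lambda>n. of_int (moebius n) * npow (real n) s :: complex"
  have p: "prime p" "p > 0" using insert.prems prime_gt_0_nat by auto
  have fin: "finite (?Q A)" and IH: "euler_prod A s = sum ?f (?Q A)" using insert by auto
  have nd: "\<not> p dvd n" "n > 0" "p \<notin> prime_factors n" if "n \<in> ?Q A" for n
  proof -
    show "n > 0" using that by (cases n) auto
    show "p \<notin> prime_factors n" using that insert.hyps by auto
    thus "\<not> p dvd n" using \<open>n > 0\<close> p by (auto simp: in_prime_factors_iff)
  qed
  have eq: "?Q (insert p A) = ?Q A \<union> (*) p ` ?Q A"
  proof (intro set_eqI iffI)
    fix n assume n: "n \<in> ?Q (insert p A)"
    hence n0: "n > 0" by (cases n) auto
    show "n \<in> ?Q A \<union> (*) p ` ?Q A"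
    proof (cases "p dvd n")
      case True
      then obtain m where m: "n = p * m" by auto
      have sq: "squarefree m" "\<not> p dvd m" using n m squarefree_prime_mult_iff[OF p(1)] by auto
      have "prime_factors n = insert p (prime_factors m)"
        unfolding m using p n0 m by (simp add: prime_factors_product prime_prime_factors)
      hence "m \<in> ?Q A" using n sq by auto
      thus ?thesis using m by auto
    next
      case False
      thus ?thesis using n by auto
    qed
  next
    fix n assume "n \<in> ?Q A \<union> (*) p ` ?Q A"
    thus "n \<in> ?Q (insert p A)"
    proof
      assume "n \<in> (*) p ` ?Q A"
      then obtain m where m: "n = p * m" "m \<in> ?Q A" by auto
      have "prime_factors n = insert p (prime_factors m)"
        unfolding m using p nd[OF m(2)] by (simp add: prime_factors_product prime_prime_factors)
      thus ?thesis using m nd[OF m(2)] squarefree_prime_mult_iff[OF p(1)] by auto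
    qed auto
  qed
  have fin': "finite (?Q (insert p A))" unfolding eq using fin by auto
  have "n \<notin> (*) p ` ?Q A" if "n \<in> ?Q A" for n
    using nd(1)[OF that] by auto
  hence disj: "?Q A \<inter> (*) p ` ?Q A = {}" by blast
  have inj: "inj_on ((*) p) (?Q A)" using p by (auto simp: inj_on_def)
  have "sum ?f (?Q (insert p A)) = sum ?f (?Q A) + sum ?f ((*) p ` ?Q A)"
    unfolding eq by (rule sum.union_disjoint) (use fin disj in auto)
  also have "sum ?f ((*) p ` ?Q A) = (\<Sum>m\<in>?Q A. ?f (p * m))" by (subst sum.reindex[OF inj]) simp
  also have "\<dots> = (\<Sum>m\<in>?Q A. - npow (real p) s * ?f m)"
  proof (rule sum.cong)
    fix m assume m: "m \<in> ?Q A"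
    have "moebius (p * m) = - moebius m"
      using m p nd[OF m] omega_prime_mult[OF p(1) nd(1,2)[OF m]]
      by (simp add: moebius_def squarefree_prime_mult_iff omega_def)
    thus "?f (p * m) = - npow (real p) s * ?f m"
      using p nd[OF m] by (simp add: npow_mult)
  qed auto
  also have "(\<Sum>m\<in>?Q A. - npow (real p) s * ?f m) = - npow (real p) s * sum ?f (?Q A)"
    by (rule sum_distrib_left[symmetric])
  also have "sum ?f (?Q A) + \<dots> = (1 - npow (real p) s) * euler_prod A s"
    unfolding IH by (simp only: ring_distribs mult_1_left) simp
  also have "\<dots> = euler_prod (insert p A) s" using insert.hyps by (simp add: euler_prod_def)
  finally show ?case using fin' by simp
qed

lemma euler_prod_tendsto:
  assumes s: "Re s > 1"
  shows "(\<lambda>N. euler_prod (primes_upto (real N)) s) \<longlonglongrightarrow> moebius_series s"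
proof -
  have "(\<lambda>N. moebius_series s - euler_prod (primes_upto (real N)) s) \<longlonglongrightarrow> 0"
  proof (rule Lim_null_comparison)
    show "(\<lambda>N. infsum (\<lambda>n. real n powr (- Re s)) {N<..}) \<longlonglongrightarrow> 0"
      by (rule infsum_powr_tail_tendsto_0[OF s])
    show "\<forall>\<^sub>F N in sequentially. norm (moebius_series s - euler_prod (primes_upto (real N)) s)
            \<le> infsum (\<lambda>n. real n powr (- Re s)) {N<..}"
    proof (intro always_eventually allI)
      fix N
      let ?A = "primes_upto (real N)"
      let ?f = "\<lambda>n. of_int (moebius n) * npow (real n) s :: complex"
      let ?Q = "{n. squarefree n \<and> prime_factors n \<subseteq> ?A}"
      note E = euler_prod_eq_sum[of ?A s]
      have E1: "finite ?Q" "euler_prod ?A s = sum ?f ?Q" using E by (auto dest: primes_uptoD)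
      have F: "(?f has_sum moebius_series s) {n. squarefree n}"
      proof -
        have "(?f has_sum moebius_series s) {n. squarefree n} \<longleftrightarrow> (?f has_sum moebius_series s) {1..}"
          by (rule has_sum_cong_neutral) (auto simp: moebius_def Suc_le_eq intro: Nat.gr0I)
        thus ?thesis using moebius_series_has_sum[OF s] by simp
      qed
      show "norm (moebius_series s - euler_prod ?A s) \<le> infsum (\<lambda>n. real n powr (- Re s)) {N<..}"
      proof (rule has_sum_diff_le_tail[OF F])
        show "(?f has_sum euler_prod ?A s) ?Q" unfolding E1(2) by (rule has_sum_finite[OF E1(1)])
        show "{n. squarefree n} - ?Q \<subseteq> {N<..}"
        proof
          fix n assume n: "n \<in> {n. squarefree n} - ?Q"
          hence n0: "n > 0" by (cases n) auto
          from n obtain p where p: "p \<in> prime_factors n" "p \<notin> ?A" by auto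
          have "p \<le> n" using p n0 by (intro dvd_imp_le) auto
          moreover have "\<not> real p \<le> real N" using p by (auto simp: primes_upto_def)
          ultimately show "n \<in> {N<..}" by simp
        qed
        show "norm (?f n) \<le> real n powr (- Re s)" if "n \<in> {n. squarefree n}" for n
          using that by (intro norm_moebius_npow_le) (cases n; auto)
      qed (use s in auto)
    qed
  qed
  hence "(\<lambda>N. moebius_series s - (moebius_series s - euler_prod (primes_upto (real N)) s)) \<longlonglongrightarrow> moebius_series s - 0"
    by (intro tendsto_diff tendsto_const)
  thus ?thesis by simp
qed

text \<open>The partial products of the Euler product tend to the series of the Moebius function, and their
  products with \<open>\<zeta>(s)\<close> tend to \<open>1\<close>.\<close>

lemma zeta_mult_moebius_series:
  assumes "Re s > 1" shows "zeta s * moebius_series s = 1"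
  using LIMSEQ_unique[OF tendsto_mult[OF tendsto_const euler_prod_tendsto[OF assms]] zeta_euler_prod_tendsto_1[OF assms]] .

text \<open>Expand the logarithms: the \<open>m\<close>-th coefficient is \<open>-(3 + 4 cos m\<theta> + cos 2m\<theta>) / m\<close>, which is not
  positive because \<open>3 + 4 cos \<theta> + cos 2\<theta> = 2 (1 + cos \<theta>)^2\<close>.\<close>

lemma trig_product_le_1:
  fixes x :: real and z :: complex
  assumes x: "0 \<le> x" "x < 1" and z: "norm z = 1"
  shows "(1 - x) ^ 3 * norm (1 - of_real x * z) ^ 4 * norm (1 - of_real x * z ^ 2) \<le> 1"
proof -
  have lnabs: "(\<lambda>n. - (x ^ Suc n / real (Suc n) * Re (w ^ Suc n))) sums ln (norm (1 - of_real x * w))"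
    if "norm w = 1" for w :: complex
  proof -
    let ?u = "- (of_real x * w) :: complex"
    have nu: "norm ?u < 1" using that x by (simp add: norm_mult)
    have ne: "1 + ?u \<noteq> 0" using nu by (metis add.inverse_inverse add_eq_0_iff norm_minus_cancel norm_one order_less_irrefl)
    have "(\<lambda>n. (- 1) ^ Suc n / of_nat n * ?u ^ n) sums Ln (1 + ?u)" by (rule Ln_series[OF nu])
    hence "(\<lambda>n. (- 1) ^ Suc (Suc n) / of_nat (Suc n) * ?u ^ Suc n) sums Ln (1 + ?u)"
      using sums_Suc_iff[of "\<lambda>n. (- 1) ^ Suc n / of_nat n * ?u ^ n" "Ln (1 + ?u)"] by simp
    hence "(\<lambda>n. Re ((- 1) ^ Suc (Suc n) / of_nat (Suc n) * ?u ^ Suc n)) sums Re (Ln (1 + ?u))"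
      by (rule sums_Re)
    moreover have "Re ((- 1) ^ Suc (Suc n) / of_nat (Suc n) * ?u ^ Suc n) = - (x ^ Suc n / real (Suc n) * Re (w ^ Suc n))" for n
    proof -
      have "(- 1) ^ Suc (Suc n) * ?u ^ Suc n = - (of_real (x ^ Suc n) * w ^ Suc n)"
        by (simp add: power_minus[of "of_real x * w"] power_mult_distrib)
      hence "(- 1) ^ Suc (Suc n) / of_nat (Suc n) * ?u ^ Suc n = of_real (- (x ^ Suc n / real (Suc n))) * w ^ Suc n"
        by (simp add: divide_simps mult_ac)
      thus ?thesis by (simp only: Re_complex_of_real times_complex.sel Im_complex_of_real)
    qed
    ultimately show ?thesis using ne by (simp add: Re_Ln)
  qed
  have z2: "norm (z ^ 2) = 1" using z by (simp add: norm_power)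
  let ?t = "\<lambda>n. 3 * (- (x ^ Suc n / real (Suc n) * Re (1 ^ Suc n))) +
              4 * (- (x ^ Suc n / real (Suc n) * Re (z ^ Suc n))) +
              (- (x ^ Suc n / real (Suc n) * Re ((z ^ 2) ^ Suc n)))"
  have series: "?t sums (3 * ln (norm (1 - of_real x * (1::complex))) + 4 * ln (norm (1 - of_real x * z)) + ln (norm (1 - of_real x * z ^ 2)))"
    by (rule sums_add[OF sums_add[OF sums_mult[OF lnabs[OF norm_one]] sums_mult[OF lnabs[OF z]]] lnabs[OF z2]])
  have nonpos: "?t n \<le> 0" for n
  proof -
    define w where "w = z ^ Suc n"
    have "norm w = 1" unfolding w_def norm_power z by simp
    hence "(Re w)\<^sup>2 + (Im w)\<^sup>2 = 1" by (metis cmod_power2 one_power2)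
    hence "Re (w ^ 2) = 2 * (Re w)\<^sup>2 - 1" by (simp add: power2_eq_square)
    hence e: "3 + 4 * Re w + Re (w ^ 2) = 2 * (1 + Re w)\<^sup>2" by (simp add: power2_eq_square algebra_simps)
    have "(z ^ 2) ^ Suc n = w ^ 2" unfolding w_def power_mult[symmetric] by (simp only: mult.commute)
    moreover have "(x ^ Suc n / real (Suc n)) * (3 + 4 * Re w + Re (w ^ 2)) \<ge> 0"
      unfolding e using x by (intro mult_nonneg_nonneg[of "x ^ Suc n / real (Suc n)"]) auto
    ultimately show ?thesis unfolding w_def[symmetric] by (simp add: algebra_simps)
  qed
  have "3 * ln (norm (1 - of_real x * (1::complex))) + 4 * ln (norm (1 - of_real x * z)) + ln (norm (1 - of_real x * z ^ 2)) \<le> 0"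
    using sums_le[OF nonpos series sums_zero] by blast
  moreover have ne: "norm (1 - of_real x * w) > 0" if "norm w = 1" for w :: complex
  proof -
    have "of_real x * w \<noteq> 1" using that x by (metis norm_mult norm_of_real abs_of_nonneg mult.right_neutral norm_one order_less_irrefl)
    thus ?thesis by simp
  qed
  moreover have "norm (1 - of_real x * 1 :: complex) = 1 - x"
    using x norm_of_real[of "1 - x", where ?'a = complex] by simp
  ultimately have "ln ((1 - x) ^ 3 * norm (1 - of_real x * z) ^ 4 * norm (1 - of_real x * z ^ 2)) \<le> 0"
    using x ne[OF z] ne[OF z2] by (simp add: ln_mult ln_realpow)
  thus ?thesis using x ne[OF z] ne[OF z2] by (subst (asm) ln_le_zero_iff) auto
qed

lemma moebius_series_3_4_1:
  assumes "\<sigma> > 1"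
  shows "norm (moebius_series (of_real \<sigma>)) ^ 3 * norm (moebius_series (Complex \<sigma> t)) ^ 4 * norm (moebius_series (Complex \<sigma> (2 * t))) \<le> 1"
proof (rule LIMSEQ_le_const2)
  let ?T = "\<lambda>F :: complex \<Rightarrow> complex. norm (F (of_real \<sigma>)) ^ 3 * norm (F (Complex \<sigma> t)) ^ 4 * norm (F (Complex \<sigma> (2 * t)))"
  show "(\<lambda>N. ?T (euler_prod (primes_upto (real N)))) \<longlonglongrightarrow> ?T moebius_series"
    using assms by (intro tendsto_intros euler_prod_tendsto) auto
  show "\<exists>N. \<forall>n\<ge>N. ?T (euler_prod (primes_upto (real n))) \<le> 1"
  proof (intro exI[of _ 0] allI impI)
    fix N :: nat
    let ?A = "primes_upto (real N)"
    have "?T (euler_prod ?A) = (\<Prod>p\<in>?A. ?T (\<lambda>s. 1 - npow (real p) s))"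
      by (simp add: euler_prod_def prod_norm[symmetric] prod.distrib prod_power_distrib)
    also have "\<dots> \<le> 1"
    proof (rule prod_le_1)
      fix p assume p: "p \<in> ?A"
      note pp = primes_uptoD[OF p]
      define x where "x = real p powr (- \<sigma>)"
      define z where "z = npow (real p) (Complex 0 t)"
      have x: "0 \<le> x" "x < 1" using assms pp powr_less_mono[of "-\<sigma>" 0 "real p"] by (auto simp: x_def)
      have z: "norm z = 1" using pp by (simp add: z_def norm_npow)
      have e0: "npow (real p) (of_real \<sigma>) = of_real x"
        using pp by (simp add: npow_def x_def powr_def flip: exp_of_real)
      have e1: "npow (real p) (Complex \<sigma> t) = of_real x * z"
        unfolding e0[symmetric] z_def npow_add_exponent[symmetric] by (simp add: complex_eq_iff Complex_eq)
      have e2: "npow (real p) (Complex \<sigma> (2 * t)) = of_real x * z ^ 2"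
        unfolding e0[symmetric] z_def power2_eq_square npow_add_exponent[symmetric]
        by (rule arg_cong[of _ _ "npow (real p)"]) (simp add: complex_eq_iff)
      have "norm (complex_of_real (1 - x)) = \<bar>1 - x\<bar>" by (rule norm_of_real)
      hence "norm (1 - complex_of_real x) = 1 - x" using x by simp
      thus "0 \<le> ?T (\<lambda>s. 1 - npow (real p) s) \<and> ?T (\<lambda>s. 1 - npow (real p) s) \<le> 1"
        unfolding e0 e1 e2 using trig_product_le_1[OF x z] x by simp
    qed
    finally show "?T (euler_prod ?A) \<le> 1" .
  qed
qed

section \<open>The Dirichlet series of the Moebius function and its second derivative\<close>

text \<open>A class of coefficients for which the Dirichlet series converges for \<open>Re s > 1\<close>. It contains the
  Moebius function and is closed under multiplication by \<open>log n\<close>, hence under differentiation of the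
  series.\<close>

definition subpolynomial :: "(nat \<Rightarrow> complex) \<Rightarrow> bool" where
  "subpolynomial a \<longleftrightarrow> (\<forall>\<epsilon>>0. \<exists>A\<ge>0. \<forall>n\<ge>1. norm (a n) \<le> A * real n powr \<epsilon>)"

definition dirichlet :: "(nat \<Rightarrow> complex) \<Rightarrow> complex \<Rightarrow> complex" where
  "dirichlet a s = (\<Sum>n. a (Suc n) * npow (real (Suc n)) s)"

lemma subpolynomial_ln:
  assumes "subpolynomial a"
  shows "subpolynomial (\<lambda>n. - of_real (ln (real n)) * a n)"
  unfolding subpolynomial_def
proof (intro allI impI)
  fix \<epsilon> :: real assume e: "\<epsilon> > 0"
  obtain A where A: "A \<ge> 0" "\<And>n. n \<ge> 1 \<Longrightarrow> norm (a n) \<le> A * real n powr (\<epsilon> / 2)"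
    using assms e unfolding subpolynomial_def by (meson half_gt_zero)
  show "\<exists>A'\<ge>0. \<forall>n\<ge>1. norm (- of_real (ln (real n)) * a n) \<le> A' * real n powr \<epsilon>"
  proof (intro exI[of _ "2 / \<epsilon> * A"] conjI allI impI)
    fix n :: nat assume n: "n \<ge> 1"
    have "norm (- of_real (ln (real n)) * a n) = ln (real n) * norm (a n)"
      using n by (simp add: norm_mult)
    also have "\<dots> \<le> (real n powr (\<epsilon> / 2) / (\<epsilon> / 2)) * (A * real n powr (\<epsilon> / 2))"
      using n e A by (intro mult_mono ln_powr_bound) auto
    also have "\<dots> = 2 / \<epsilon> * A * (real n powr (\<epsilon> / 2) * real n powr (\<epsilon> / 2))" by simp
    also have "real n powr (\<epsilon> / 2) * real n powr (\<epsilon> / 2) = real n powr \<epsilon>"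
      by (simp flip: powr_add)
    finally show "norm (- of_real (ln (real n)) * a n) \<le> 2 / \<epsilon> * A * real n powr \<epsilon>" .
  qed (use e A in auto)
qed

lemma dirichlet_summable_norm:
  assumes "subpolynomial a" "Re s > 1"
  shows "summable (\<lambda>n. norm (a (Suc n) * npow (real (Suc n)) s))"
proof -
  define \<epsilon> where "\<epsilon> = (Re s - 1) / 2"
  have e: "\<epsilon> > 0" using assms by (simp add: \<epsilon>_def)
  then obtain A where A: "A \<ge> 0" "\<And>n. n \<ge> 1 \<Longrightarrow> norm (a n) \<le> A * real n powr \<epsilon>"
    using assms unfolding subpolynomial_def by meson
  show ?thesis
  proof (rule summable_comparison_test')
    show "summable (\<lambda>n. A * real (Suc n) powr (- (1 + \<epsilon>)))"
      using e by (intro summable_mult summable_nat_powr) auto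
    fix n
    have "norm (a (Suc n) * npow (real (Suc n)) s) \<le> A * real (Suc n) powr \<epsilon> * real (Suc n) powr (- Re s)"
      using A(2)[of "Suc n"] by (simp add: norm_mult norm_npow mult_right_mono)
    also have "\<dots> = A * real (Suc n) powr (\<epsilon> - Re s)" by (simp flip: powr_add)
    also have "\<epsilon> - Re s = - (1 + \<epsilon>)" by (simp add: \<epsilon>_def field_simps)
    finally show "norm (norm (a (Suc n) * npow (real (Suc n)) s)) \<le> A * real (Suc n) powr (- (1 + \<epsilon>))" by simp
  qed
qed

lemma dirichlet_has_field_derivative:
  assumes a: "subpolynomial a" and s: "Re s > 1"
  shows "(dirichlet a has_field_derivative dirichlet (\<lambda>n. - of_real (ln (real n)) * a n) s) (at s)"
proof -
  let ?S = "{s::complex. Re s > 1}"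
  let ?f = "\<lambda>n s. a (Suc n) * npow (real (Suc n)) s"
  let ?f' = "\<lambda>n s. (- of_real (ln (real (Suc n))) * a (Suc n)) * npow (real (Suc n)) s"
  have op: "open ?S" by (rule open_halfspace_Re_gt)
  have d: "(?f n has_field_derivative ?f' n s) (at s)" for n s
    using DERIV_cmult[OF has_field_derivative_npow[of "real (Suc n)" s], of "a (Suc n)"]
    by (simp add: mult_ac)
  have "\<exists>g g'. \<forall>x\<in>?S. (\<lambda>n. ?f n x) sums g x \<and> (\<lambda>n. ?f' n x) sums g' x \<and> (g has_field_derivative g' x) (at x)"
  proof (rule series_and_derivative_comparison_local[OF op d])
    fix s assume "s \<in> ?S"
    define c where "c = (Re s - 1) / 2"
    have c: "c > 0" using \<open>s \<in> ?S\<close> by (simp add: c_def)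
    define h where "h n = norm (a (Suc n) * npow (real (Suc n)) (of_real (1 + c)))" for n
    have "summable h" unfolding h_def using c by (intro dirichlet_summable_norm a) auto
    moreover have "norm (?f n y) \<le> h n" if y: "y \<in> ball s c" for n y
    proof -
      have "norm (y - s) < c" using y by (simp add: dist_norm norm_minus_commute)
      hence "- c < Re (y - s)" using abs_Re_le_cmod[of "y - s"] by linarith
      hence "Re s - c < Re y" by simp
      hence re: "Re y \<ge> 1 + c" by (simp add: c_def field_simps)
      show ?thesis unfolding h_def norm_mult using re
        by (intro mult_left_mono) (auto simp: norm_npow intro!: powr_mono)
    qed
    ultimately show "\<exists>d h. 0 < d \<and> summable h \<and> (\<forall>\<^sub>F n in sequentially. \<forall>y\<in>ball s d \<inter> ?S. norm (?f n y) \<le> h n)"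
      using c by (intro exI[of _ c] exI[of _ h]) auto
  qed
  then obtain g g' where g: "\<And>x. Re x > 1 \<Longrightarrow> (\<lambda>n. ?f n x) sums g x"
    "\<And>x. Re x > 1 \<Longrightarrow> (\<lambda>n. ?f' n x) sums g' x" "\<And>x. Re x > 1 \<Longrightarrow> (g has_field_derivative g' x) (at x)"
    by auto
  have "(dirichlet a has_field_derivative g' s) (at s)"
  proof (rule has_field_derivative_transform_within_open[OF g(3)[OF s] op])
    show "s \<in> ?S" using s by simp
    show "g x = dirichlet a x" if "x \<in> ?S" for x
      using g(1)[of x] that by (simp add: dirichlet_def sums_iff)
  qed
  moreover have "g' s = dirichlet (\<lambda>n. - of_real (ln (real n)) * a n) s"
    using g(2)[OF s] by (simp add: dirichlet_def sums_iff)
  ultimately show ?thesis by simp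
qed

definition moebius_ln2 :: "nat \<Rightarrow> real" where
  "moebius_ln2 n = of_int (moebius n) * (ln (real n))\<^sup>2"

abbreviation "moebius_ln2_series \<equiv> dirichlet (\<lambda>n. of_real (moebius_ln2 n))"

lemma subpolynomial_moebius: "subpolynomial (\<lambda>n. of_int (moebius n))"
  unfolding subpolynomial_def
proof (intro allI impI exI[of _ 1] conjI)
  fix \<epsilon> :: real and n :: nat assume "\<epsilon> > 0" "n \<ge> 1"
  have "norm (of_int (moebius n) :: complex) \<le> 1"
    using abs_moebius_le_1[of n] by (simp add: norm_of_int)
  also have "1 \<le> 1 * real n powr \<epsilon>" using \<open>\<epsilon> > 0\<close> \<open>n \<ge> 1\<close> by (simp add: ge_one_powr_ge_zero)
  finally show "norm (of_int (moebius n) :: complex) \<le> 1 * real n powr \<epsilon>" .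
qed auto

lemma subpolynomial_moebius_ln2: "subpolynomial (\<lambda>n. of_real (moebius_ln2 n))"
  using subpolynomial_ln[OF subpolynomial_ln[OF subpolynomial_moebius]]
  by (simp add: moebius_ln2_def power2_eq_square mult_ac)

lemma deriv2_moebius_series:
  assumes "Re s > 1"
  shows "moebius_series field_differentiable (at s)"
    "deriv moebius_series field_differentiable (at s)"
    "deriv (deriv moebius_series) s = moebius_ln2_series s"
proof -
  have eq: "moebius_series = dirichlet (\<lambda>n. of_int (moebius n))"
    by (simp add: moebius_series_def dirichlet_def fun_eq_iff)
  let ?D1 = "dirichlet (\<lambda>n. - of_real (ln (real n)) * of_int (moebius n))"
  have d1: "(moebius_series has_field_derivative ?D1 s) (at s)" if "Re s > 1" for s
    unfolding eq by (rule dirichlet_has_field_derivative[OF subpolynomial_moebius that])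
  thus "moebius_series field_differentiable (at s)" using assms by (auto simp: field_differentiable_def)
  have op: "open {s::complex. Re s > 1}" by (rule open_halfspace_Re_gt)
  have d2: "(?D1 has_field_derivative moebius_ln2_series s) (at s)"
    using dirichlet_has_field_derivative[OF subpolynomial_ln[OF subpolynomial_moebius] assms]
    by (simp add: moebius_ln2_def power2_eq_square mult_ac)
  have d3: "(deriv moebius_series has_field_derivative moebius_ln2_series s) (at s)"
    by (rule has_field_derivative_transform_within_open[OF d2 op]) (use assms DERIV_imp_deriv[OF d1] in auto)
  thus "deriv moebius_series field_differentiable (at s)" "deriv (deriv moebius_series) s = moebius_ln2_series s"
    by (auto simp: field_differentiable_def DERIV_imp_deriv)
qed

text \<open>Near \<open>1\<close> the function \<open>1/\<zeta>(s) = (s - 1) / zeta_reg(s)\<close> extends holomorphically, so a compactness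
  argument bounds its second derivative.\<close>

lemma moebius_ln2_series_bound_near_1:
  obtains \<rho> C where "\<rho> > 0" "C > 0" "\<And>s. Re s > 1 \<Longrightarrow> norm (s - 1) < \<rho> \<Longrightarrow> norm (moebius_ln2_series s) \<le> C"
proof -
  let ?S = "{s::complex. Re s > 0}"
  define U where "U = {s\<in>?S. zeta_reg s \<noteq> 0}"
  have opS: "open ?S" by (rule open_halfspace_Re_gt)
  have cont: "continuous_on ?S zeta_reg" by (rule holomorphic_on_imp_continuous_on[OF zeta_reg_holomorphic])
  have "U = ?S \<inter> zeta_reg -` (- {0})" by (auto simp: U_def)
  hence opU: "open U" using continuous_on_open_vimage[OF opS] cont by (metis Int_commute open_Compl closed_singleton)
  have "1 \<in> U" by (simp add: U_def zeta_reg_1)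
  then obtain r where r: "r > 0" "cball 1 r \<subseteq> U" using opU open_contains_cball by blast
  define H where "H s = (s - 1) / zeta_reg s" for s
  have "zeta_reg holomorphic_on U" by (rule holomorphic_on_subset[OF zeta_reg_holomorphic]) (auto simp: U_def)
  hence "H holomorphic_on U" unfolding H_def by (intro holomorphic_intros) (auto simp: U_def)
  hence "deriv (deriv H) holomorphic_on U" using opU by (intro holomorphic_deriv)
  hence "continuous_on (cball 1 r) (deriv (deriv H))"
    by (rule holomorphic_on_imp_continuous_on[THEN continuous_on_subset]) (rule r)
  hence "compact (deriv (deriv H) ` cball 1 r)" by (intro compact_continuous_image) auto
  then obtain C where C: "C > 0" "\<forall>z\<in>deriv (deriv H) ` cball 1 r. norm z \<le> C"
    using compact_imp_bounded bounded_pos by metis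
  show thesis
  proof (rule that[of r C])
    fix s :: complex assume s: "Re s > 1" "norm (s - 1) < r"
    have op1: "open {s::complex. Re s > 1}" by (rule open_halfspace_Re_gt)
    have eq: "moebius_series z = H z" if "Re z > 1" for z
    proof -
      have "z \<noteq> 1" using that by auto
      moreover have "zeta_reg z \<noteq> 0" using zeta_mult_moebius_series[OF that] by (auto simp: zeta_def)
      ultimately show ?thesis
        using zeta_mult_moebius_series[OF that] by (simp add: H_def zeta_def field_simps)
    qed
    have "deriv (deriv moebius_series) s = deriv (deriv H) s"
    proof (rule deriv_cong_ev)
      have "deriv moebius_series z = deriv H z" if "Re z > 1" for z
      proof (rule deriv_cong_ev)
        show "\<forall>\<^sub>F x in nhds z. moebius_series x = H x"
          by (rule eventually_mono[OF eventually_nhds_in_open[OF op1]]) (use that eq in auto)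
      qed simp
      thus "\<forall>\<^sub>F x in nhds s. deriv moebius_series x = deriv H x"
        by (intro eventually_mono[OF eventually_nhds_in_open[OF op1]]) (use s in auto)
    qed simp
    moreover have "s \<in> cball 1 r" using s by (simp add: dist_norm norm_minus_commute)
    ultimately show "norm (moebius_ln2_series s) \<le> C"
      using C(2) deriv2_moebius_series(3)[OF s(1)] by auto
  qed (use r C in auto)
qed

section \<open>Growth of 1/zeta near the line Re s = 1\<close>

text \<open>The exponent \<open>1/14\<close> is chosen because the final bound for the second derivative of \<open>1/\<zeta>\<close> has the
  exponent \<open>14 a\<close> when \<open>\<zeta>(s) = O(|s|^a)\<close>, and it must not exceed \<open>1\<close>. The interpolated
  bounds for the terms converge for \<open>Re s \<ge> 1 - a/2 = 27/28\<close>.\<close>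

lemma zeta_norm_le:
  assumes d: "\<delta> > 0"
  obtains C where "C \<ge> 1" "\<And>s. Re s \<ge> 27 / 28 \<Longrightarrow> norm (s - 1) \<ge> \<delta> \<Longrightarrow> norm (zeta s) \<le> C * norm s powr (1/14)"
proof -
  obtain C0 where C0: "C0 > 0" "\<And>s. Re s \<ge> 1 - (1/14) / 2 \<Longrightarrow> norm (zeta_reg s) \<le> 1 + C0 * norm (s - 1) * norm s powr (1/14)"
    by (rule norm_zeta_reg_le[of "1/14"]) auto
  show thesis
  proof (rule that[of "1 + 2 / \<delta> + C0"])
    fix s :: complex assume s: "Re s \<ge> 27 / 28" "norm (s - 1) \<ge> \<delta>"
    have ns: "norm s \<ge> 27 / 28" using s abs_Re_le_cmod[of s] by linarith
    have "(1/2) powr (1/14) \<le> norm s powr (1/14)" using ns by (intro powr_mono2) auto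
    moreover have "(1/2 :: real) powr 1 \<le> (1/2) powr (1/14)" by (intro powr_mono') auto
    ultimately have p: "1 \<le> 2 * norm s powr (1/14)" by simp
    have n0: "norm (s - 1) > 0" using s d by linarith
    have "norm (zeta s) = norm (zeta_reg s) / norm (s - 1)" by (simp add: zeta_def norm_divide)
    also have "\<dots> \<le> (1 + C0 * norm (s - 1) * norm s powr (1/14)) / norm (s - 1)"
      using C0(2)[of s] s by (intro divide_right_mono) auto
    also have "\<dots> = 1 / norm (s - 1) + C0 * norm s powr (1/14)" using n0 by (simp add: add_divide_distrib)
    also have "1 / norm (s - 1) \<le> 1 / \<delta>" using s d n0 by (intro divide_left_mono) auto
    also have "1 / \<delta> \<le> (1 / \<delta>) * (2 * norm s powr (1/14))" using p d mult_left_mono[OF p, of "1/\<delta>"] by simp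
    also have "\<dots> + C0 * norm s powr (1/14) \<le> (1 + 2 / \<delta> + C0) * norm s powr (1/14)"
      by (simp add: ring_distribs)
    finally show "norm (zeta s) \<le> (1 + 2 / \<delta> + C0) * norm s powr (1/14)" by simp
  qed (use d C0 in auto)
qed

lemma zeta_holomorphic: "zeta holomorphic_on ({s. Re s > 0} - {1})"
  unfolding zeta_def
  by (intro holomorphic_intros holomorphic_on_subset[OF zeta_reg_holomorphic]) auto

text \<open>Cauchy's inequality on a disc of fixed radius, which stays inside \<open>Re s \<ge> 27/28\<close> and away from \<open>1\<close>.\<close>

lemma zeta_derivs_le:
  assumes d: "\<delta> > 0"
  obtains C where "C \<ge> 1" "\<And>s. Re s \<ge> 1 \<Longrightarrow> \<bar>Im s\<bar> \<ge> \<delta> \<Longrightarrow> norm (deriv zeta s) \<le> C * norm s powr (1/14)"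
    "\<And>s. Re s \<ge> 1 \<Longrightarrow> \<bar>Im s\<bar> \<ge> \<delta> \<Longrightarrow> norm (deriv (deriv zeta) s) \<le> C * norm s powr (1/14)"
proof -
  define r where "r = min (\<delta> / 2) (1 / 28)"
  have r: "r > 0" "r \<le> \<delta> / 2" "r \<le> 1 / 28" using d by (auto simp: r_def)
  obtain C1 where C1: "C1 \<ge> 1" "\<And>s. Re s \<ge> 27 / 28 \<Longrightarrow> norm (s - 1) \<ge> \<delta> / 2 \<Longrightarrow> norm (zeta s) \<le> C1 * norm s powr (1/14)"
    using zeta_norm_le[of "\<delta> / 2"] d by (metis half_gt_zero)
  have bd: "norm ((deriv ^^ n) zeta s) \<le> fact n * (2 * C1 * norm s powr (1/14)) / r ^ n"
    if s: "Re s \<ge> 1" "\<bar>Im s\<bar> \<ge> \<delta>" for s n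
  proof (rule Cauchy_inequality)
    have in_ball: "Re y \<ge> 27 / 28" "norm (y - 1) \<ge> \<delta> / 2" "norm y \<le> 2 * norm s" if "norm (s - y) \<le> r" for y
    proof -
      have "Re (s - y) \<le> r" using that abs_Re_le_cmod[of "s - y"] by linarith
      thus "Re y \<ge> 27 / 28" using s r by simp
      have "\<bar>Im (s - y)\<bar> \<le> r" using that abs_Im_le_cmod[of "s - y"] by linarith
      hence "\<bar>Im s - Im y\<bar> \<le> r" by simp
      hence "\<bar>Im y\<bar> \<ge> \<delta> / 2" using s r by linarith
      thus "norm (y - 1) \<ge> \<delta> / 2" using abs_Im_le_cmod[of "y - 1"] by simp
      have "norm y \<le> norm s + norm (s - y)" by (metis norm_triangle_sub norm_minus_commute)
      moreover have "norm s \<ge> 1" using s abs_Re_le_cmod[of s] by linarith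
      ultimately show "norm y \<le> 2 * norm s" using that r by linarith
    qed
    have sub: "cball s r \<subseteq> {s. Re s > 0} - {1}"
      using in_ball d by (fastforce simp: dist_norm)
    have hol: "zeta holomorphic_on cball s r" by (rule holomorphic_on_subset[OF zeta_holomorphic sub])
    show "zeta holomorphic_on ball s r" by (rule holomorphic_on_subset[OF hol]) auto
    show "continuous_on (cball s r) zeta" by (rule holomorphic_on_imp_continuous_on[OF hol])
    fix y assume y: "norm (s - y) = r"
    have "norm (zeta y) \<le> C1 * norm y powr (1/14)" using in_ball[of y] y by (intro C1) auto
    also have "\<dots> \<le> C1 * (2 * norm s) powr (1/14)"
      using in_ball[of y] y C1 by (intro mult_left_mono powr_mono2) auto
    also have "\<dots> = C1 * (2 powr (1/14) * norm s powr (1/14))" by (simp add: powr_mult)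
    also have "\<dots> \<le> C1 * (2 powr 1 * norm s powr (1/14))"
      using C1 by (intro mult_left_mono mult_right_mono powr_mono) auto
    finally show "norm (zeta y) \<le> 2 * C1 * norm s powr (1/14)" by simp
  qed (rule r)
  have r1: "r ^ 2 \<le> r" "r \<le> 1" using r by (auto simp: power2_eq_square mult_le_cancel_right1)
  show thesis
  proof (rule that[of "4 * C1 / r ^ 2"])
    have "1 \<le> 4 * C1" "r ^ 2 \<le> 1" using C1 r1 by auto
    thus "4 * C1 / r ^ 2 \<ge> 1" using r by (simp add: le_divide_eq)
    fix s assume s: "Re s \<ge> 1" "\<bar>Im s\<bar> \<ge> \<delta>"
    have "norm (deriv zeta s) \<le> 2 * C1 * norm s powr (1/14) / r" using bd[OF s, of 1] by simp
    also have "\<dots> \<le> 4 * C1 * norm s powr (1/14) / r ^ 2"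
      using C1 r r1 by (intro frac_le mult_right_mono mult_nonneg_nonneg) auto
    finally show "norm (deriv zeta s) \<le> 4 * C1 / r ^ 2 * norm s powr (1/14)" by simp
    have "norm (deriv (deriv zeta) s) \<le> 4 * C1 * norm s powr (1/14) / r ^ 2"
      using bd[OF s, of 2] by (simp add: numeral_2_eq_2)
    thus "norm (deriv (deriv zeta) s) \<le> 4 * C1 / r ^ 2 * norm s powr (1/14)" by simp
  qed
qed

text \<open>Solve the inequality with exponents 3, 4, 1 for its middle factor, with \<open>\<zeta>(\<sigma>) = O(1/(\<sigma> - 1))\<close>. The
  point \<open>s\<close> measures the height \<open>t\<close>; keeping it fixed while \<open>\<sigma>\<close> varies allows two points at the
  same height to be compared later.\<close>

lemma zeta_pow4_lower_bound:
  assumes d: "\<delta> > 0"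
  obtains c where "0 < c" "c \<le> 1" "\<And>\<sigma> t s. 1 < \<sigma> \<Longrightarrow> \<sigma> \<le> 2 \<Longrightarrow> \<bar>t\<bar> \<ge> \<delta> \<Longrightarrow> Re s > 1 \<Longrightarrow> Im s = t \<Longrightarrow>
      c * (\<sigma> - 1) ^ 3 * norm s powr (- (1/14)) \<le> norm (zeta (Complex \<sigma> t)) ^ 4"
proof -
  obtain C0 where C0: "C0 > 0" "\<And>s. Re s \<ge> 1 - (1/14) / 2 \<Longrightarrow> norm (zeta_reg s) \<le> 1 + C0 * norm (s - 1) * norm s powr (1/14)"
    by (rule norm_zeta_reg_le[of "1/14"]) auto
  obtain C1 where C1: "C1 \<ge> 1" "\<And>s. Re s \<ge> 27 / 28 \<Longrightarrow> norm (s - 1) \<ge> \<delta> \<Longrightarrow> norm (zeta s) \<le> C1 * norm s powr (1/14)"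
    using zeta_norm_le[OF d] by metis
  define K where "K = 1 + 2 * C0"
  have K: "K \<ge> 1" using C0 by (simp add: K_def)
  show thesis
  proof (rule that[of "1 / (K ^ 3 * (4 * C1))"])
    have "1 \<le> K ^ 3" using K by simp
    hence "1 * 1 \<le> K ^ 3 * (4 * C1)" using C1(1) K by (intro mult_mono) auto
    hence ge1: "K ^ 3 * (4 * C1) \<ge> 1" by simp
    hence "K ^ 3 * (4 * C1) > 0" by linarith
    thus "0 < 1 / (K ^ 3 * (4 * C1))" "1 / (K ^ 3 * (4 * C1)) \<le> 1"
      using ge1 by (simp only: zero_less_divide_1_iff, simp only: divide_le_eq_1_pos)
    fix \<sigma> t :: real and s :: complex
    assume h: "1 < \<sigma>" "\<sigma> \<le> 2" "\<bar>t\<bar> \<ge> \<delta>" "Re s > 1" "Im s = t"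
    have ns: "norm s \<ge> 1" "norm s \<ge> \<bar>t\<bar>"
      using h abs_Re_le_cmod[of s] abs_Im_le_cmod[of s] by linarith+
    have inv: "norm (moebius_series z) = 1 / norm (zeta z)" "norm (zeta z) > 0" if "Re z > 1" for z
    proof -
      have "norm (zeta z) * norm (moebius_series z) = 1"
        using zeta_mult_moebius_series[OF that] by (metis norm_mult norm_one)
      moreover from this have "norm (zeta z) \<noteq> 0" by auto
      ultimately show "norm (moebius_series z) = 1 / norm (zeta z)" "norm (zeta z) > 0"
        by (auto simp: field_simps)
    qed
    let ?a = "norm (zeta (of_real \<sigma>))" and ?b = "norm (zeta (Complex \<sigma> t))" and ?c = "norm (zeta (Complex \<sigma> (2 * t)))"
    have pos: "?a > 0" "?b > 0" "?c > 0" using inv(2) h by auto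
    have "(1 / ?a) ^ 3 * (1 / ?b) ^ 4 * (1 / ?c) \<le> 1"
      using moebius_series_3_4_1[OF h(1), of t] h by (simp add: inv)
    hence "1 \<le> ?a ^ 3 * ?b ^ 4 * ?c" using pos by (simp add: field_simps)
    also have "\<dots> \<le> (K / (\<sigma> - 1)) ^ 3 * ?b ^ 4 * (4 * C1 * norm s powr (1/14))"
    proof (intro mult_mono power_mono)
      have "norm (zeta_reg (of_real \<sigma>)) \<le> 1 + C0 * norm (of_real \<sigma> - 1 :: complex) * norm (of_real \<sigma> :: complex) powr (1/14)"
        by (rule C0) (use h in auto)
      also have "norm (of_real \<sigma> - 1 :: complex) = \<sigma> - 1"
        using h norm_of_real[of "\<sigma> - 1", where ?'a = complex] by simp
      also have "norm (of_real \<sigma> :: complex) = \<sigma>" using h by simp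
      also have "1 + C0 * (\<sigma> - 1) * \<sigma> powr (1/14) \<le> 1 + C0 * 1 * 2"
      proof (intro add_left_mono mult_mono)
        have "\<sigma> powr (1/14) \<le> \<sigma> powr 1" using h by (intro powr_mono) auto
        thus "\<sigma> powr (1/14) \<le> 2" using h by simp
      qed (use C0 h in auto)
      finally have "norm (zeta_reg (of_real \<sigma>)) \<le> K" by (simp add: K_def)
      moreover have "norm (of_real \<sigma> - 1 :: complex) = \<sigma> - 1"
        using h norm_of_real[of "\<sigma> - 1", where ?'a = complex] by simp
      ultimately show "?a \<le> K / (\<sigma> - 1)" using h by (simp add: zeta_def norm_divide divide_right_mono)
      have "norm (Complex \<sigma> (2 * t)) \<le> \<bar>\<sigma>\<bar> + \<bar>2 * t\<bar>" using cmod_le[of "Complex \<sigma> (2 * t)"] by simp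
      also have "\<dots> \<le> 4 * norm s" using h ns by linarith
      finally have n4: "norm (Complex \<sigma> (2 * t)) \<le> 4 * norm s" .
      have "?c \<le> C1 * norm (Complex \<sigma> (2 * t)) powr (1/14)"
        using h abs_Im_le_cmod[of "Complex \<sigma> (2 * t) - 1"] by (intro C1) auto
      also have "\<dots> \<le> C1 * (4 * norm s) powr (1/14)"
        using n4 C1 by (intro mult_left_mono powr_mono2) auto
      also have "\<dots> = C1 * (4 powr (1/14) * norm s powr (1/14))" by (simp add: powr_mult)
      also have "\<dots> \<le> C1 * (4 powr 1 * norm s powr (1/14))"
        using C1 by (intro mult_left_mono mult_right_mono powr_mono) auto
      finally show "?c \<le> 4 * C1 * norm s powr (1/14)" by simp
    qed (use h K in auto)
    also have "\<dots> = (K ^ 3 * (4 * C1)) / ((\<sigma> - 1) ^ 3 * norm s powr (- (1/14))) * ?b ^ 4"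
      using ns by (simp add: power_divide powr_minus field_simps)
    finally have "1 \<le> (K ^ 3 * (4 * C1)) / ((\<sigma> - 1) ^ 3 * norm s powr (- (1/14))) * ?b ^ 4" .
    moreover have "norm s > 0" using ns by linarith
    hence "(\<sigma> - 1) ^ 3 * norm s powr (- (1/14)) > 0"
      using h by (intro mult_pos_pos zero_less_power) auto
    moreover have "K ^ 3 * (4 * C1) > 0" using K C1 by auto
    ultimately show "1 / (K ^ 3 * (4 * C1)) * (\<sigma> - 1) ^ 3 * norm s powr (- (1/14)) \<le> ?b ^ 4"
      by (simp add: field_simps)
  qed
qed

text \<open>The bound for \<open>\<zeta>^4\<close> degenerates as \<open>\<sigma>\<close> tends to \<open>1\<close>, so it is used only at distance at least \<open>\<theta>\<close> from the
  line, and \<open>\<zeta>\<close> is then followed back towards the line by means of the bound for its derivative. With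
  \<open>\<theta>\<close> proportional to \<open>|s|^(-5a)\<close> the value at distance \<open>\<theta>\<close>, of order \<open>|s|^(-4a)\<close>, is at least
  twice as large as the possible change.\<close>

lemma zeta_lower_bound:
  assumes d: "\<delta> > 0"
  obtains c where "0 < c" "\<And>s. 1 < Re s \<Longrightarrow> Re s \<le> 2 \<Longrightarrow> \<bar>Im s\<bar> \<ge> \<delta> \<Longrightarrow> c * norm s powr (- (4/14)) \<le> norm (zeta s)"
proof -
  obtain c0 where c0: "0 < c0" "c0 \<le> 1" "\<And>\<sigma> t s. 1 < \<sigma> \<Longrightarrow> \<sigma> \<le> 2 \<Longrightarrow> \<bar>t\<bar> \<ge> \<delta> \<Longrightarrow> Re s > 1 \<Longrightarrow> Im s = t \<Longrightarrow>
      c0 * (\<sigma> - 1) ^ 3 * norm s powr (- (1/14)) \<le> norm (zeta (Complex \<sigma> t)) ^ 4"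
    using zeta_pow4_lower_bound[OF d] by metis
  obtain D0 where D0: "D0 \<ge> 1" "\<And>s. Re s \<ge> 1 \<Longrightarrow> \<bar>Im s\<bar> \<ge> \<delta> \<Longrightarrow> norm (deriv zeta s) \<le> D0 * norm s powr (1/14)"
    using zeta_derivs_le[OF d] by metis
  define D where "D = 3 * D0"
  have D: "D \<ge> 1" using D0 by (simp add: D_def)
  \<comment> \<open>this choice makes the lower bound at distance \<open>\<theta>\<close> equal to \<open>2 D \<kappa> |s|^(-4/14)\<close>\<close>
  define \<kappa> where "\<kappa> = c0 / (2 * D) ^ 4"
  have D4: "(2 * D) ^ 4 \<ge> 1" using D by (intro one_le_power) simp
  have "(2 * D) ^ 4 > 0" using D4 by linarith
  hence k: "0 < \<kappa>" "\<kappa> \<le> 1"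
    unfolding \<kappa>_def using c0 D4 by (simp only: divide_pos_pos, simp only: divide_le_eq_1_pos)
  have ck: "c0 * \<kappa> ^ 3 = (2 * D * \<kappa>) ^ 4"
    using D by (simp add: \<kappa>_def field_simps eval_nat_numeral)
  show thesis
  proof (rule that[of "D * \<kappa>"])
    show "0 < D * \<kappa>" using D k by simp
    fix s assume s: "1 < Re s" "Re s \<le> 2" "\<bar>Im s\<bar> \<ge> \<delta>"
    define R where "R = norm s"
    have R: "R \<ge> 1" using s abs_Re_le_cmod[of s] unfolding R_def by linarith
    define \<theta> where "\<theta> = \<kappa> * R powr (- (5/14))"
    have "R powr (- (5/14)) \<le> R powr 0" using R by (intro powr_mono) auto
    hence Rle: "R powr (- (5/14)) \<le> 1" using R by simp
    have th: "0 < \<theta>" "\<theta> \<le> 1" using k R Rle mult_mono[OF k(2) Rle] by (auto simp: \<theta>_def)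
    have lower: "2 * (D * \<kappa> * R powr (- (4/14))) \<le> norm (zeta (Complex \<sigma> (Im s)))" if "1 + \<theta> \<le> \<sigma>" "\<sigma> \<le> 2" for \<sigma>
    proof -
      have "(2 * (D * \<kappa> * R powr (- (4/14)))) ^ 4 = c0 * \<kappa> ^ 3 * (R powr (- (4/14))) ^ 4"
        unfolding ck by (simp add: power_mult_distrib)
      also have "(R powr (- (4/14))) ^ 4 = R powr (- (16/14))" using R by (simp add: powr_power)
      also have "\<dots> = (R powr (- (5/14))) ^ 3 * R powr (- (1/14))" using R by (simp add: powr_power flip: powr_add)
      also have "c0 * \<kappa> ^ 3 * \<dots> = c0 * \<theta> ^ 3 * R powr (- (1/14))" by (simp add: \<theta>_def power_mult_distrib)
      also have "\<dots> \<le> c0 * (\<sigma> - 1) ^ 3 * R powr (- (1/14))"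
        using that th c0 by (intro mult_right_mono mult_left_mono power_mono) auto
      also have "\<dots> \<le> norm (zeta (Complex \<sigma> (Im s))) ^ 4"
        unfolding R_def by (rule c0) (use that th s in auto)
      finally show ?thesis using D k by (subst (asm) power_mono_iff) auto
    qed
    have "D * \<kappa> * R powr (- (4/14)) \<le> norm (zeta s)"
    proof (cases "Re s \<ge> 1 + \<theta>")
      case True
      have "2 * (D * \<kappa> * R powr (- (4/14))) \<le> norm (zeta s)" using lower[OF True s(2)] by simp
      moreover have "D * \<kappa> * R powr (- (4/14)) \<ge> 0" using D k by simp
      ultimately show ?thesis by linarith
    next
      case False
      define s1 where "s1 = Complex (1 + \<theta>) (Im s)"
      have l1: "2 * (D * \<kappa> * R powr (- (4/14))) \<le> norm (zeta s1)"
        unfolding s1_def by (rule lower) (use th in auto)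
      let ?L = "closed_segment s s1"
      have seg: "Re z \<ge> 1" "Re z \<le> 2" "Im z = Im s" if "z \<in> ?L" for z
      proof -
        from that obtain u where u: "0 \<le> u" "u \<le> 1" "z = (1 - u) *\<^sub>R s + u *\<^sub>R s1" by (auto simp: in_segment)
        have "Im z = (1 - u) * Im s + u * Im s" using u by (simp add: s1_def)
        thus "Im z = Im s" by (simp add: algebra_simps)
        have "Re z = (1 - u) * Re s + u * (1 + \<theta>)" using u by (simp add: s1_def)
        moreover have "(1 - u) * Re s + u * (1 + \<theta>) \<ge> (1 - u) * 1 + u * 1"
          using u s th by (intro add_mono mult_left_mono) auto
        moreover have "(1 - u) * Re s + u * (1 + \<theta>) \<le> (1 - u) * 2 + u * 2"
          using u s th by (intro add_mono mult_left_mono) auto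
        ultimately show "Re z \<ge> 1" "Re z \<le> 2" by auto
      qed
      have "norm (zeta s1 - zeta s) \<le> D * R powr (1/14) * norm (s1 - s)"
      proof (rule field_differentiable_bound[where S = ?L and f' = "deriv zeta"])
        fix z assume z: "z \<in> ?L"
        have "z \<in> {s. Re s > 0} - {1}" using seg[OF z] s d by auto
        moreover have "open ({s. Re s > 0} - {1::complex})" by (intro open_Diff open_halfspace_Re_gt) auto
        ultimately have "(zeta has_field_derivative deriv zeta z) (at z)"
          using holomorphic_derivI[OF zeta_holomorphic] by blast
        thus "(zeta has_field_derivative deriv zeta z) (at z within ?L)" by (rule has_field_derivative_at_within)
        have "norm z \<le> \<bar>Re z\<bar> + \<bar>Im z\<bar>" by (rule cmod_le)
        also have "\<dots> \<le> 3 * R" using seg[OF z] R abs_Im_le_cmod[of s] unfolding R_def by linarith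
        finally have n3: "norm z \<le> 3 * R" .
        have "norm (deriv zeta z) \<le> D0 * norm z powr (1/14)" by (rule D0) (use seg[OF z] s in auto)
        also have "\<dots> \<le> D0 * (3 * R) powr (1/14)"
          using n3 D0 by (intro mult_left_mono powr_mono2) auto
        also have "\<dots> = D0 * (3 powr (1/14) * R powr (1/14))" using R by (simp add: powr_mult)
        also have "\<dots> \<le> D0 * (3 powr 1 * R powr (1/14))"
          using D0 by (intro mult_left_mono mult_right_mono powr_mono) auto
        finally show "norm (deriv zeta z) \<le> D * R powr (1/14)" by (simp add: D_def)
      qed auto
      also have "norm (s1 - s) \<le> \<theta>"
      proof -
        have "s1 - s = of_real (1 + \<theta> - Re s)" by (simp add: s1_def complex_eq_iff)
        hence "norm (s1 - s) = \<bar>1 + \<theta> - Re s\<bar>" by (metis norm_of_real)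
        thus ?thesis using False s by simp
      qed
      also have "D * R powr (1/14) * \<theta> = D * \<kappa> * (R powr (1/14) * R powr (- (5/14)))" by (simp add: \<theta>_def)
      also have "R powr (1/14) * R powr (- (5/14)) = R powr (- (4/14))" by (simp flip: powr_add)
      finally have "norm (zeta s1 - zeta s) \<le> D * \<kappa> * R powr (- (4/14))" using D by (simp add: mult_left_mono)
      moreover have "norm (zeta s1) \<le> norm (zeta s) + norm (zeta s1 - zeta s)" by (metis norm_triangle_sub add.commute)
      ultimately show ?thesis using l1 by linarith
    qed
    thus "D * \<kappa> * norm s powr (- (4/14)) \<le> norm (zeta s)" by (simp add: R_def)
  qed
qed

lemma moebius_ln2_series_eq:
  assumes s: "Re s > 1"
  shows "moebius_ln2_series s = 2 * (deriv zeta s)\<^sup>2 * (moebius_series s) ^ 3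
           - deriv (deriv zeta) s * (moebius_series s)\<^sup>2"
proof -
  let ?S = "{s::complex. Re s > 1}" and ?T = "{s::complex. Re s > 0} - {1}"
  let ?F = moebius_series
  have op: "open ?S" by (rule open_halfspace_Re_gt)
  have opT: "open ?T" by (intro open_Diff open_halfspace_Re_gt) auto
  have ST: "z \<in> ?T" if "Re z > 1" for z using that by auto
  have z1: "(zeta has_field_derivative deriv zeta z) (at z)" if "Re z > 1" for z
    using holomorphic_derivI[OF zeta_holomorphic opT ST[OF that]] .
  have z2: "(deriv zeta has_field_derivative deriv (deriv zeta) z) (at z)" if "Re z > 1" for z
    using holomorphic_derivI[OF holomorphic_deriv[OF zeta_holomorphic opT] opT ST[OF that]] .
  have F: "?F z = inverse (zeta z)" "zeta z \<noteq> 0" if "Re z > 1" for z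
  proof -
    show "zeta z \<noteq> 0" using zeta_mult_moebius_series[OF that] by auto
    thus "?F z = inverse (zeta z)" using zeta_mult_moebius_series[OF that] by (simp add: field_simps)
  qed
  have F1: "(?F has_field_derivative - (deriv zeta z * (?F z)\<^sup>2)) (at z)" if "Re z > 1" for z
  proof (rule has_field_derivative_transform_within_open[OF _ op])
    show "((\<lambda>z. inverse (zeta z)) has_field_derivative - (deriv zeta z * (?F z)\<^sup>2)) (at z)"
      using DERIV_inverse'[OF z1[OF that] F(2)[OF that]] F(1)[OF that]
      by (simp add: power2_eq_square mult_ac)
  qed (use that F in auto)
  have "((\<lambda>z. - (deriv zeta z * (?F z)\<^sup>2)) has_field_derivative
         (2 * (deriv zeta s)\<^sup>2 * ?F s ^ 3 - deriv (deriv zeta) s * (?F s)\<^sup>2)) (at s)"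
    by (rule derivative_eq_intros z2 F1 s refl)+
       (simp add: power2_eq_square power3_eq_cube algebra_simps)
  hence "(deriv ?F has_field_derivative
         (2 * (deriv zeta s)\<^sup>2 * ?F s ^ 3 - deriv (deriv zeta) s * (?F s)\<^sup>2)) (at s)"
    by (rule has_field_derivative_transform_within_open[OF _ op]) (use s DERIV_imp_deriv[OF F1] in auto)
  thus ?thesis using deriv2_moebius_series(3)[OF s] by (simp add: DERIV_imp_deriv)
qed

text \<open>Away from the real axis \<open>2 \<zeta>'^2 / \<zeta>^3 - \<zeta>'' / \<zeta>^2\<close> is \<open>O(|s|^(2a + 12a)) = O(|s|)\<close>; close to it, points
  with \<open>1 < Re s < 1 + \<delta>\<close> lie in the disc about \<open>1\<close> already dealt with.\<close>

lemma moebius_ln2_series_bound: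
  obtains \<delta> C where "\<delta> > 0" "C > 0"
    "\<And>s. Re s > 1 \<Longrightarrow> Re s < 1 + \<delta> \<Longrightarrow> norm (moebius_ln2_series s) \<le> C * norm s"
proof -
  obtain \<rho> C0 where C0: "\<rho> > 0" "C0 > 0" "\<And>s. Re s > 1 \<Longrightarrow> norm (s - 1) < \<rho> \<Longrightarrow> norm (moebius_ln2_series s) \<le> C0"
    using moebius_ln2_series_bound_near_1 by metis
  define \<delta> where "\<delta> = min (\<rho> / 2) 1"
  have d: "\<delta> > 0" "\<delta> \<le> \<rho> / 2" "\<delta> \<le> 1" using C0 by (auto simp: \<delta>_def)
  obtain C1 where C1: "C1 \<ge> 1" "\<And>s. Re s \<ge> 1 \<Longrightarrow> \<bar>Im s\<bar> \<ge> \<delta> \<Longrightarrow> norm (deriv zeta s) \<le> C1 * norm s powr (1/14)"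
    "\<And>s. Re s \<ge> 1 \<Longrightarrow> \<bar>Im s\<bar> \<ge> \<delta> \<Longrightarrow> norm (deriv (deriv zeta) s) \<le> C1 * norm s powr (1/14)"
    using zeta_derivs_le[OF d(1)] by metis
  obtain c where c: "0 < c" "\<And>s. 1 < Re s \<Longrightarrow> Re s \<le> 2 \<Longrightarrow> \<bar>Im s\<bar> \<ge> \<delta> \<Longrightarrow> c * norm s powr (- (4/14)) \<le> norm (zeta s)"
    using zeta_lower_bound[OF d(1)] by metis
  define C where "C = max C0 (2 * C1\<^sup>2 * (1 / c) ^ 3 + C1 * (1 / c)\<^sup>2)"
  show thesis
  proof (rule that[of \<delta> C])
    fix s :: complex assume s: "Re s > 1" "Re s < 1 + \<delta>"
    have R: "norm s \<ge> 1" using s abs_Re_le_cmod[of s] by linarith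
    show "norm (moebius_ln2_series s) \<le> C * norm s"
    proof (cases "\<bar>Im s\<bar> < \<delta>")
      case True
      have "norm (s - 1) \<le> \<bar>Re (s - 1)\<bar> + \<bar>Im (s - 1)\<bar>" by (rule cmod_le)
      also have "\<dots> = \<bar>Re s - 1\<bar> + \<bar>Im s\<bar>" by simp
      also have "\<dots> < \<rho>" using True s d by linarith
      finally have "norm (moebius_ln2_series s) \<le> C0" using C0 s by auto
      also have "\<dots> \<le> C * 1" by (simp add: C_def)
      also have "\<dots> \<le> C * norm s" using R C0 by (intro mult_left_mono) (auto simp: C_def)
      finally show ?thesis .
    next
      case False
      define R where "R = norm s"
      have R1: "R \<ge> 1" using R by (simp add: R_def)
      let ?F = "moebius_series s"
      have Fl: "norm ?F \<le> (1 / c) * R powr (4/14)"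
      proof -
        have z: "c * R powr (- (4/14)) \<le> norm (zeta s)" unfolding R_def by (rule c) (use s d False in auto)
        have "norm (zeta s) * norm ?F = 1"
          using zeta_mult_moebius_series[OF s(1)] by (metis norm_mult norm_one)
        hence "c * R powr (- (4/14)) * norm ?F \<le> 1"
          using mult_right_mono[OF z, of "norm ?F"] by simp
        thus ?thesis using c(1) R1 by (simp add: powr_minus field_simps)
      qed
      have "norm (moebius_ln2_series s) \<le> norm (2 * (deriv zeta s)\<^sup>2 * ?F ^ 3) + norm (deriv (deriv zeta) s * ?F\<^sup>2)"
        unfolding moebius_ln2_series_eq[OF s(1)] by (rule norm_triangle_ineq4)
      also have "\<dots> = 2 * (norm (deriv zeta s))\<^sup>2 * norm ?F ^ 3 + norm (deriv (deriv zeta) s) * (norm ?F)\<^sup>2"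
        by (simp add: norm_mult norm_power)
      also have "\<dots> \<le> 2 * (C1 * R powr (1/14))\<^sup>2 * ((1 / c) * R powr (4/14)) ^ 3
                    + (C1 * R powr (1/14)) * ((1 / c) * R powr (4/14))\<^sup>2"
        unfolding R_def using Fl[unfolded R_def] C1 s False
        by (intro add_mono mult_mono power_mono order_refl) auto
      also have "\<dots> = 2 * C1\<^sup>2 * (1 / c) ^ 3 * ((R powr (1/14))\<^sup>2 * (R powr (4/14)) ^ 3)
                    + C1 * (1 / c)\<^sup>2 * (R powr (1/14) * (R powr (4/14))\<^sup>2)"
        by (simp add: power_mult_distrib power_divide)
      also have "(R powr (1/14))\<^sup>2 * (R powr (4/14)) ^ 3 = R"
        using R1 by (simp add: powr_power flip: powr_add)
      also have "R powr (1/14) * (R powr (4/14))\<^sup>2 = R powr (9/14)"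
        using R1 by (simp add: powr_power flip: powr_add)
      also have "2 * C1\<^sup>2 * (1 / c) ^ 3 * R + C1 * (1 / c)\<^sup>2 * R powr (9/14)
              \<le> 2 * C1\<^sup>2 * (1 / c) ^ 3 * R + C1 * (1 / c)\<^sup>2 * R powr 1"
        using R1 C1 by (intro add_left_mono mult_left_mono powr_mono) auto
      also have "\<dots> = (2 * C1\<^sup>2 * (1 / c) ^ 3 + C1 * (1 / c)\<^sup>2) * R"
        using R1 by (simp add: ring_distribs)
      also have "\<dots> \<le> C * R" using R1 by (intro mult_right_mono) (auto simp: C_def)
      finally show ?thesis by (simp add: R_def)
    qed
  qed (use d C0 in \<open>auto simp: C_def\<close>)
qed

section \<open>Gaussian averaging and the bound for the sum of the Moebius function\<close>

lemma integrable_indicator_exp: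
  assumes "a > 0"
  shows "integrable lborel (\<lambda>v. indicator {c..} v * exp (- a * v) :: real)"
    and "(\<integral>v. indicator {c..} v * exp (- a * v) \<partial>lborel) = exp (- a * c) / a"
proof -
  have hi: "((\<lambda>v. exp (- a * v)) has_integral exp (- a * c) / a) {c..}"
    by (rule has_integral_exp_minus_to_infinity[OF assms])
  hence "(\<lambda>v. exp (- a * v)) absolutely_integrable_on {c..}"
    by (intro nonnegative_absolutely_integrable_1) auto
  hence "integrable lebesgue (\<lambda>v. indicator {c..} v * exp (- a * v))"
    by (simp add: set_integrable_def)
  thus *: "integrable lborel (\<lambda>v. indicator {c..} v * exp (- a * v))"
    by (subst (asm) integrable_completion) auto
  hence "set_integrable lborel {c..} (\<lambda>v. exp (- a * v))" by (simp add: set_integrable_def)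
  from set_borel_integral_eq_integral(2)[OF this] hi
  show "(\<integral>v. indicator {c..} v * exp (- a * v) \<partial>lborel) = exp (- a * c) / a"
    by (simp add: set_lebesgue_integral_def integral_unique)
qed

lemma integral_indicator_cexp:
  fixes s :: complex
  assumes s: "Re s > 0"
  shows "integrable lborel (\<lambda>v. indicator {c..} v *\<^sub>R exp (- (s * of_real v)))"
    and "(\<integral>v. norm (indicator {c..} v *\<^sub>R exp (- (s * of_real v))) \<partial>lborel) = exp (- (Re s * c)) / Re s"
    and "(\<integral>v. indicator {c..} v *\<^sub>R exp (- (s * of_real v)) \<partial>lborel) = exp (- (s * of_real c)) / s"
proof -
  have nrm: "norm (indicator {c..} v *\<^sub>R exp (- (s * of_real v))) = indicator {c..} v * exp (- Re s * v)" for v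
    by (simp add: indicator_def)
  show int: "integrable lborel (\<lambda>v. indicator {c..} v *\<^sub>R exp (- (s * of_real v)))"
  proof (rule Bochner_Integration.integrable_bound[OF integrable_indicator_exp(1)[OF s, of c]])
    show "(\<lambda>v. indicator {c..} v *\<^sub>R exp (- (s * of_real v))) \<in> borel_measurable lborel"
      by measurable
    show "AE v in lborel. norm (indicator {c..} v *\<^sub>R exp (- (s * of_real v))) \<le> norm (indicator {c..} v * exp (- Re s * v))"
      by (intro AE_I2) (simp only: nrm, simp)
  qed
  show "(\<integral>v. norm (indicator {c..} v *\<^sub>R exp (- (s * of_real v))) \<partial>lborel) = exp (- (Re s * c)) / Re s"
    unfolding nrm using integrable_indicator_exp(2)[OF s, of c] by simp
  let ?f = "\<lambda>v. exp (- (s * of_real v)) :: complex"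
  let ?F = "\<lambda>v. - (exp (- (s * of_real v)) / s) :: complex"
  have s0: "s \<noteq> 0" using s by auto
  have "(LBINT v=ereal c..\<infinity>. ?f v) = 0 - ?F c"
  proof (rule interval_integral_FTC_integrable)
    have vd: "(?F has_vector_derivative ?f v) (at v)" for v
    proof -
      have "((\<lambda>z. - (exp (- (s * z)) / s)) has_field_derivative exp (- (s * of_real v))) (at (of_real v))"
        using s0 by (auto intro!: derivative_eq_intros)
      thus ?thesis by (rule has_vector_derivative_real_field)
    qed
    show "(?F has_vector_derivative ?f v) (at v)" for v by (rule vd)
    show "isCont ?f v" for v by (intro continuous_intros)
    have "set_integrable lborel {c..} ?f" using int by (simp add: set_integrable_def)
    thus "set_integrable lborel (einterval (ereal c) \<infinity>) ?f"
      by (rule set_integrable_subset) (auto simp: einterval_def)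
    show "((?F \<circ> real_of_ereal) \<longlongrightarrow> ?F c) (at_right (ereal c))"
    proof (subst ereal_tendsto_simps(2))
      show "(?F \<longlongrightarrow> ?F c) (at_right c)"
        using s0 by (auto intro!: tendsto_eq_intros)
    qed
    show "((?F \<circ> real_of_ereal) \<longlongrightarrow> 0) (at_left \<infinity>)"
      unfolding ereal_tendsto_simps
    proof -
      have "((\<lambda>v. exp (- (Re s * v)) / norm s) \<longlongrightarrow> 0) at_top"
        using s s0 by real_asymp
      thus "(?F \<longlongrightarrow> 0) at_top"
        by (intro tendsto_norm_zero_cancel[where f = ?F]) (simp add: norm_divide)
    qed
  qed simp
  also have "(LBINT v=ereal c..\<infinity>. ?f v) = (LBINT v:{c<..}. ?f v)"
    by (rule interval_integral_to_infinity_eq)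
  also have "\<dots> = (\<integral>v. indicator {c..} v *\<^sub>R ?f v \<partial>lborel)"
    unfolding set_lebesgue_integral_def
  proof (rule integral_cong_AE)
    show "AE v in lborel. indicator {c<..} v *\<^sub>R ?f v = indicator {c..} v *\<^sub>R ?f v"
      using AE_lborel_singleton[of c] by eventually_elim (auto simp: indicator_def)
  qed measurable
  finally show "(\<integral>v. indicator {c..} v *\<^sub>R exp (- (s * of_real v)) \<partial>lborel) = exp (- (s * of_real c)) / s"
    by simp
qed

definition moebius_ln2_sum :: "real \<Rightarrow> real" where
  "moebius_ln2_sum u = (\<Sum>n | 1 \<le> n \<and> real n \<le> u. moebius_ln2 n)"

lemma finite_nat_interval: "finite {n::nat. 1 \<le> n \<and> real n \<le> u}"
  using finite_nat_le_real[of u "\<lambda>n. 1 \<le> n"] by (simp add: conj_commute)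

text \<open>\<open>n^(-s)/s\<close> is the integral of \<open>e^(-sv)\<close> over \<open>v \<ge> log n\<close>.\<close>

lemma laplace_moebius_ln2_sum:
  assumes s: "Re s > 1"
  shows "integrable lborel (\<lambda>v. of_real (moebius_ln2_sum (exp v)) * exp (- (s * of_real v)))"
    and "(\<integral>v. of_real (moebius_ln2_sum (exp v)) * exp (- (s * of_real v)) \<partial>lborel) = moebius_ln2_series s / s"
proof -
  have s0: "Re s > 0" "s \<noteq> 0" using s by auto
  let ?f = "\<lambda>n v. of_real (moebius_ln2 (Suc n)) * (indicator {ln (real (Suc n))..} v *\<^sub>R exp (- (s * of_real v)))"
  have fin: "finite {n. real (Suc n) \<le> exp v}" for v
  proof (rule finite_subset)
    show "{n. real (Suc n) \<le> exp v} \<subseteq> {n::nat. real n \<le> exp v \<and> True}" by auto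
  qed (rule finite_nat_le_real)
  have ind: "indicator {ln (real (Suc n))..} v = (if real (Suc n) \<le> exp v then 1 else 0 :: real)" for n v
  proof -
    have "ln (real (Suc n)) \<le> v \<longleftrightarrow> real (Suc n) \<le> exp v"
      by (subst ln_le_cancel_iff[of _ "exp v", simplified, symmetric]) auto
    thus ?thesis by (simp add: indicator_def)
  qed
  have zero: "?f n v = 0" if "n \<notin> {n. real (Suc n) \<le> exp v}" for n v
    using that by (simp only: ind mem_Collect_eq if_False scaleR_zero_left mult_zero_right)
  have sum_eq: "(\<Sum>n. ?f n v) = of_real (moebius_ln2_sum (exp v)) * exp (- (s * of_real v))" for v
  proof -
    have "(\<Sum>n. ?f n v) = (\<Sum>n | real (Suc n) \<le> exp v. ?f n v)"
      by (rule suminf_finite[OF fin zero])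
    also have "\<dots> = (\<Sum>n | real (Suc n) \<le> exp v. of_real (moebius_ln2 (Suc n)) * exp (- (s * of_real v)))"
      by (intro sum.cong refl) (simp only: ind mem_Collect_eq if_True scaleR_one)
    also have "\<dots> = (\<Sum>n | 1 \<le> n \<and> real n \<le> exp v. of_real (moebius_ln2 n) * exp (- (s * of_real v)))"
      by (rule sum.reindex_bij_witness[of _ "\<lambda>n. n - 1" Suc]) auto
    finally show ?thesis by (simp add: moebius_ln2_sum_def sum_distrib_right)
  qed
  have int: "integrable lborel (?f n)" for n
    by (intro integrable_mult_right integral_indicator_cexp s0)
  have summ: "AE v in lborel. summable (\<lambda>n. norm (?f n v))"
  proof (rule AE_I2)
    fix v show "summable (\<lambda>n. norm (?f n v))"
      by (rule summable_finite[OF fin[of v]]) (use zero[of _ v] in auto)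
  qed
  have norms: "(\<integral>v. norm (?f n v) \<partial>lborel) = norm (of_real (moebius_ln2 (Suc n)) * npow (real (Suc n)) s) * (1 / Re s)" for n
  proof -
    have "(\<integral>v. norm (?f n v) \<partial>lborel) = \<bar>moebius_ln2 (Suc n)\<bar> *
        (\<integral>v. norm (indicator {ln (real (Suc n))..} v *\<^sub>R exp (- (s * of_real v))) \<partial>lborel)"
      by (simp only: norm_mult norm_of_real integral_mult_right_zero)
    also have "\<dots> = \<bar>moebius_ln2 (Suc n)\<bar> * (exp (- (Re s * ln (real (Suc n)))) / Re s)"
      by (simp only: integral_indicator_cexp(2)[OF s0(1)])
    finally show ?thesis by (simp add: npow_def norm_mult)
  qed
  have summ2: "summable (\<lambda>n. \<integral>v. norm (?f n v) \<partial>lborel)"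
    unfolding norms by (intro summable_mult2 dirichlet_summable_norm[OF subpolynomial_moebius_ln2 s])
  show "integrable lborel (\<lambda>v. of_real (moebius_ln2_sum (exp v)) * exp (- (s * of_real v)))"
    using integrable_suminf[OF int summ summ2] unfolding sum_eq .
  have "(\<integral>v. of_real (moebius_ln2_sum (exp v)) * exp (- (s * of_real v)) \<partial>lborel) = (\<Sum>n. integral\<^sup>L lborel (?f n))"
    using integral_suminf[OF int summ summ2] unfolding sum_eq .
  also have "\<dots> = (\<Sum>n. of_real (moebius_ln2 (Suc n)) * npow (real (Suc n)) s / s)"
    by (simp only: integral_mult_right_zero integral_indicator_cexp(3)[OF s0(1)] npow_def times_divide_eq_right)
  also have "\<dots> = (\<Sum>n. of_real (moebius_ln2 (Suc n)) * npow (real (Suc n)) s) / s"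
    by (rule suminf_divide[OF summable_norm_cancel[OF dirichlet_summable_norm[OF subpolynomial_moebius_ln2 s]]])
  finally show "(\<integral>v. of_real (moebius_ln2_sum (exp v)) * exp (- (s * of_real v)) \<partial>lborel) = moebius_ln2_series s / s"
    by (simp add: dirichlet_def)
qed

text \<open>Integrate the Laplace transform on the vertical line through \<open>\<sigma>\<close> against a Gaussian in the height and
  exchange the integrals. Since the characteristic function of the normal distribution is again a
  Gaussian, the result is the mean of \<open>h\<close> over a window of width \<open>1/V\<close> around \<open>V\<close>; this takes the place
  of an inversion formula.\<close>

lemma gaussian_average_eq:
  fixes V \<sigma> :: real
  assumes V: "V > 0" and \<sigma>: "\<sigma> > 1"
  defines "h \<equiv> \<lambda>v. moebius_ln2_sum (exp v) * exp (- (\<sigma> * v))"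
  shows "integrable lborel h"
    and "complex_of_real (sqrt (2 * pi) / V * (\<integral>x. std_normal_density x * h (V + x / V) \<partial>lborel)) =
         (\<integral>\<tau>. iexp (V\<^sup>2 * \<tau>) * (moebius_ln2_series (Complex \<sigma> (V * \<tau>)) / Complex \<sigma> (V * \<tau>)) \<partial>std_normal_distribution)" (is "?thesis1")
    and "integrable std_normal_distribution (\<lambda>\<tau>. iexp (V\<^sup>2 * \<tau>) * (moebius_ln2_series (Complex \<sigma> (V * \<tau>)) / Complex \<sigma> (V * \<tau>)))"
proof -
  define h0 where "h0 v = complex_of_real (h v)" for v
  have Cs: "Complex \<sigma> t * of_real v = of_real (\<sigma> * v) + \<i> * of_real (t * v)" for t v
    by (simp add: complex_eq_iff)
  have h0t: "of_real (moebius_ln2_sum (exp v)) * exp (- (Complex \<sigma> t * of_real v)) = h0 v * iexp (- (t * v))" for t v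
  proof -
    have "exp (- (Complex \<sigma> t * of_real v)) = exp (complex_of_real (- (\<sigma> * v))) * iexp (- (t * v))"
      unfolding Cs by (simp flip: exp_add)
    thus ?thesis by (simp only: exp_of_real h0_def h_def of_real_mult mult.assoc)
  qed
  have int0: "integrable lborel (\<lambda>v. h0 v * iexp (- (t * v)))" for t
    using laplace_moebius_ln2_sum(1)[of "Complex \<sigma> t"] \<sigma> unfolding h0t by simp
  have inth0: "integrable lborel h0" using int0[of 0] by simp
  thus "integrable lborel h" unfolding h0_def by (simp only: complex_of_real_integrable_eq)
  hence [measurable]: "h \<in> borel_measurable borel" by (auto dest: borel_measurable_integrable)
  have [measurable]: "h0 \<in> borel_measurable borel" unfolding h0_def by measurable
  let ?N = std_normal_distribution
  interpret N: real_distribution ?N by (rule real_dist_normal_dist)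
  interpret P: pair_sigma_finite ?N lborel by unfold_locales
  define f where "f \<tau> v = h0 v * iexp (V * \<tau> * (V - v))" for \<tau> v
  have nf: "norm (f \<tau> v) = norm (h0 v)" for \<tau> v by (simp add: f_def norm_mult)
  have fm[measurable]: "case_prod f \<in> borel_measurable (?N \<Otimes>\<^sub>M lborel)"
    unfolding f_def by measurable
  have intf: "integrable (?N \<Otimes>\<^sub>M lborel) (case_prod f)"
  proof (rule P.Fubini_integrable[OF fm])
    show "integrable ?N (\<lambda>x. \<integral>y. norm (case_prod f (x, y)) \<partial>lborel)"
      by (simp add: nf)
    show "AE x in ?N. integrable lborel (\<lambda>y. case_prod f (x, y))"
    proof (rule AE_I2)
      fix x
      have "f x \<in> borel_measurable lborel" unfolding f_def by measurable
      hence "integrable lborel (f x)"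
        by (rule Bochner_Integration.integrable_bound[OF inth0]) (simp add: nf)
      thus "integrable lborel (\<lambda>y. case_prod f (x, y))" by simp
    qed
  qed
  have inner1: "(\<integral>\<tau>. f \<tau> v \<partial>?N) = complex_of_real (h v * exp (- (V * (V - v))\<^sup>2 / 2))" for v
  proof -
    have "(\<integral>\<tau>. f \<tau> v \<partial>?N) = h0 v * (\<integral>\<tau>. iexp (V * (V - v) * \<tau>) \<partial>?N)"
      unfolding f_def by (subst integral_mult_right_zero) (simp add: mult_ac)
    also have "(\<integral>\<tau>. iexp (V * (V - v) * \<tau>) \<partial>?N) = char ?N (V * (V - v))"
      by (simp add: char_def)
    finally show ?thesis by (simp add: char_std_normal_distribution h0_def)
  qed
  have inner2: "(\<integral>v. f \<tau> v \<partial>lborel) = iexp (V\<^sup>2 * \<tau>) * (moebius_ln2_series (Complex \<sigma> (V * \<tau>)) / Complex \<sigma> (V * \<tau>))" for \<tau>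
  proof -
    have "f \<tau> v = iexp (V\<^sup>2 * \<tau>) * (h0 v * iexp (- (V * \<tau> * v)))" for v
    proof -
      have "iexp (V * \<tau> * (V - v)) = iexp (V\<^sup>2 * \<tau> + - (V * \<tau> * v))"
        by (simp add: power2_eq_square algebra_simps)
      also have "\<dots> = iexp (V\<^sup>2 * \<tau>) * iexp (- (V * \<tau> * v))"
        by (simp only: of_real_add ring_distribs exp_add)
      finally show ?thesis by (simp add: f_def)
    qed
    hence "(\<integral>v. f \<tau> v \<partial>lborel) = iexp (V\<^sup>2 * \<tau>) * (\<integral>v. h0 v * iexp (- (V * \<tau> * v)) \<partial>lborel)"
      by (simp only: integral_mult_right_zero)
    also have "(\<integral>v. h0 v * iexp (- (V * \<tau> * v)) \<partial>lborel) = moebius_ln2_series (Complex \<sigma> (V * \<tau>)) / Complex \<sigma> (V * \<tau>)"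
      using laplace_moebius_ln2_sum(2)[of "Complex \<sigma> (V * \<tau>)"] \<sigma> unfolding h0t by simp
    finally show ?thesis .
  qed
  show "integrable ?N (\<lambda>\<tau>. iexp (V\<^sup>2 * \<tau>) * (moebius_ln2_series (Complex \<sigma> (V * \<tau>)) / Complex \<sigma> (V * \<tau>)))"
    using P.integrable_fst[OF intf] unfolding inner2 .
  have "(\<integral>v. h v * exp (- (V * (V - v))\<^sup>2 / 2) \<partial>lborel) =
      \<bar>1 / V\<bar> *\<^sub>R (\<integral>x. h (V + 1 / V * x) * exp (- (V * (V - (V + 1 / V * x)))\<^sup>2 / 2) \<partial>lborel)"
    by (rule lborel_integral_real_affine) (use V in simp)
  also have "\<dots> = 1 / V * (\<integral>x. sqrt (2 * pi) * (std_normal_density x * h (V + x / V)) \<partial>lborel)"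
    using V by (simp add: std_normal_density_def mult_ac)
  also have "\<dots> = sqrt (2 * pi) / V * (\<integral>x. std_normal_density x * h (V + x / V) \<partial>lborel)" by simp
  finally have "complex_of_real (sqrt (2 * pi) / V * (\<integral>x. std_normal_density x * h (V + x / V) \<partial>lborel)) =
      (\<integral>v. complex_of_real (h v * exp (- (V * (V - v))\<^sup>2 / 2)) \<partial>lborel)" by (simp only: integral_complex_of_real)
  also have "\<dots> = (\<integral>v. (\<integral>\<tau>. f \<tau> v \<partial>?N) \<partial>lborel)" by (simp only: inner1)
  also have "\<dots> = (\<integral>\<tau>. (\<integral>v. f \<tau> v \<partial>lborel) \<partial>?N)" by (rule P.Fubini_integral[OF intf])
  finally show ?thesis1 unfolding inner2 .
qed

lemma abs_moebius_ln2_le: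
  assumes "1 \<le> n" "real n \<le> u" shows "\<bar>moebius_ln2 n\<bar> \<le> (ln u)\<^sup>2"
proof -
  have "\<bar>moebius_ln2 n\<bar> = real_of_int \<bar>moebius n\<bar> * (ln (real n))\<^sup>2" by (simp add: moebius_ln2_def abs_mult)
  also have "\<dots> \<le> 1 * (ln u)\<^sup>2"
  proof (rule mult_mono)
    have "ln (real n) \<le> ln u" using assms by (subst ln_le_cancel_iff) auto
    thus "(ln (real n))\<^sup>2 \<le> (ln u)\<^sup>2" using assms by (intro power_mono) auto
  qed (use abs_moebius_le_1[of n] in auto)
  finally show ?thesis by simp
qed

lemma abs_moebius_ln2_sum_le:
  assumes "u \<ge> 1" shows "\<bar>moebius_ln2_sum u\<bar> \<le> u * (ln u)\<^sup>2"
proof -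
  have "\<bar>moebius_ln2_sum u\<bar> \<le> (\<Sum>n | 1 \<le> n \<and> real n \<le> u. \<bar>moebius_ln2 n\<bar>)"
    unfolding moebius_ln2_sum_def by (rule sum_abs)
  also have "\<dots> \<le> (\<Sum>n | 1 \<le> n \<and> real n \<le> u. (ln u)\<^sup>2)"
    by (rule sum_mono) (use abs_moebius_ln2_le in auto)
  also have "\<dots> = real (card {n::nat. 1 \<le> n \<and> real n \<le> u}) * (ln u)\<^sup>2" by simp
  also have "{n::nat. 1 \<le> n \<and> real n \<le> u} = {1..nat \<lfloor>u\<rfloor>}"
    using assms by (auto simp: le_nat_floor le_nat_iff le_floor_iff)
  also have "real (card {1..nat \<lfloor>u\<rfloor>}) * (ln u)\<^sup>2 \<le> u * (ln u)\<^sup>2"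
    using assms by (intro mult_right_mono) auto
  finally show ?thesis .
qed

lemma abs_moebius_ln2_sum_diff_le:
  assumes "1 \<le> u" "u \<le> w"
  shows "\<bar>moebius_ln2_sum w - moebius_ln2_sum u\<bar> \<le> (w - u + 1) * (ln w)\<^sup>2"
proof -
  let ?A = "{n::nat. 1 \<le> n \<and> u < real n \<and> real n \<le> w}"
  have fin: "finite ?A" by (rule finite_subset[OF _ finite_nat_interval[of w]]) auto
  have "moebius_ln2_sum w = moebius_ln2_sum u + sum moebius_ln2 ?A"
    unfolding moebius_ln2_sum_def
    by (subst sum.union_disjoint[symmetric])
       (use assms fin finite_nat_interval[of u] in \<open>auto intro!: sum.cong\<close>)
  hence "\<bar>moebius_ln2_sum w - moebius_ln2_sum u\<bar> \<le> (\<Sum>n\<in>?A. \<bar>moebius_ln2 n\<bar>)"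
    using sum_abs[of moebius_ln2 ?A] by simp
  also have "\<dots> \<le> (\<Sum>n\<in>?A. (ln w)\<^sup>2)"
    by (rule sum_mono) (use abs_moebius_ln2_le in auto)
  also have "\<dots> = real (card ?A) * (ln w)\<^sup>2" by simp
  also have "\<dots> \<le> (w - u + 1) * (ln w)\<^sup>2"
  proof (rule mult_right_mono)
    have "?A \<subseteq> {nat \<lfloor>u\<rfloor> + 1..nat \<lfloor>w\<rfloor>}"
    proof
      fix n assume n: "n \<in> ?A"
      have "nat \<lfloor>u\<rfloor> < n" using n assms by (simp add: nat_less_iff floor_less_iff)
      moreover have "n \<le> nat \<lfloor>w\<rfloor>" using n by (simp add: le_nat_floor)
      ultimately show "n \<in> {nat \<lfloor>u\<rfloor> + 1..nat \<lfloor>w\<rfloor>}" by simp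
    qed
    hence "card ?A \<le> card {nat \<lfloor>u\<rfloor> + 1..nat \<lfloor>w\<rfloor>}" by (intro card_mono) auto
    also have "\<dots> = nat \<lfloor>w\<rfloor> - nat \<lfloor>u\<rfloor>" by simp
    finally have "real (card ?A) \<le> real (nat \<lfloor>w\<rfloor> - nat \<lfloor>u\<rfloor>)" by simp
    also have "\<dots> \<le> w - u + 1" using assms by linarith
    finally show "real (card ?A) \<le> w - u + 1" .
  qed simp
  finally show ?thesis .
qed

lemma power2_le_exp: "w \<ge> 0 \<Longrightarrow> w\<^sup>2 \<le> 2 * exp (w::real)"
  using exp_lower_Taylor_quadratic[of w] by simp

text \<open>The damping \<open>e^(-v/V)\<close> limits the growth of \<open>v^2\<close> to the order \<open>V^2\<close>, also far from \<open>V\<close>.\<close>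

lemma damped_sum_le:
  fixes V :: real
  assumes V: "V \<ge> 1"
  defines "h \<equiv> \<lambda>v. moebius_ln2_sum (exp v) * exp (- ((1 + 1 / V) * v))"
  shows "\<bar>h v\<bar> \<le> 8 * V\<^sup>2"
proof (cases "v \<ge> 0")
  case False
  hence "exp v < 1" by simp
  hence "\<not> (1 \<le> n \<and> real n \<le> exp v)" for n :: nat by linarith
  hence "{n::nat. 1 \<le> n \<and> real n \<le> exp v} = {}" by blast
  hence "moebius_ln2_sum (exp v) = 0" unfolding moebius_ln2_sum_def by (simp only: sum.empty)
  thus ?thesis by (simp add: h_def)
next
  case True
  have "\<bar>h v\<bar> = \<bar>moebius_ln2_sum (exp v)\<bar> * exp (- ((1 + 1 / V) * v))" by (simp add: h_def abs_mult)
  also have "\<dots> \<le> (exp v * v\<^sup>2) * exp (- ((1 + 1 / V) * v))"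
    using abs_moebius_ln2_sum_le[of "exp v"] True by (intro mult_right_mono) auto
  also have "\<dots> = v\<^sup>2 * exp (- (v / V))"
    by (simp add: ring_distribs exp_diff exp_minus field_simps exp_add)
  also have "v\<^sup>2 = V\<^sup>2 * (v / V)\<^sup>2" using V by (simp add: power2_eq_square)
  also have "\<dots> * exp (- (v / V)) \<le> V\<^sup>2 * (2 * exp (v / V)) * exp (- (v / V))"
    using V True by (intro mult_right_mono mult_left_mono power2_le_exp) auto
  also have "\<dots> = 2 * V\<^sup>2" by (simp add: exp_minus)
  finally show ?thesis using zero_le_power2[of V] by linarith
qed

text \<open>For \<open>|v - V| < 1\<close> there are \<open>O(e^V |v - V| + 1)\<close> integers between \<open>e^v\<close> and \<open>e^V\<close>, and each
  contributes \<open>O(V^2)\<close> to the sum; after multiplication by the damping factor of order \<open>e^(-V)\<close> the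
  \<open>1\<close>, which comes from the jumps, becomes the term \<open>e^(-V)\<close>. The change of the damping factor itself
  is of the same order. For larger \<open>|v - V|\<close> the claim follows from boundedness.\<close>

lemma damped_sum_lipschitz:
  fixes V :: real
  assumes V: "V \<ge> 1"
  defines "h \<equiv> \<lambda>v. moebius_ln2_sum (exp v) * exp (- ((1 + 1 / V) * v))"
  shows "\<bar>h v - h V\<bar> \<le> 30 * V\<^sup>2 * (\<bar>v - V\<bar> + exp (- V))"
proof (cases "\<bar>v - V\<bar> \<ge> 1")
  case True
  have "\<bar>h v - h V\<bar> \<le> \<bar>h v\<bar> + \<bar>h V\<bar>" by simp
  also have "\<dots> \<le> 16 * V\<^sup>2 * 1" using damped_sum_le[OF V, of v] damped_sum_le[OF V, of V] unfolding h_def by simp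
  also have "\<dots> \<le> 30 * V\<^sup>2 * (\<bar>v - V\<bar> + exp (- V))"
    using True by (intro mult_mono) (auto intro: add_increasing2)
  finally show ?thesis .
next
  case False
  define \<sigma> where "\<sigma> = 1 + 1 / V"
  have \<sigma>: "1 \<le> \<sigma>" "\<sigma> \<le> 2" using V by (auto simp: \<sigma>_def)
  have v: "v > 0" "v < V + 1" "V < v + 1" using False V by linarith+
  define lo hi where "lo = min v V" and "hi = max v V"
  have lohi: "0 \<le> lo" "lo \<le> hi" "hi \<le> lo + 1" "hi - lo = \<bar>v - V\<bar>" "hi \<le> V + 1" "hi \<le> v + 1" "V \<le> lo + 1"
    using v V by (auto simp: lo_def hi_def)
  have e1: "exp (1::real) \<le> 3" by (rule exp_le)
  have diffexp: "exp hi - exp lo \<le> exp hi * \<bar>v - V\<bar>"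
  proof -
    have "1 + (lo - hi) \<le> exp (lo - hi)" by (rule exp_ge_add_one_self)
    hence "exp hi * (1 + (lo - hi)) \<le> exp hi * exp (lo - hi)" by (intro mult_left_mono) auto
    also have "exp hi * exp (lo - hi) = exp lo" by (simp flip: exp_add)
    finally show ?thesis unfolding lohi(4)[symmetric] by (simp add: algebra_simps)
  qed
  have S: "\<bar>moebius_ln2_sum (exp v) - moebius_ln2_sum (exp V)\<bar> \<le> (exp hi * \<bar>v - V\<bar> + 1) * (4 * V\<^sup>2)"
  proof -
    have "\<bar>moebius_ln2_sum (exp v) - moebius_ln2_sum (exp V)\<bar> = \<bar>moebius_ln2_sum (exp hi) - moebius_ln2_sum (exp lo)\<bar>"
      by (auto simp: lo_def hi_def max_def min_def)
    also have "\<dots> \<le> (exp hi - exp lo + 1) * (ln (exp hi))\<^sup>2"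
      using lohi by (intro abs_moebius_ln2_sum_diff_le) auto
    also have "\<dots> \<le> (exp hi * \<bar>v - V\<bar> + 1) * (2 * V)\<^sup>2"
      using diffexp lohi V by (intro mult_mono power_mono) auto
    finally show ?thesis by (simp add: power_mult_distrib)
  qed
  have 1: "\<bar>moebius_ln2_sum (exp v) - moebius_ln2_sum (exp V)\<bar> * exp (- (\<sigma> * v)) \<le> (3 * \<bar>v - V\<bar> + 3 * exp (- V)) * (4 * V\<^sup>2)"
  proof -
    have "exp (- (\<sigma> * v)) \<le> exp (- v)" using \<sigma> v by simp
    hence "\<bar>moebius_ln2_sum (exp v) - moebius_ln2_sum (exp V)\<bar> * exp (- (\<sigma> * v))
       \<le> ((exp hi * \<bar>v - V\<bar> + 1) * (4 * V\<^sup>2)) * exp (- v)"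
      using S by (intro mult_mono) auto
    also have "\<dots> = (exp (hi - v) * \<bar>v - V\<bar> + exp (- v)) * (4 * V\<^sup>2)"
      by (simp add: exp_diff exp_minus field_simps)
    also have "\<dots> \<le> (3 * \<bar>v - V\<bar> + 3 * exp (- V)) * (4 * V\<^sup>2)"
    proof (intro mult_right_mono add_mono)
      have "exp (hi - v) \<le> exp 1" using lohi by simp
      thus "exp (hi - v) \<le> 3" using e1 by linarith
      have "exp (- v) \<le> exp (1 + - V)" using v by simp
      also have "\<dots> = exp 1 * exp (- V)" by (rule exp_add)
      also have "\<dots> \<le> 3 * exp (- V)" using e1 by (intro mult_right_mono) auto
      finally show "exp (- v) \<le> 3 * exp (- V)" .
    qed auto
    finally show ?thesis .
  qed
  have 2: "\<bar>moebius_ln2_sum (exp V)\<bar> * \<bar>exp (- (\<sigma> * v)) - exp (- (\<sigma> * V))\<bar> \<le> 6 * \<bar>v - V\<bar> * V\<^sup>2"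
  proof -
    have "\<bar>exp (- (\<sigma> * v)) - exp (- (\<sigma> * V))\<bar> = exp (- (\<sigma> * lo)) - exp (- (\<sigma> * hi))"
      using \<sigma> by (auto simp: lo_def hi_def max_def min_def mult_left_mono)
    also have "\<dots> \<le> exp (- (\<sigma> * lo)) * (\<sigma> * (hi - lo))"
    proof -
      have "1 + (- (\<sigma> * (hi - lo))) \<le> exp (- (\<sigma> * (hi - lo)))" by (rule exp_ge_add_one_self)
      hence "exp (- (\<sigma> * lo)) * (1 + (- (\<sigma> * (hi - lo)))) \<le> exp (- (\<sigma> * lo)) * exp (- (\<sigma> * (hi - lo)))"
        by (intro mult_left_mono) auto
      also have "\<dots> = exp (- (\<sigma> * hi))" by (simp add: algebra_simps flip: exp_add)
      finally show ?thesis by (simp add: algebra_simps)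
    qed
    also have "\<dots> \<le> (3 * exp (- V)) * (2 * \<bar>v - V\<bar>)"
    proof (rule mult_mono)
      have "1 * lo \<le> \<sigma> * lo" using \<sigma> lohi by (intro mult_right_mono) auto
      hence "exp (- (\<sigma> * lo)) \<le> exp (1 + - V)" using lohi by simp
      also have "\<dots> = exp 1 * exp (- V)" by (rule exp_add)
      also have "\<dots> \<le> 3 * exp (- V)" using e1 by (intro mult_right_mono) auto
      finally show "exp (- (\<sigma> * lo)) \<le> 3 * exp (- V)" .
      show "\<sigma> * (hi - lo) \<le> 2 * \<bar>v - V\<bar>" unfolding lohi(4) using \<sigma> by (intro mult_right_mono) auto
    qed (use \<sigma> lohi in auto)
    finally have "\<bar>exp (- (\<sigma> * v)) - exp (- (\<sigma> * V))\<bar> \<le> (3 * exp (- V)) * (2 * \<bar>v - V\<bar>)" .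
    moreover have "\<bar>moebius_ln2_sum (exp V)\<bar> \<le> exp V * V\<^sup>2"
      using abs_moebius_ln2_sum_le[of "exp V"] V by simp
    ultimately have "\<bar>moebius_ln2_sum (exp V)\<bar> * \<bar>exp (- (\<sigma> * v)) - exp (- (\<sigma> * V))\<bar>
        \<le> (exp V * V\<^sup>2) * ((3 * exp (- V)) * (2 * \<bar>v - V\<bar>))"
      by (intro mult_mono) auto
    also have "\<dots> = 6 * \<bar>v - V\<bar> * V\<^sup>2" by (simp add: exp_minus field_simps)
    finally show ?thesis .
  qed
  have "h v - h V = (moebius_ln2_sum (exp v) - moebius_ln2_sum (exp V)) * exp (- (\<sigma> * v))
      + moebius_ln2_sum (exp V) * (exp (- (\<sigma> * v)) - exp (- (\<sigma> * V)))"
    by (simp add: h_def \<sigma>_def algebra_simps)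
  also have "\<bar>\<dots>\<bar> \<le> \<bar>moebius_ln2_sum (exp v) - moebius_ln2_sum (exp V)\<bar> * exp (- (\<sigma> * v))
      + \<bar>moebius_ln2_sum (exp V)\<bar> * \<bar>exp (- (\<sigma> * v)) - exp (- (\<sigma> * V))\<bar>"
    by (rule order.trans[OF abs_triangle_ineq]) (simp add: abs_mult)
  also have "\<dots> \<le> (3 * \<bar>v - V\<bar> + 3 * exp (- V)) * (4 * V\<^sup>2) + 6 * \<bar>v - V\<bar> * V\<^sup>2"
    using 1 2 by linarith
  also have "\<dots> = V\<^sup>2 * (18 * \<bar>v - V\<bar> + 12 * exp (- V))" by (simp add: algebra_simps)
  also have "\<dots> \<le> V\<^sup>2 * (30 * \<bar>v - V\<bar> + 30 * exp (- V))" by (intro mult_left_mono add_mono) auto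
  also have "\<dots> = 30 * V\<^sup>2 * (\<bar>v - V\<bar> + exp (- V))" by (simp add: algebra_simps)
  finally show ?thesis .
qed

text \<open>The Gaussian mean is \<open>O(V)\<close>, because \<open>G(s)/s\<close> is bounded, and replacing the mean by the value at \<open>V\<close> costs
  \<open>V^2\<close> times the width \<open>1/V\<close> of the window.\<close>

lemma moebius_ln2_sum_bound_large:
  obtains V0 C where "V0 \<ge> 1" "C > 0" "\<And>V. V \<ge> V0 \<Longrightarrow> \<bar>moebius_ln2_sum (exp V)\<bar> \<le> C * exp V * V"
proof -
  obtain \<delta> C0 where C0: "\<delta> > 0" "C0 > 0"
    "\<And>s. Re s > 1 \<Longrightarrow> Re s < 1 + \<delta> \<Longrightarrow> norm (moebius_ln2_series s) \<le> C0 * norm s"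
    using moebius_ln2_series_bound by metis
  define V0 where "V0 = max 1 (2 / \<delta>)"
  show thesis
  proof (rule that[of V0 "3 * (C0 + 90)"])
    show "V0 \<ge> 1" by (simp add: V0_def)
    show "3 * (C0 + 90) > 0" using C0 by simp
    fix V assume "V \<ge> V0"
    hence V: "V \<ge> 1" "V \<ge> 2 / \<delta>" by (auto simp: V0_def)
    define \<sigma> where "\<sigma> = 1 + 1 / V"
    have "1 / V < \<delta>" using V C0(1) by (simp add: field_simps)
    hence \<sigma>: "\<sigma> > 1" "\<sigma> < 1 + \<delta>" using V by (auto simp: \<sigma>_def)
    define h where "h v = moebius_ln2_sum (exp v) * exp (- (\<sigma> * v))" for v
    let ?N = std_normal_distribution and ?\<phi> = std_normal_density
    interpret N: real_distribution ?N by (rule real_dist_normal_dist)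
    have V0: "V > 0" using V by simp
    note avg = gaussian_average_eq[OF V0 \<sigma>(1), folded h_def]
    have inth: "integrable lborel h" by (rule avg(1))
    have [measurable]: "h \<in> borel_measurable borel" using borel_measurable_integrable[OF inth] by simp
    let ?g = "\<lambda>\<tau>. iexp (V\<^sup>2 * \<tau>) * (moebius_ln2_series (Complex \<sigma> (V * \<tau>)) / Complex \<sigma> (V * \<tau>))"
    have "norm (\<integral>\<tau>. ?g \<tau> \<partial>?N) \<le> (\<integral>\<tau>. C0 \<partial>?N)"
    proof (rule Bochner_Integration.integral_norm_bound_integral[OF avg(3)])
      fix \<tau>
      have "norm (?g \<tau>) = norm (moebius_ln2_series (Complex \<sigma> (V * \<tau>))) / norm (Complex \<sigma> (V * \<tau>))"
        by (simp add: norm_mult norm_divide)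
      also have "\<dots> \<le> (C0 * norm (Complex \<sigma> (V * \<tau>))) / norm (Complex \<sigma> (V * \<tau>))"
        by (intro divide_right_mono C0) (use \<sigma> in auto)
      also have "\<dots> \<le> C0" using C0 by simp
      finally show "norm (?g \<tau>) \<le> C0" .
    qed simp
    also have "(\<integral>\<tau>. C0 \<partial>?N) = C0" using N.prob_space by simp
    finally have "\<bar>sqrt (2 * pi) / V * (\<integral>x. ?\<phi> x * h (V + x / V) \<partial>lborel)\<bar> \<le> C0"
      unfolding avg(2)[symmetric] by (simp only: norm_of_real)
    hence "sqrt (2 * pi) * \<bar>\<integral>x. ?\<phi> x * h (V + x / V) \<partial>lborel\<bar> \<le> C0 * V"
      using V by (simp add: abs_mult field_simps)
    moreover have "1 * \<bar>\<integral>x. ?\<phi> x * h (V + x / V) \<partial>lborel\<bar> \<le> sqrt (2 * pi) * \<bar>\<integral>x. ?\<phi> x * h (V + x / V) \<partial>lborel\<bar>"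
      using pi_gt3 by (intro mult_right_mono) auto
    ultimately have mean: "\<bar>\<integral>x. ?\<phi> x * h (V + x / V) \<partial>lborel\<bar> \<le> C0 * V" by linarith
    have int\<phi>: "integrable lborel ?\<phi>" using integrable_std_normal_moment[of 0] by simp
    have int\<phi>1: "integrable lborel (\<lambda>x. ?\<phi> x * \<bar>x\<bar>)" using integrable_std_normal_moment_abs[of 1] by simp
    have i1: "(\<integral>x. ?\<phi> x \<partial>lborel) = 1" using integral_std_normal_moment_even[of 0] by simp
    have i2: "(\<integral>x. ?\<phi> x * \<bar>x\<bar> \<partial>lborel) = sqrt (2 / pi)" using integral_std_normal_moment_abs_odd[of 0] by simp
    have sq: "sqrt (2 / pi) \<le> 1" using pi_gt3 by (simp add: field_simps)
    have int1: "integrable lborel (\<lambda>x. ?\<phi> x * h (V + x / V))"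
    proof (rule Bochner_Integration.integrable_bound[OF integrable_mult_right[OF int\<phi>, of "8 * V\<^sup>2"]])
      show "AE x in lborel. norm (?\<phi> x * h (V + x / V)) \<le> norm (8 * V\<^sup>2 * ?\<phi> x)"
      proof (rule AE_I2)
        fix x
        have "norm (?\<phi> x * h (V + x / V)) = ?\<phi> x * \<bar>h (V + x / V)\<bar>" by (simp add: abs_mult)
        also have "\<dots> \<le> ?\<phi> x * (8 * V\<^sup>2)"
          unfolding h_def \<sigma>_def by (intro mult_left_mono damped_sum_le V(1)) auto
        finally show "norm (?\<phi> x * h (V + x / V)) \<le> norm (8 * V\<^sup>2 * ?\<phi> x)" by (simp add: abs_mult mult.commute)
      qed
    qed measurable
    have int2: "integrable lborel (\<lambda>x. ?\<phi> x * (h (V + x / V) - h V))"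
      using Bochner_Integration.integrable_diff[OF int1 integrable_mult_left[OF int\<phi>, of "h V"]]
      by (simp add: algebra_simps)
    let ?k = "\<lambda>x. 30 * V * (?\<phi> x * \<bar>x\<bar>) + 30 * V\<^sup>2 * exp (- V) * ?\<phi> x"
    have "h V = (\<integral>x. ?\<phi> x * h V \<partial>lborel)" using i1 by simp
    also have "\<dots> = (\<integral>x. ?\<phi> x * h (V + x / V) - ?\<phi> x * (h (V + x / V) - h V) \<partial>lborel)"
      by (simp add: algebra_simps)
    also have "\<dots> = (\<integral>x. ?\<phi> x * h (V + x / V) \<partial>lborel) - (\<integral>x. ?\<phi> x * (h (V + x / V) - h V) \<partial>lborel)"
      by (rule Bochner_Integration.integral_diff[OF int1 int2])
    finally have split: "h V = (\<integral>x. ?\<phi> x * h (V + x / V) \<partial>lborel) - (\<integral>x. ?\<phi> x * (h (V + x / V) - h V) \<partial>lborel)" .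
    have "\<bar>\<integral>x. ?\<phi> x * (h (V + x / V) - h V) \<partial>lborel\<bar> \<le> (\<integral>x. ?k x \<partial>lborel)"
    proof -
      have "norm (\<integral>x. ?\<phi> x * (h (V + x / V) - h V) \<partial>lborel) \<le> (\<integral>x. ?k x \<partial>lborel)"
      proof (rule Bochner_Integration.integral_norm_bound_integral)
        show "integrable lborel (\<lambda>x. ?\<phi> x * (h (V + x / V) - h V))" by (rule int2)
        show "integrable lborel ?k" using int\<phi> int\<phi>1 by (intro Bochner_Integration.integrable_add integrable_mult_right)
        fix x
        have "norm (?\<phi> x * (h (V + x / V) - h V)) = ?\<phi> x * \<bar>h (V + x / V) - h V\<bar>" by (simp add: abs_mult)
        also have "\<dots> \<le> ?\<phi> x * (30 * V\<^sup>2 * (\<bar>(V + x / V) - V\<bar> + exp (- V)))"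
          unfolding h_def \<sigma>_def by (intro mult_left_mono damped_sum_lipschitz V(1)) auto
        also have "\<dots> = ?k x" using V0 by (simp add: abs_divide power2_eq_square field_simps)
        finally show "norm (?\<phi> x * (h (V + x / V) - h V)) \<le> ?k x" .
      qed
      thus ?thesis by simp
    qed
    also have "(\<integral>x. ?k x \<partial>lborel) = 30 * V * sqrt (2 / pi) + 30 * V\<^sup>2 * exp (- V)"
      using int\<phi> int\<phi>1 by (subst Bochner_Integration.integral_add) (auto simp: i1 i2)
    also have "\<dots> \<le> 30 * V * 1 + 30 * (2 * V)"
    proof (intro add_mono mult_left_mono sq)
      have "V\<^sup>2 * exp (- V) \<le> (2 * exp V) * exp (- V)"
        using V by (intro mult_right_mono power2_le_exp) auto
      also have "\<dots> = 2" by (simp add: exp_minus)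
      finally have "V\<^sup>2 * exp (- V) \<le> 2 * V" using V by linarith
      thus "30 * V\<^sup>2 * exp (- V) \<le> 30 * (2 * V)" by (simp only: mult.assoc mult_le_cancel_left_pos)
    qed (use V in auto)
    finally have "\<bar>\<integral>x. ?\<phi> x * (h (V + x / V) - h V) \<partial>lborel\<bar> \<le> 90 * V" by simp
    hence "\<bar>h V\<bar> \<le> C0 * V + 90 * V" using mean split by linarith
    hence hV: "\<bar>h V\<bar> \<le> (C0 + 90) * V" by (simp add: algebra_simps)
    have "\<bar>moebius_ln2_sum (exp V)\<bar> = \<bar>h V\<bar> * exp (\<sigma> * V)"
      by (simp add: h_def abs_mult exp_minus)
    \<comment> \<open>\<open>\<sigma> = 1 + 1/V\<close> costs only the factor \<open>e\<close> at \<open>v = V\<close>\<close>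
    also have "\<sigma> * V = V + 1" using V by (simp add: \<sigma>_def field_simps)
    also have "exp (V + 1) = exp 1 * exp V" by (simp add: exp_add)
    also have "\<bar>h V\<bar> * (exp 1 * exp V) \<le> ((C0 + 90) * V) * (3 * exp V)"
      using hV exp_le C0 V by (intro mult_mono) auto
    finally show "\<bar>moebius_ln2_sum (exp V)\<bar> \<le> 3 * (C0 + 90) * exp V * V" by (simp add: mult_ac)
  qed
qed

text \<open>\<open>(log x)^2 - (log n)^2 \<le> 2 log x log (x/n)\<close>, and the sum of \<open>log (x/n)\<close> is \<open>O(x)\<close>; so the weight
  \<open>(log n)^2\<close> may be replaced by \<open>(log x)^2\<close> at the cost of \<open>O(x log x)\<close>.\<close>

lemma moebius_sum_bound:
  obtains K where "K \<ge> 0" "\<And>x. x \<ge> 1 \<Longrightarrow> \<bar>omega_sum (-1) 0 {} x\<bar> \<le> K * x / (1 + ln x)"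
proof -
  obtain V0 C where C: "V0 \<ge> 1" "C > 0" "\<And>V. V \<ge> V0 \<Longrightarrow> \<bar>moebius_ln2_sum (exp V)\<bar> \<le> C * exp V * V"
    using moebius_ln2_sum_bound_large by metis
  have triv: "\<bar>omega_sum (-1) 0 {} x\<bar> \<le> x" if "x \<ge> 1" for x
  proof -
    have "\<bar>omega_sum (-1) 0 {} x\<bar> \<le> (\<Sum>n\<in>squarefree_upto {} x. \<bar>(-1) ^ omega n * real (omega n choose 0)\<bar>)"
      unfolding omega_sum_def by (rule sum_abs)
    also have "\<dots> = real (card (squarefree_upto {} x))" by (simp add: power_abs)
    also have "\<dots> \<le> x" using that by (intro card_squarefree_upto_le) auto
    finally show ?thesis .
  qed
  show thesis
  proof (rule that[of "max (2 * (C + 2)) (1 + V0)"])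
    show "0 \<le> max (2 * (C + 2)) (1 + V0)" using C by auto
    fix x :: real assume x: "x \<ge> 1"
    let ?M = "omega_sum (-1) 0 {} x"
    have l: "1 + ln x > 0" using x by (simp add: add_pos_nonneg)
    show "\<bar>?M\<bar> \<le> max (2 * (C + 2)) (1 + V0) * x / (1 + ln x)"
    proof (cases "ln x \<ge> V0")
      case False
      have "\<bar>?M\<bar> * (1 + ln x) \<le> x * (1 + V0)"
        using triv[OF x] False x by (intro mult_mono) auto
      also have "\<dots> \<le> max (2 * (C + 2)) (1 + V0) * x" using x by (simp add: mult.commute)
      finally show ?thesis using l by (simp add: pos_le_divide_eq)
    next
      case True
      define V where "V = ln x"
      have V: "V \<ge> 1" "V \<ge> V0" using True C(1) by (auto simp: V_def)
      have xV: "x = exp V" using x by (simp add: V_def)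
      let ?A = "{n::nat. 1 \<le> n \<and> real n \<le> x}"
      have M: "?M = (\<Sum>n\<in>?A. of_int (moebius n))"
        unfolding omega_sum_def
        by (rule sum.mono_neutral_cong_left) (use finite_nat_interval[of x] in \<open>auto simp: squarefree_upto_def moebius_def omega_def\<close>)
      have "?M * V\<^sup>2 = moebius_ln2_sum x + (\<Sum>n\<in>?A. of_int (moebius n) * (V\<^sup>2 - (ln (real n))\<^sup>2))"
        unfolding M moebius_ln2_sum_def moebius_ln2_def sum_distrib_right sum.distrib[symmetric]
        by (rule sum.cong) (auto simp: algebra_simps)
      hence "\<bar>?M\<bar> * V\<^sup>2 \<le> \<bar>moebius_ln2_sum x\<bar> + \<bar>\<Sum>n\<in>?A. of_int (moebius n) * (V\<^sup>2 - (ln (real n))\<^sup>2)\<bar>"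
        using abs_triangle_ineq[of "moebius_ln2_sum x"
            "\<Sum>n\<in>?A. of_int (moebius n) * (V\<^sup>2 - (ln (real n))\<^sup>2)"] abs_mult[of ?M "V\<^sup>2"]
        by simp
      also have "\<bar>\<Sum>n\<in>?A. of_int (moebius n) * (V\<^sup>2 - (ln (real n))\<^sup>2)\<bar> \<le> (\<Sum>n\<in>?A. 2 * V * ln (x / real n))"
      proof (rule order.trans[OF sum_abs sum_mono])
        fix n assume n: "n \<in> ?A"
        have ln: "0 \<le> ln (real n)" "ln (real n) \<le> V" "ln (x / real n) = V - ln (real n)"
          using n x by (auto simp: V_def ln_div)
        have "\<bar>real_of_int (moebius n) * (V\<^sup>2 - (ln (real n))\<^sup>2)\<bar> \<le> 1 * \<bar>V\<^sup>2 - (ln (real n))\<^sup>2\<bar>"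
          unfolding abs_mult using abs_moebius_le_1[of n] by (intro mult_right_mono) auto
        also have "1 * \<bar>V\<^sup>2 - (ln (real n))\<^sup>2\<bar> = \<bar>(V + ln (real n)) * (V - ln (real n))\<bar>"
          by (simp add: power2_eq_square algebra_simps)
        also have "\<dots> = (V + ln (real n)) * (V - ln (real n))" using ln V by (simp add: abs_mult)
        also have "\<dots> \<le> 2 * V * (V - ln (real n))" using ln by (intro mult_right_mono) auto
        finally show "\<bar>real_of_int (moebius n) * (V\<^sup>2 - (ln (real n))\<^sup>2)\<bar> \<le> 2 * V * ln (x / real n)"
          unfolding ln(3) .
      qed
      also have "\<dots> = 2 * V * (\<Sum>n\<in>?A. ln (x / real n))" by (rule sum_distrib_left[symmetric])
      also have "\<dots> \<le> 2 * V * x"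
        using V x by (intro mult_left_mono sum_ln_quotient_le finite_nat_interval) auto
      also have "\<bar>moebius_ln2_sum x\<bar> \<le> C * x * V" using C(3)[OF V(2)] by (simp add: xV)
      finally have "(\<bar>?M\<bar> * V) * V \<le> ((C + 2) * x) * V" by (simp add: power2_eq_square algebra_simps)
      hence MV: "\<bar>?M\<bar> * V \<le> (C + 2) * x" using V by simp
      have "\<bar>?M\<bar> * (1 + V) \<le> \<bar>?M\<bar> * (2 * V)" using V by (intro mult_left_mono) auto
      also have "\<dots> \<le> 2 * ((C + 2) * x)" using MV by simp
      also have "\<dots> \<le> max (2 * (C + 2)) (1 + V0) * x" using x mult_right_mono[of "2 * (C + 2)" "max (2 * (C + 2)) (1 + V0)" x] by simp
      finally show ?thesis using l by (simp add: pos_le_divide_eq V_def)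
    qed
  qed
qed

section \<open>Bounds for M_omega\<close>

text \<open>Vandermonde's identity for the sum \<open>w + (-1)\<close>. The case \<open>w = 0\<close>, which belongs to \<open>n = 1\<close>, is
  included.\<close>

lemma gbinomial_minus_one_eq:
  "(real w - 1) gchoose m = (\<Sum>j\<le>m. (-1) ^ (m - j) * real (w choose j))"
proof -
  have "(real w + (-1)) gchoose m = (\<Sum>j\<in>{0..m}. (real w gchoose j) * ((-1) gchoose (m - j)))"
    by (rule gbinomial_Vandermonde[symmetric])
  thus ?thesis
    by (simp add: gchoose_minus_one binomial_gbinomial mult.commute atLeast0AtMost)
qed

lemma rough_iff:
  assumes "n \<ge> 1"
  shows "least_prime_factor n > ereal y \<longleftrightarrow> (\<forall>p\<in>primes_upto y. \<not> p dvd n)"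
proof (cases "n = 1")
  case True
  thus ?thesis by (auto simp: least_prime_factor_def dest: primes_uptoD)
next
  case False
  hence "prime_factors n \<noteq> {}" using assms by (auto simp: prime_factorization_empty_iff)
  hence "least_prime_factor n > ereal y \<longleftrightarrow> (\<forall>p\<in>prime_factors n. real p > y)"
  proof -
    have "least_prime_factor n > ereal y \<longleftrightarrow> real (Min (prime_factors n)) > y"
      using False by (simp add: least_prime_factor_def)
    also have "\<dots> \<longleftrightarrow> (\<forall>p\<in>prime_factors n. real p > y)"
      using \<open>prime_factors n \<noteq> {}\<close> 
      by (metis Min_in Min_le List.finite_set finite_set_mset of_nat_le_iff order_less_le_trans)
    finally show ?thesis .
  qed
  thus ?thesis using assms by (auto simp: primes_upto_def prime_factors_dvd not_le)
qed

lemma M_omega_eq_squarefree: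
  "M_omega k x y = (\<Sum>n\<in>squarefree_upto (primes_upto y) x. (-1) ^ omega n * ((real (omega n) - 1) gchoose (k - 1)))"
proof -
  have "finite {n::nat. 1 \<le> n \<and> real n \<le> x \<and> least_prime_factor n > ereal y}"
    by (rule finite_subset[OF _ finite_nat_le_real[of x "\<lambda>_. True"]]) auto
  thus ?thesis unfolding M_omega_def
    by (intro sum.mono_neutral_cong_right)
       (auto simp: squarefree_upto_def rough_iff moebius_def omega_def)
qed

lemma M_omega_eq_omega_sum:
  "M_omega k x y = (\<Sum>j\<le>k - 1. (-1) ^ (k - 1 - j) * omega_sum (-1) j (primes_upto y) x)"
  unfolding M_omega_eq_squarefree gbinomial_minus_one_eq omega_sum_def sum_distrib_left
  by (subst sum.swap) (simp add: mult.left_commute)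

lemma abs_M_omega_le_omega_sum:
  "\<bar>M_omega k x y\<bar> \<le> (\<Sum>j\<le>k - 1. omega_sum 1 j (primes_upto y) x)"
proof -
  have "\<bar>M_omega k x y\<bar> \<le> (\<Sum>j\<le>k - 1. \<bar>(-1) ^ (k - 1 - j) * omega_sum (-1) j (primes_upto y) x\<bar>)"
    unfolding M_omega_eq_omega_sum by (rule sum_abs)
  also have "\<dots> \<le> (\<Sum>j\<le>k - 1. omega_sum 1 j (primes_upto y) x)"
  proof (rule sum_mono)
    fix j
    have "\<bar>omega_sum (-1) j (primes_upto y) x\<bar>
        \<le> (\<Sum>n\<in>squarefree_upto (primes_upto y) x. \<bar>(-1) ^ omega n * real (omega n choose j)\<bar>)"
      unfolding omega_sum_def by (rule sum_abs)
    also have "\<dots> = omega_sum 1 j (primes_upto y) x"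
      by (simp add: omega_sum_def abs_mult power_abs)
    finally show "\<bar>(-1) ^ (k - 1 - j) * omega_sum (-1) j (primes_upto y) x\<bar> \<le> omega_sum 1 j (primes_upto y) x"
      by (simp add: abs_mult power_abs)
  qed
  finally show ?thesis .
qed

text \<open>Trivial bound for each term times the number of terms.\<close>

lemma M_omega_sieve_bound:
  assumes y: "2 \<le> y" "y \<le> x"
  shows "\<bar>M_omega k x y\<bar> \<le> 12 * x / ln y * (ln x / ln y) ^ (k - 1)"
proof -
  let ?Q = "squarefree_upto (primes_upto y) x"
  have u: "ln x / ln y \<ge> 1" using y by (subst le_divide_eq_1_pos) auto
  have "\<bar>M_omega k x y\<bar> \<le> (\<Sum>n\<in>?Q. \<bar>(-1) ^ omega n * ((real (omega n) - 1) gchoose (k - 1))\<bar>)"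
    unfolding M_omega_eq_squarefree by (rule sum_abs)
  also have "\<dots> \<le> (\<Sum>n\<in>?Q. (ln x / ln y) ^ (k - 1))"
  proof (rule sum_mono)
    fix n assume n: "n \<in> ?Q"
    have "\<bar>(real (omega n) - 1) gchoose (k - 1)\<bar> \<le> (ln x / ln y) ^ (k - 1)"
    proof (cases "omega n")
      case 0
      thus ?thesis using u by (simp add: gchoose_minus_one power_abs one_le_power)
    next
      case (Suc w)
      have "\<bar>(real (omega n) - 1) gchoose (k - 1)\<bar> = real (w choose (k - 1))"
        using Suc by (simp add: binomial_gbinomial[symmetric])
      also have "\<dots> \<le> real (omega n) ^ (k - 1)"
      proof (cases "k - 1 \<le> w")
        case True
        have "real (w choose (k - 1)) \<le> real (w ^ (k - 1))"
          using binomial_le_pow[OF True] of_nat_le_iff by blast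
        also have "\<dots> = real w ^ (k - 1)" by simp
        also have "\<dots> \<le> real (omega n) ^ (k - 1)" using Suc by (intro power_mono) auto
        finally show ?thesis .
      qed (simp add: not_le binomial_eq_0)
      also have "\<dots> \<le> (ln x / ln y) ^ (k - 1)"
        using omega_rough_le[OF y n] by (intro power_mono) auto
      finally show ?thesis .
    qed
    thus "\<bar>(-1) ^ omega n * ((real (omega n) - 1) gchoose (k - 1))\<bar> \<le> (ln x / ln y) ^ (k - 1)"
      by (simp add: abs_mult power_abs)
  qed
  also have "\<dots> = real (card ?Q) * (ln x / ln y) ^ (k - 1)" by simp
  also have "\<dots> \<le> 12 * x / ln y * (ln x / ln y) ^ (k - 1)"
    using u by (intro mult_right_mono card_rough_squarefree_le y) auto
  finally show ?thesis .
qed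

text \<open>On \<open>[1.9, \<infinity>)\<close> the function \<open>log log (x + 1)\<close> is positive and bounded away from \<open>0\<close>, because \<open>e < 2.9\<close>.\<close>

lemma iter_log_le_ln_ln:
  obtains A where "A \<ge> 1" "\<And>x. x \<ge> 1.9 \<Longrightarrow> iter_log x \<le> A * ln (ln (x + 1))"
    "\<And>x. x \<ge> 1.9 \<Longrightarrow> ln (ln (x + 1)) \<ge> 1 / A"
proof -
  define c where "c = ln (ln (2.9::real))"
  have "exp 1 < (2.9::real)" using e_less_272 by simp
  hence "ln (exp 1) < ln (2.9::real)" by (subst ln_less_cancel_iff) auto
  hence l29: "1 < ln (2.9::real)" by simp
  hence c: "c > 0" unfolding c_def by simp
  have ge: "ln (ln (x + 1)) \<ge> c" "ln (x + 1) > 1" if "x \<ge> 1.9" for x :: real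
  proof -
    have "ln (x + 1) \<ge> ln 2.9" using that by (subst ln_le_cancel_iff) auto
    thus "ln (x + 1) > 1" using l29 by linarith
    show "ln (ln (x + 1)) \<ge> c" unfolding c_def
      using \<open>ln (x + 1) \<ge> ln 2.9\<close> l29 by (subst ln_le_cancel_iff) linarith+
  qed
  define A where "A = 2 / c + 1"
  show thesis
  proof (rule that[of A])
    show "A \<ge> 1" using c by (simp add: A_def)
    fix x :: real assume x: "x \<ge> 1.9"
    have "1 / A \<le> c" using c unfolding A_def by (simp add: field_simps)
    thus "ln (ln (x + 1)) \<ge> 1 / A" using ge[OF x] by linarith
    have "ln x \<le> ln (x + 1)" using x by (subst ln_le_cancel_iff) auto
    hence "1 + ln x \<le> 2 * ln (x + 1)" using ge[OF x] by linarith
    moreover have "1 + ln x > 0" using x by (simp add: add_pos_nonneg)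
    ultimately have "ln (1 + ln x) \<le> ln (2 * ln (x + 1))" by (subst ln_le_cancel_iff) auto
    also have "\<dots> = ln 2 + ln (ln (x + 1))" using ge[OF x] by (simp add: ln_mult)
    also have "ln 2 \<le> (1::real)" using ln2_le_25_over_36 by linarith
    finally have "iter_log x \<le> 2 + ln (ln (x + 1))" by (simp add: iter_log_def)
    also have "2 \<le> 2 / c * ln (ln (x + 1))" using ge[OF x] c by (simp add: field_simps)
    finally show "iter_log x \<le> A * ln (ln (x + 1))" by (simp add: A_def algebra_simps)
  qed
qed

text \<open>The sifting condition is dropped, which makes the bound uniform in \<open>y\<close>.\<close>

lemma M_omega_trivial_bound:
  obtains D where "D \<ge> 0" "\<And>x y. x \<ge> 1.9 \<Longrightarrow> \<bar>M_omega k x y\<bar> \<le> D * x * ln (ln (x + 1)) ^ (k - 1)"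
proof -
  obtain A where A: "A \<ge> 1" "\<And>x. x \<ge> 1.9 \<Longrightarrow> iter_log x \<le> A * ln (ln (x + 1))"
    "\<And>x. x \<ge> 1.9 \<Longrightarrow> ln (ln (x + 1)) \<ge> 1 / A" using iter_log_le_ln_ln by blast
  \<comment> \<open>with weight \<open>1\<close> the sums over primes lose \<open>9 e log log x\<close>, and each added prime a factor \<open>7\<close>\<close>
  define E :: real where "E = 7 * (9 * exp 1)"
  have E: "E \<ge> 1" unfolding E_def using exp_ge_add_one_self[of "1::real"] by linarith
  have U: "\<bar>omega_sum 1 j B x\<bar> \<le> E ^ j * 7 ^ card B * x * iter_log x ^ j"
    if "finite B" "\<And>q. q \<in> B \<Longrightarrow> prime q" "x \<ge> 1" for j B x
  proof -
    have "\<bar>omega_sum 1 j B x\<bar> \<le> 1 * (7 * (9 * exp 1)) ^ j * 7 ^ card B * x * iter_log x ^ j * 1"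
    proof (rule omega_sum_bound[where w = "\<lambda>_. 1"])
      fix B :: "nat set" and x :: real assume "x \<ge> 1"
      have "\<bar>omega_sum 1 0 B x\<bar> \<le> x"
        using card_squarefree_upto_le[of x B] \<open>x \<ge> 1\<close> by (simp add: omega_sum_def)
      also have "x \<le> 7 ^ card B * x" using \<open>x \<ge> 1\<close> mult_right_mono[of 1 "7 ^ card B" x] by simp
      finally show "\<bar>omega_sum 1 0 B x\<bar> \<le> 1 * 7 ^ card B * x * 1" by simp
    next
      fix x :: real assume "x \<ge> 1"
      thus "(\<Sum>p\<in>primes_upto x. 1 / real p * 1) \<le> 9 * exp 1 * iter_log x * 1"
        using sum_prime_reciprocals_le by simp
    qed (use that in auto)
    thus ?thesis by (simp add: E_def)
  qed
  show thesis
  proof (rule that[of "real (Suc (k - 1)) * (E * A) ^ (k - 1)"], goal_cases)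
    case 1 show ?case using E A by simp
  next
    case (2 x y)
    hence x1: "x \<ge> 1" by simp
    have ll: "ln (ln (x + 1)) > 0" using A(1) A(3)[OF 2] by (smt (verit) divide_pos_pos)
    have L: "iter_log x \<ge> 1" by (rule iter_log_ge_1[OF x1])
    have "\<bar>M_omega k x y\<bar> \<le> (\<Sum>j\<le>k - 1. omega_sum 1 j (primes_upto y) x)"
      by (rule abs_M_omega_le_omega_sum)
    also have "\<dots> \<le> (\<Sum>j\<le>k - 1. E ^ (k - 1) * x * (A * ln (ln (x + 1))) ^ (k - 1))"
    proof (rule sum_mono)
      fix j assume j: "j \<in> {..k - 1}"
      have "omega_sum 1 j (primes_upto y) x \<le> omega_sum 1 j {} x"
        unfolding omega_sum_def by (rule sum_mono2, rule finite_squarefree_upto) (auto simp: squarefree_upto_def)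
      also have "\<dots> \<le> E ^ j * x * iter_log x ^ j" using U[where B = "{}" and x = x and j = j] x1 by simp
      also have "\<dots> \<le> E ^ (k - 1) * x * iter_log x ^ (k - 1)"
        using E x1 j L by (intro mult_mono power_increasing) auto
      also have "\<dots> \<le> E ^ (k - 1) * x * (A * ln (ln (x + 1))) ^ (k - 1)"
        using E x1 L A(2)[OF 2] by (intro mult_left_mono power_mono) auto
      finally show "omega_sum 1 j (primes_upto y) x \<le> \<dots>" .
    qed
    also have "\<dots> = real (Suc (k - 1)) * (E * A) ^ (k - 1) * x * ln (ln (x + 1)) ^ (k - 1)"
      by (simp add: power_mult_distrib)
    finally show ?case .
  qed
qed

lemma M_omega_upper_bound:
  assumes k: "k \<ge> 1"
  shows "\<exists>B :: real. \<forall>x y :: real. x > 0 \<and> 1.9 \<le> y \<and> y \<le> x powr (1 / real k) \<longrightarrow>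
            M_omega k x y \<le> B * x * ln y * ln (ln (x + 1)) ^ (k - 1)"
proof -
  obtain D where D: "D \<ge> 0" "\<And>x y. x \<ge> 1.9 \<Longrightarrow> \<bar>M_omega k x y\<bar> \<le> D * x * ln (ln (x + 1)) ^ (k - 1)"
    using M_omega_trivial_bound by blast
  obtain A where A: "A \<ge> 1" "\<And>x::real. x \<ge> 1.9 \<Longrightarrow> ln (ln (x + 1)) \<ge> 1 / A"
    using iter_log_le_ln_ln by metis
  show ?thesis
  proof (intro exI[of _ "D / ln 1.9"] allI impI)
    fix x y :: real assume xy: "x > 0 \<and> 1.9 \<le> y \<and> y \<le> x powr (1 / real k)"
    have x: "x \<ge> 1.9"
    proof (rule ccontr)
      assume "\<not> x \<ge> 1.9"
      hence "x < 1.9" by simp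
      have "x powr (1 / real k) < 1.9 powr (1 / real k)"
        using \<open>x < 1.9\<close> xy k by (intro powr_less_mono2) auto
      also have "\<dots> \<le> 1.9 powr 1" using k by (intro powr_mono) auto
      finally show False using xy by simp
    qed
    have ll: "ln (ln (x + 1)) > 0" using A(1) A(2)[OF x] by (smt (verit) divide_pos_pos)
    have "M_omega k x y \<le> D * x * ln (ln (x + 1)) ^ (k - 1) * 1" using D(2)[OF x, of y] by simp
    also have "\<dots> \<le> D * x * ln (ln (x + 1)) ^ (k - 1) * (ln y / ln 1.9)"
      using D x ll xy by (intro mult_left_mono) auto
    finally show "M_omega k x y \<le> D / ln 1.9 * x * ln y * ln (ln (x + 1)) ^ (k - 1)"
      by (simp add: mult_ac)
  qed
qed

text \<open>For \<open>\<kappa> \<le> 0\<close> at most the primes up to \<open>Y0\<close> are sifted out, so the factor \<open>7\<close> for each of them is a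
  constant.\<close>

lemma M_omega_bound_bounded_y:
  assumes k: "k \<ge> 1" and kappa: "\<kappa> \<le> 0" and Y0: "Y0 > 0"
    and moebius_sum: "\<And>x. x \<ge> 1 \<Longrightarrow> \<bar>omega_sum (-1) 0 {} x\<bar> \<le> K * x / (1 + ln x)" and K: "K \<ge> 0"
  shows "\<exists>C. \<forall>x \<ge> 1.9. \<bar>M_omega k x (Y_fun Y0 \<kappa> x)\<bar> \<le> C * (x * ln (ln (x + 1)) ^ k / ln x)"
proof -
  obtain A where A: "A \<ge> 1" "\<And>x. x \<ge> 1.9 \<Longrightarrow> iter_log x \<le> A * ln (ln (x + 1))"
    "\<And>x. x \<ge> 1.9 \<Longrightarrow> ln (ln (x + 1)) \<ge> 1 / A" using iter_log_le_ln_ln by blast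
  define E :: real where "E = 7 * (18 * exp 1)"
  have E: "E \<ge> 1" unfolding E_def using exp_ge_add_one_self[of "1::real"] by linarith
  define N where "N = card (primes_upto Y0)"
  have S: "\<bar>omega_sum (-1) j B x\<bar> \<le> K * E ^ j * 7 ^ card B * x * iter_log x ^ j * (1 / (1 + ln x))"
    if "finite B" "\<And>q. q \<in> B \<Longrightarrow> prime q" "x \<ge> 1" for j B x
    unfolding E_def
  proof (rule omega_sum_bound[where w = "\<lambda>x. 1 / (1 + ln x)"])
    fix B :: "nat set" and x :: real
    assume "finite B" "\<And>q. q \<in> B \<Longrightarrow> prime q" "x \<ge> 1"
    thus "\<bar>omega_sum (-1) 0 B x\<bar> \<le> K * 7 ^ card B * x * (1 / (1 + ln x))"
      using omega_sum_0_coprime_bound[OF moebius_sum _ K, where B = B and x = x] by simp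
  next
    fix x :: real assume "x \<ge> 1"
    thus "(\<Sum>p\<in>primes_upto x. 1 / real p * (1 / (1 + ln (x / real p)))) \<le> 18 * exp 1 * iter_log x * (1 / (1 + ln x))"
      using sum_prime_log_weight_le[of x] by simp
  qed (use that K in auto)
  show ?thesis
  proof (intro exI[of _ "real (Suc (k - 1)) * (K * E ^ k * 7 ^ N * A ^ k)"] allI impI)
    fix x :: real assume x: "x \<ge> 1.9"
    define Y where "Y = Y_fun Y0 \<kappa> x"
    have ll: "ln (ln (x + 1)) > 0" using A(1) A(3)[OF x] by (smt (verit) divide_pos_pos)
    have lx: "ln x > 0" using x by simp
    have "\<kappa> * (ln x / ln (ln (x + 1))) \<le> 0"
      using kappa ll lx by (intro mult_nonpos_nonneg) auto
    hence "Y \<le> Y0" unfolding Y_def Y_fun_def using Y0 by (simp add: mult_le_cancel_left1)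
    hence "primes_upto Y \<subseteq> primes_upto Y0" by (auto simp: primes_upto_def)
    hence cN: "card (primes_upto Y) \<le> N" unfolding N_def by (intro card_mono) auto
    have L: "iter_log x \<ge> 1" by (rule iter_log_ge_1) (use x in simp)
    have "\<bar>M_omega k x Y\<bar> \<le> (\<Sum>j\<le>k - 1. \<bar>(-1) ^ (k - 1 - j) * omega_sum (-1) j (primes_upto Y) x\<bar>)"
      unfolding M_omega_eq_omega_sum by (rule sum_abs)
    also have "\<dots> \<le> (\<Sum>j\<le>k - 1. K * E ^ k * 7 ^ N * x * (A * ln (ln (x + 1))) ^ k * (1 / ln x))"
    proof (rule sum_mono)
      fix j assume j: "j \<in> {..k - 1}"
      have "\<bar>(-1) ^ (k - 1 - j) * omega_sum (-1) j (primes_upto Y) x\<bar> = \<bar>omega_sum (-1) j (primes_upto Y) x\<bar>"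
        by (simp add: abs_mult power_abs)
      also have "\<dots> \<le> K * E ^ j * 7 ^ card (primes_upto Y) * x * iter_log x ^ j * (1 / (1 + ln x))"
        using x by (intro S) (auto dest: primes_uptoD)
      also have "\<dots> \<le> K * E ^ k * 7 ^ N * x * iter_log x ^ k * (1 / ln x)"
        using E K x j L cN lx by (intro mult_mono power_increasing divide_left_mono mult_nonneg_nonneg mult_pos_pos add_pos_pos) auto
      also have "\<dots> \<le> K * E ^ k * 7 ^ N * x * (A * ln (ln (x + 1))) ^ k * (1 / ln x)"
        using E K x L A(2)[OF x] lx by (intro mult_right_mono mult_left_mono power_mono) auto
      finally show "\<bar>(-1) ^ (k - 1 - j) * omega_sum (-1) j (primes_upto Y) x\<bar> \<le> \<dots>" .
    qed
    also have "\<dots> = real (Suc (k - 1)) * (K * E ^ k * 7 ^ N * A ^ k) * (x * ln (ln (x + 1)) ^ k / ln x)"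
      by (simp add: power_mult_distrib)
    finally show "\<bar>M_omega k x (Y_fun Y0 \<kappa> x)\<bar> \<le> \<dots>" by (simp add: Y_def)
  qed
qed

lemma Y_fun_eventually:
  fixes \<kappa> Y0 :: real
  assumes "\<kappa> > 0" "Y0 > 0"
  obtains X where "X \<ge> 2" "\<And>x. x \<ge> X \<Longrightarrow> 2 \<le> Y_fun Y0 \<kappa> x \<and> Y_fun Y0 \<kappa> x \<le> x \<and>
     ln (Y_fun Y0 \<kappa> x) \<ge> \<kappa> / 2 * (ln x / ln (ln (x + 1)))"
proof -
  have lim: "filterlim (\<lambda>x::real. ln x / ln (ln (x + 1))) at_top at_top" by real_asymp
  have lim2: "((\<lambda>x::real. (ln x / ln (ln (x + 1))) / ln x) \<longlongrightarrow> 0) at_top" by real_asymp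
  have lim3: "((\<lambda>x::real. 1 / ln x) \<longlongrightarrow> 0) at_top" by real_asymp
  have "eventually (\<lambda>x::real. ln x / ln (ln (x + 1)) \<ge> max (2 / \<kappa> * \<bar>ln Y0\<bar>) (2 / \<kappa> * ln 2)) at_top"
    using lim unfolding filterlim_at_top by blast
  moreover have "eventually (\<lambda>x::real. (ln x / ln (ln (x + 1))) / ln x < 1 / (2 * \<kappa>)) at_top"
    using lim2 by (rule order_tendstoD) (use assms in auto)
  moreover have "eventually (\<lambda>x::real. ln x \<ge> 2 * \<bar>ln Y0\<bar>) at_top"
    using ln_at_top by (simp add: filterlim_at_top)
  moreover have "eventually (\<lambda>x::real. x \<ge> 2) at_top" by (rule eventually_ge_at_top)
  ultimately have "eventually (\<lambda>x. 2 \<le> Y_fun Y0 \<kappa> x \<and> Y_fun Y0 \<kappa> x \<le> x \<and>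
     ln (Y_fun Y0 \<kappa> x) \<ge> \<kappa> / 2 * (ln x / ln (ln (x + 1)))) at_top"
  proof eventually_elim
    case (elim x)
    define r where "r = ln x / ln (ln (x + 1))"
    have lx: "ln x > 0" using elim by simp
    have Y: "ln (Y_fun Y0 \<kappa> x) = ln Y0 + \<kappa> * r" "Y_fun Y0 \<kappa> x > 0"
      using assms by (simp_all add: Y_fun_def ln_mult r_def)
    have 1: "\<kappa> / 2 * r \<ge> \<bar>ln Y0\<bar>" "\<kappa> / 2 * r \<ge> ln 2"
      using elim(1) assms unfolding r_def[symmetric] by (auto simp: field_simps)
    have 2: "\<kappa> * r \<le> ln x / 2" using elim(2) assms lx unfolding r_def[symmetric] by (simp add: field_simps)
    have "ln 2 \<le> ln (Y_fun Y0 \<kappa> x)" "ln (Y_fun Y0 \<kappa> x) \<le> ln x" using 1 2 elim(3) Y by linarith+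
    hence "2 \<le> Y_fun Y0 \<kappa> x" "Y_fun Y0 \<kappa> x \<le> x"
      using ln_le_cancel_iff[of 2 "Y_fun Y0 \<kappa> x"] ln_le_cancel_iff[of "Y_fun Y0 \<kappa> x" x] Y(2) elim(4)
      by auto
    moreover have "ln (Y_fun Y0 \<kappa> x) \<ge> \<kappa> / 2 * r" using 1 Y by linarith
    ultimately show ?case by (simp add: r_def)
  qed
  then obtain X0 where "\<And>x. x \<ge> X0 \<Longrightarrow> 2 \<le> Y_fun Y0 \<kappa> x \<and> Y_fun Y0 \<kappa> x \<le> x \<and>
     ln (Y_fun Y0 \<kappa> x) \<ge> \<kappa> / 2 * (ln x / ln (ln (x + 1)))"
    by (auto simp: eventually_at_top_linorder)
  thus thesis by (intro that[of "max 2 X0"]) auto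
qed

text \<open>For large \<open>x\<close> the sieve bound applies with \<open>log x / log Y(x) = O(log log x)\<close>; on the remaining bounded
  range of \<open>x\<close> the trivial bound is enough.\<close>

lemma M_omega_bound_large_y:
  assumes k: "k \<ge> 1" and kappa: "\<kappa> > 0" and Y0: "Y0 > 0"
  shows "\<exists>C. \<forall>x \<ge> 1.9. \<bar>M_omega k x (Y_fun Y0 \<kappa> x)\<bar> \<le> C * (x * ln (ln (x + 1)) ^ k / ln x)"
proof -
  obtain X where X: "X \<ge> 2" "\<And>x. x \<ge> X \<Longrightarrow> 2 \<le> Y_fun Y0 \<kappa> x \<and> Y_fun Y0 \<kappa> x \<le> x \<and>
     ln (Y_fun Y0 \<kappa> x) \<ge> \<kappa> / 2 * (ln x / ln (ln (x + 1)))"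
    using Y_fun_eventually[OF kappa Y0] by blast
  obtain A where A: "A \<ge> 1" "\<And>x::real. x \<ge> 1.9 \<Longrightarrow> ln (ln (x + 1)) \<ge> 1 / A"
    using iter_log_le_ln_ln by metis
  obtain D where D: "D \<ge> 0" "\<And>x y. x \<ge> 1.9 \<Longrightarrow> \<bar>M_omega k x y\<bar> \<le> D * x * ln (ln (x + 1)) ^ (k - 1)"
    using M_omega_trivial_bound by blast
  define C where "C = D * A * ln X + 12 * (2 / \<kappa>) ^ k"
  show ?thesis
  proof (intro exI[of _ C] allI impI)
    fix x :: real assume x: "x \<ge> 1.9"
    define l where "l = ln (ln (x + 1))"
    have l: "l \<ge> 1 / A" "l > 0" using A(1) A(2)[OF x] unfolding l_def by (smt (verit) divide_pos_pos)+
    have lx: "ln x > 0" using x by simp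
    have kk: "l ^ k = l * l ^ (k - 1)" using k by (cases k) auto
    define R where "R = x * l ^ k / ln x"
    have R: "R \<ge> 0" using x l lx by (simp add: R_def)
    have "\<bar>M_omega k x (Y_fun Y0 \<kappa> x)\<bar> \<le> C * R"
    proof (cases "x \<ge> X")
      case True
      define y where "y = Y_fun Y0 \<kappa> x"
      have y: "2 \<le> y" "y \<le> x" "ln y \<ge> \<kappa> / 2 * (ln x / l)"
        using X(2)[OF True] unfolding y_def l_def by auto
      have ly: "ln y > 0" using y by simp
      have u: "ln x / ln y \<le> 2 / \<kappa> * l" using y(3) ly kappa l(2) by (simp add: field_simps)
      have "\<bar>M_omega k x y\<bar> \<le> 12 * x / ln y * (ln x / ln y) ^ (k - 1)"
        by (rule M_omega_sieve_bound) fact+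
      also have "\<dots> = 12 * x / ln x * (ln x / ln y) ^ k"
        using k lx by (cases k) (auto simp: field_simps)
      also have "\<dots> \<le> 12 * x / ln x * (2 / \<kappa> * l) ^ k"
        using u x lx ly by (intro mult_left_mono power_mono) auto
      also have "\<dots> = 12 * (2 / \<kappa>) ^ k * R" by (simp add: R_def power_mult_distrib power_divide mult_ac)
      also have "\<dots> \<le> C * R"
        using R D A X by (intro mult_right_mono) (auto simp: C_def)
      finally show ?thesis by (simp add: y_def)
    next
      case False
      have "\<bar>M_omega k x (Y_fun Y0 \<kappa> x)\<bar> \<le> D * x * l ^ (k - 1)" using D(2)[OF x] by (simp add: l_def)
      also have "\<dots> = D * x * l ^ (k - 1) * 1" by simp
      also have "\<dots> \<le> D * x * l ^ (k - 1) * ((A * l) * (ln X / ln x))"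
      proof (rule mult_left_mono)
        have "A * l \<ge> 1" using l A(1) by (simp add: field_simps)
        moreover have "ln X / ln x \<ge> 1" using False x lx by simp
        ultimately show "1 \<le> (A * l) * (ln X / ln x)" using mult_mono[of 1 "A * l" 1 "ln X / ln x"] by simp
      qed (use D x l in auto)
      also have "\<dots> = D * A * ln X * R" by (simp add: R_def kk)
      also have "\<dots> \<le> C * R" using R kappa by (intro mult_right_mono) (auto simp: C_def)
      finally show ?thesis .
    qed
    thus "\<bar>M_omega k x (Y_fun Y0 \<kappa> x)\<bar> \<le> C * (x * ln (ln (x + 1)) ^ k / ln x)"
      by (simp add: R_def l_def)
  qed
qed

theorem proposition5p1:
  fixes k :: nat
  assumes "k \<ge> 1"
  shows "(\<forall>Y0 > 0. \<forall>\<kappa> :: real. \<exists>C :: real. \<forall>x :: real. x \<ge> 1.9 \<longrightarrow>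
            \<bar>M_omega k x (Y_fun Y0 \<kappa> x)\<bar> \<le> C * (x * ln (ln (x + 1)) ^ k / ln x)) \<and>
         (\<exists>B :: real. \<forall>x y :: real. x > 0 \<and> 1.9 \<le> y \<and> y \<le> x powr (1 / real k) \<longrightarrow>
            M_omega k x y \<le> B * x * ln y * ln (ln (x + 1)) ^ (k - 1))"
proof (intro conjI allI impI)
  fix Y0 \<kappa> :: real assume Y0: "Y0 > 0"
  obtain K where K: "K \<ge> 0" "\<And>x. x \<ge> 1 \<Longrightarrow> \<bar>omega_sum (-1) 0 {} x\<bar> \<le> K * x / (1 + ln x)"
    using moebius_sum_bound by metis
  have "\<exists>C. \<forall>x \<ge> 1.9. \<bar>M_omega k x (Y_fun Y0 \<kappa> x)\<bar> \<le> C * (x * ln (ln (x + 1)) ^ k / ln x)"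
  proof (cases "\<kappa> \<le> 0")
    case True
    show ?thesis by (rule M_omega_bound_bounded_y[OF assms True Y0 K(2,1)])
  next
    case False
    thus ?thesis using M_omega_bound_large_y[OF assms _ Y0] by simp
  qed
  thus "\<exists>C. \<forall>x. x \<ge> 1.9 \<longrightarrow> \<bar>M_omega k x (Y_fun Y0 \<kappa> x)\<bar> \<le> C * (x * ln (ln (x + 1)) ^ k / ln x)"
    by simp
next
  show "\<exists>B :: real. \<forall>x y :: real. x > 0 \<and> 1.9 \<le> y \<and> y \<le> x powr (1 / real k) \<longrightarrow>
            M_omega k x y \<le> B * x * ln y * ln (ln (x + 1)) ^ (k - 1)"
    by (rule M_omega_upper_bound[OF assms])
qed

end
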